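(* Let $V$ be a finite set and let $f:2^V\to\mathbb{Z}$ be a submodular function. For a constant positive integer $k$, let $\mathcal{F}\subseteq 2^V$ be the intersection of the complements of $k$ lattices, i.e. $\mathcal{F}=\bigcap_{i=1}^k(2^V\setminus\mathcal{L}_i)$ for some lattices $\mathcal{L}_1,\ldots,\mathcal{L}_k\subseteq 2^V$. Suppose that we are given a membership oracle for $\mathcal{F}$. Then a minimizer of $f$ over $\mathcal{F}$ can be obtained in polynomial time.
   Context: A set function $f:2^V\to\mathbb{Z}$ is submodular if $f(X)+f(Y)\ge f(X\cup Y)+f(X\cap Y)$ for all $X,Y\subseteq V$. It is accessed in the evaluation oracle model, i.e. through an oracle returning $f(X)$ for any given $X\subseteq V$. A family $\mathcal{L}\subseteq 2^V$ is a lattice if for all $X,Y\in\mathcal{L}$ we have $X\cup Y,X\cap Y\in\mathcal{L}$. A membership oracle for $\mathcal{F}$ decides, for any given $X\subseteq V$, whether $X\in\mathcal{F}$. Polynomial time means polynomial in $n=|V|$ for fixed $k$ (the polynomial may depend on $k$), counting oracle queries (for $f$ and for $\mathcal{F}$) and elementary operations. A minimizer of $f$ over a family $\mathcal{G}\subseteq 2^V$ is a set $X\in\mathcal{G}$ with $f(X)\le f(Y)$ for all $Y\in\mathcal{G}$; the algorithm is required to output one whenever $\mathcal{G}$ is nonempty. *)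

theory Defs
  imports Main "HOL-Computational_Algebra.Polynomial"
begin

section \<open>Submodular functions, lattices of sets, minimizers\<close>

definition submodular_on :: "'a set \<Rightarrow> ('a set \<Rightarrow> int) \<Rightarrow> bool" where
  "submodular_on V f \<longleftrightarrow>
     (\<forall>X Y. X \<subseteq> V \<longrightarrow> Y \<subseteq> V \<longrightarrow> f X + f Y \<ge> f (X \<union> Y) + f (X \<inter> Y))"

definition set_lattice :: "'a set set \<Rightarrow> bool" where
  "set_lattice L \<longleftrightarrow> (\<forall>X\<in>L. \<forall>Y\<in>L. X \<union> Y \<in> L \<and> X \<inter> Y \<in> L)"

definition minimizer :: "('a set \<Rightarrow> int) \<Rightarrow> 'a set set \<Rightarrow> 'a set \<Rightarrow> bool" where
  "minimizer f G X \<longleftrightarrow> X \<in> G \<and> (\<forall>Y\<in>G. f X \<le> f Y)"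

section \<open>Programs with an evaluation oracle and a membership oracle\<close>

text \<open>
  Algorithms are programs of a while language over integer arrays. A program is a finite syntactic
  object that does not depend on the instance. Its elementary operations are memory access,
  addition, subtraction, multiplication, comparison, Boolean connectives and branching, each at unit
  cost, on integers of any size (oracle values are unbounded, and the running time is to be bounded
  in terms of the size of the ground set alone). There is deliberately no division with rounding:
  exact rational arithmetic is available through pairs of integers, whereas unit-cost rounding would
  go beyond the usual elementary operations.
\<close>

type_synonym vname = string

text \<open>Every variable is an array; a scalar is an array of which only the cell 0 is used.\<close>

type_synonym state = "vname \<Rightarrow> int \<Rightarrow> int"

datatype aexp =
    Const int
  | Read vname aexp
  | Add aexp aexp
  | Sub aexp aexp
  | Mul aexp aexp

datatype bexp =
    Less aexp aexp
  | Equal aexp aexp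
  | BNot bexp
  | BAnd bexp bexp

text \<open>
  The command \<open>AskValue x i a\<close> stores in cell \<open>i\<close> of \<open>x\<close> the answer of the evaluation oracle on the
  set represented by the array \<open>a\<close>; \<open>AskMember\<close> does the same for the membership oracle, with the
  answers 1 (yes) and 0 (no).
\<close>

datatype com =
    Skip
  | Assign vname aexp aexp
  | AskValue vname aexp vname
  | AskMember vname aexp vname
  | Seq com com
  | Cond bexp com com
  | While bexp com

fun aval :: "aexp \<Rightarrow> state \<Rightarrow> int" where
  "aval (Const c) s = c"
| "aval (Read a i) s = s a (aval i s)"
| "aval (Add d e) s = aval d s + aval e s"
| "aval (Sub d e) s = aval d s - aval e s"
| "aval (Mul d e) s = aval d s * aval e s"

fun bval :: "bexp \<Rightarrow> state \<Rightarrow> bool" where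
  "bval (Less d e) s \<longleftrightarrow> aval d s < aval e s"
| "bval (Equal d e) s \<longleftrightarrow> aval d s = aval e s"
| "bval (BNot b) s \<longleftrightarrow> \<not> bval b s"
| "bval (BAnd b c) s \<longleftrightarrow> bval b s \<and> bval c s"

fun acost :: "aexp \<Rightarrow> nat" where
  "acost (Const c) = 1"
| "acost (Read a i) = acost i + 1"
| "acost (Add d e) = acost d + acost e + 1"
| "acost (Sub d e) = acost d + acost e + 1"
| "acost (Mul d e) = acost d + acost e + 1"

fun bcost :: "bexp \<Rightarrow> nat" where
  "bcost (Less d e) = acost d + acost e + 1"
| "bcost (Equal d e) = acost d + acost e + 1"
| "bcost (BNot b) = bcost b + 1"
| "bcost (BAnd b c) = bcost b + bcost c + 1"

definition store :: "state \<Rightarrow> vname \<Rightarrow> int \<Rightarrow> int \<Rightarrow> state" where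
  "store s x i v = s(x := (s x)(i := v))"

text \<open>Subsets of \<open>{..<n}\<close> are represented by arrays: \<open>j\<close> is an element iff cell \<open>j\<close> is nonzero.\<close>

definition array_set :: "nat \<Rightarrow> (int \<Rightarrow> int) \<Rightarrow> nat set" where
  "array_set n r = {j. j < n \<and> r (int j) \<noteq> 0}"

text \<open>
  \<open>exec n val mem c s t s'\<close>: with the oracles \<open>val\<close> and \<open>mem\<close> on subsets of \<open>{..<n}\<close>, the program \<open>c\<close>
  started in \<open>s\<close> terminates in \<open>s'\<close>, and \<open>t\<close> is the total number of elementary operations and oracle
  queries.
\<close>

inductive exec ::
  "nat \<Rightarrow> (nat set \<Rightarrow> int) \<Rightarrow> (nat set \<Rightarrow> bool) \<Rightarrow> com \<Rightarrow> state \<Rightarrow> nat \<Rightarrow> state \<Rightarrow> bool"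
  for n :: nat and val :: "nat set \<Rightarrow> int" and mem :: "nat set \<Rightarrow> bool"
where
  Skip: "exec n val mem Skip s 1 s"
| Assign: "exec n val mem (Assign x i e) s (acost i + acost e + 1)
    (store s x (aval i s) (aval e s))"
| AskValue: "exec n val mem (AskValue x i a) s (acost i + 1)
    (store s x (aval i s) (val (array_set n (s a))))"
| AskMember: "exec n val mem (AskMember x i a) s (acost i + 1)
    (store s x (aval i s) (if mem (array_set n (s a)) then 1 else 0))"
| Seq: "exec n val mem c s t s' \<Longrightarrow> exec n val mem d s' u s'' \<Longrightarrow>
    exec n val mem (Seq c d) s (t + u) s''"
| CondTrue: "bval b s \<Longrightarrow> exec n val mem c s t s' \<Longrightarrow>
    exec n val mem (Cond b c d) s (bcost b + t + 1) s'"
| CondFalse: "\<not> bval b s \<Longrightarrow> exec n val mem d s t s' \<Longrightarrow>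
    exec n val mem (Cond b c d) s (bcost b + t + 1) s'"
| WhileFalse: "\<not> bval b s \<Longrightarrow> exec n val mem (While b c) s (bcost b + 1) s"
| WhileTrue: "bval b s \<Longrightarrow> exec n val mem c s t s' \<Longrightarrow>
    exec n val mem (While b c) s' u s'' \<Longrightarrow>
    exec n val mem (While b c) s (bcost b + t + u + 1) s''"

inductive_cases exec_SkipE: "exec n val mem Skip s t s'"
inductive_cases exec_AssignE: "exec n val mem (Assign x i e) s t s'"
inductive_cases exec_AskValueE: "exec n val mem (AskValue x i a) s t s'"
inductive_cases exec_AskMemberE: "exec n val mem (AskMember x i a) s t s'"
inductive_cases exec_SeqE: "exec n val mem (Seq c d) s t s'"
inductive_cases exec_CondE: "exec n val mem (Cond b c d) s t s'"
inductive_cases exec_WhileE: "exec n val mem (While b c) s t s'"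

lemma exec_deterministic:
  "exec n val mem c s t s' \<Longrightarrow> exec n val mem c s u s'' \<Longrightarrow> u = t \<and> s'' = s'"
proof (induction arbitrary: u s'' rule: exec.induct)
  case Skip
  then show ?case by (auto elim: exec_SkipE)
next
  case Assign
  then show ?case by (auto elim: exec_AssignE)
next
  case AskValue
  then show ?case by (auto elim: exec_AskValueE)
next
  case AskMember
  then show ?case by (auto elim: exec_AskMemberE)
next
  case Seq
  from Seq.prems show ?case by (rule exec_SeqE) (auto dest!: Seq.IH)
next
  case CondTrue
  from CondTrue.prems show ?case by (rule exec_CondE) (auto simp: CondTrue.hyps(1) dest!: CondTrue.IH)
next
  case CondFalse
  from CondFalse.prems show ?case by (rule exec_CondE) (auto simp: CondFalse.hyps(1) dest!: CondFalse.IH)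
next
  case WhileFalse
  from WhileFalse.prems show ?case by (rule exec_WhileE) (auto simp: WhileFalse.hyps)
next
  case WhileTrue
  from WhileTrue.prems show ?case by (rule exec_WhileE) (auto simp: WhileTrue.hyps(1) dest!: WhileTrue.IH)
qed

definition input_state :: "nat \<Rightarrow> state" where
  "input_state n = store (\<lambda>x i. 0) ''n'' 0 (int n)"

text \<open>
  The numbering \<open>e\<close> of the ground set \<open>V\<close> lets a program, which only sees the indices below \<open>card V\<close>,
  address the elements of \<open>V\<close>. The input is \<open>card V\<close> and the two oracles, and the output is the set
  represented by the array \<open>''X''\<close>. The time bound is also required if \<open>F\<close> is empty.
\<close>

definition finds_minimizer_within ::
  "com \<Rightarrow> nat \<Rightarrow> (nat \<Rightarrow> 'a) \<Rightarrow> 'a set \<Rightarrow> ('a set \<Rightarrow> int) \<Rightarrow> 'a set set \<Rightarrow> bool"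
where
  "finds_minimizer_within c T e V f F \<longleftrightarrow>
     (\<exists>t s. exec (card V) (\<lambda>S. f (e ` S)) (\<lambda>S. e ` S \<in> F) c (input_state (card V)) t s \<and>
        t \<le> T \<and>
        (F \<noteq> {} \<longrightarrow> minimizer f F (e ` array_set (card V) (s ''X''))))"

end

theory Submission
  imports Defs
begin

text \<open>
  If \<open>X\<close> is neither \<open>{}\<close> nor \<open>V\<close> and not in a lattice \<open>L\<close>, then there are \<open>u \<in> X\<close> and \<open>v \<in> V - X\<close> such
  that no member of \<open>L\<close> contains \<open>u\<close> but not \<open>v\<close>: otherwise \<open>X\<close> would be a union of intersections of
  members of \<open>L\<close>. Hence for every such \<open>X \<in> F\<close> there are sets \<open>A \<subseteq> X\<close> and \<open>B \<subseteq> V - X\<close> with at most \<open>k\<close>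
  elements each such that all sets between \<open>A\<close> and \<open>V - B\<close> belong to \<open>F\<close>. It therefore suffices to
  minimize \<open>f\<close> between \<open>A\<close> and \<open>V - B\<close> for all of the polynomially many pairs \<open>(A, B)\<close>, and to keep the
  best of the minimizers that the membership oracle accepts, together with \<open>{}\<close> and \<open>V\<close>.

  The unconstrained minimizations use Schrijver's strongly polynomial algorithm with distance labels
  in place of shortest paths. It maintains a nonnegative combination \<open>x\<close> of greedy bases given by
  linear orders, and labels \<open>d\<close> that vanish where \<open>x\<close> is positive and grow by at most one along every
  pair that is increasing in one of the orders. When all elements with \<open>x < 0\<close> have label \<open>n\<close>, some
  value \<open>j \<le> n\<close> is missing among the labels, and the set of elements with label greater than \<open>j\<close> is a
  lower set of all orders, hence tight, and a minimizer. As arithmetic on integers of any size has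
  unit cost, the weights of the combination are kept as integers up to a common positive factor.
\<close>


section \<open>Loop programs\<close>

text \<open>The time bound may depend on \<open>n\<close> only, while values are unbounded and there
  is no rounding division. So every rational step is a cross multiplication, and common factors of
  the weights are never removed: signs and comparisons of ratios do not see a positive factor.
  Optimality is therefore stated relative to the total weight W, as x(U) = W (g U - g {}).

  Running times come from the syntax; the real task is to show that a fixed number of rounds
  suffices. The measure has five digits in base B = (n + 3)^2, which gives B^5 = (n + 3)^10 rounds.
  A finished state stays finished, so surplus rounds do no harm. Polynomially many digits require
  few orders: a push adds \<open>n\<close> of them, and Caratheodory reductions bring their number
  back to at most n + 1.

  The program never learns which pair (A, B) is a certificate for membership, nor which label is
  missing. It tries all pairs and all n + 1 label thresholds. A wrong guess is harmless, because
  only sets accepted by the membership oracle are kept and the stored value only decreases.\<close>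

text \<open>
  \<open>PFor x a b c\<close> runs \<open>c\<close> exactly \<open>a * n + b\<close> times, so that a program denotes a total function on
  states and its running time is polynomial by construction.
\<close>

datatype prog =
    PSkip
  | PAssign vname aexp aexp
  | PValue vname aexp vname
  | PMember vname aexp vname
  | PSeq prog prog (infixr ";;" 60)
  | PCond bexp prog prog
  | PFor vname nat nat prog

fun compile :: "prog \<Rightarrow> com" where
  "compile PSkip = Skip"
| "compile (PAssign x i e) = Assign x i e"
| "compile (PValue x i a) = AskValue x i a"
| "compile (PMember x i a) = AskMember x i a"
| "compile (PSeq c d) = Seq (compile c) (compile d)"
| "compile (PCond b c d) = Cond b (compile c) (compile d)"
| "compile (PFor x a b c) = Seq (Assign x (Const 0) (Const 0))
    (While (Less (Read x (Const 0)) (Add (Mul (Const (int a)) (Read ''n'' (Const 0))) (Const (int b))))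
      (Seq (compile c) (Assign x (Const 0) (Add (Read x (Const 0)) (Const 1)))))"

fun sem :: "nat \<Rightarrow> (nat set \<Rightarrow> int) \<Rightarrow> (nat set \<Rightarrow> bool) \<Rightarrow> prog \<Rightarrow> state \<Rightarrow> state" where
  "sem n val mem PSkip s = s"
| "sem n val mem (PAssign x i e) s = store s x (aval i s) (aval e s)"
| "sem n val mem (PValue x i a) s = store s x (aval i s) (val (array_set n (s a)))"
| "sem n val mem (PMember x i a) s = store s x (aval i s) (if mem (array_set n (s a)) then 1 else 0)"
| "sem n val mem (PSeq c d) s = sem n val mem d (sem n val mem c s)"
| "sem n val mem (PCond b c d) s = (if bval b s then sem n val mem c s else sem n val mem d s)"
| "sem n val mem (PFor x a b c) s =
    fold (\<lambda>i s. store (sem n val mem c s) x 0 (int (Suc i))) [0..<a * n + b] (store s x 0 0)"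

declare sem.simps(7) [simp del]

fun written :: "prog \<Rightarrow> vname set" where
  "written PSkip = {}"
| "written (PAssign x i e) = {x}"
| "written (PValue x i a) = {x}"
| "written (PMember x i a) = {x}"
| "written (PSeq c d) = written c \<union> written d"
| "written (PCond b c d) = written c \<union> written d"
| "written (PFor x a b c) = insert x (written c)"

text \<open>In \<open>sem\<close> the counter values are dictated by the fold, whereas the compiled
  loop reads the counter back from the state and increments it. The two agree only if the body
  leaves its counter alone.\<close>

fun counters_safe :: "prog \<Rightarrow> bool" where
  "counters_safe (PSeq c d) \<longleftrightarrow> counters_safe c \<and> counters_safe d"
| "counters_safe (PCond b c d) \<longleftrightarrow> counters_safe c \<and> counters_safe d"
| "counters_safe (PFor x a b c) \<longleftrightarrow> x \<notin> written c \<and> counters_safe c"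
| "counters_safe c \<longleftrightarrow> True"

text \<open>For a loop, initializing the counter costs 3, each round costs 16 beyond its body and
  the final test costs 10; 16 and 10 are both rounded up to 20. Both branches of a conditional are
  added because a maximum of polynomials is not a polynomial.\<close>

fun time_poly :: "prog \<Rightarrow> nat poly" where
  "time_poly PSkip = 1"
| "time_poly (PAssign x i e) = [:acost i + acost e + 1:]"
| "time_poly (PValue x i a) = [:acost i + 1:]"
| "time_poly (PMember x i a) = [:acost i + 1:]"
| "time_poly (PSeq c d) = time_poly c + time_poly d"
| "time_poly (PCond b c d) = [:bcost b + 1:] + time_poly c + time_poly d"
| "time_poly (PFor x a b c) = [:23:] + [:b, a:] * (time_poly c + [:20:])"

lemma store_other [simp]: "y \<noteq> x \<Longrightarrow> store s x i v y = s y"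
  by (simp add: store_def)

lemma store_same [simp]: "store s x i v x = (s x)(i := v)"
  by (simp add: store_def)

lemma sem_unwritten: "y \<notin> written c \<Longrightarrow> sem n val mem c s y = s y"
proof (induction c arbitrary: s)
  case (PFor x a b c)
  note sem.simps(7) [simp]
  have "fold (\<lambda>i s. store (sem n val mem c s) x 0 (int (Suc i))) is s y = s y" for "is" s
    by (induction "is" arbitrary: s) (use PFor in auto)
  then show ?case using PFor by simp
qed auto

text \<open>Packages what every loop proof needs: the counter value, the frame condition for
  variables that the body does not write, and the invariant. \<open>N\<close> is a separate premise
  so that \<open>1 * n + 0\<close> can be presented as \<open>n\<close>.\<close>

lemma For_induct:
  assumes init: "I 0 (store s x 0 0)"
    and step: "\<And>i t. i < a * n + b \<Longrightarrow> t x 0 = int i \<Longrightarrow>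
      (\<And>y. y \<noteq> x \<Longrightarrow> y \<notin> written c \<Longrightarrow> t y = s y) \<Longrightarrow> I i t \<Longrightarrow>
      I (Suc i) (store (sem n val mem c t) x 0 (int (Suc i)))"
    and N: "N = a * n + b"
  shows "I N (sem n val mem (PFor x a b c) s)"
proof -
  let ?f = "\<lambda>i s. store (sem n val mem c s) x 0 (int (Suc i))"
  have "k \<le> a * n + b \<Longrightarrow> I k (fold ?f [0..<k] (store s x 0 0)) \<and>
      fold ?f [0..<k] (store s x 0 0) x 0 = int k \<and>
      (\<forall>y. y \<noteq> x \<longrightarrow> y \<notin> written c \<longrightarrow> fold ?f [0..<k] (store s x 0 0) y = s y)" for k
  proof (induction k)
    case 0
    then show ?case using init by simp
  next
    case (Suc k)
    let ?t = "fold ?f [0..<k] (store s x 0 0)"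
    have "I (Suc k) (?f k ?t)"
      by (rule step) (use Suc in auto)
    then show ?case using Suc by (simp add: sem_unwritten)
  qed
  then show ?thesis using N by (simp add: sem.simps(7))
qed

lemma compile_correct:
  assumes "counters_safe c" "''n'' \<notin> written c" "s ''n'' 0 = int n"
  shows "\<exists>t. t \<le> poly (time_poly c) n \<and> exec n val mem (compile c) s t (sem n val mem c s)"
  using assms
proof (induction c arbitrary: s)
  case PSkip
  show ?case using exec.Skip[of n val mem s] by auto
next
  case (PAssign x i e)
  show ?case using exec.Assign[of n val mem x i e s] by auto
next
  case (PValue x i a)
  show ?case using exec.AskValue[of n val mem x i a s] by auto
next
  case (PMember x i a)
  show ?case using exec.AskMember[of n val mem x i a s] by auto
next
  case (PSeq c d)
  obtain t where t: "t \<le> poly (time_poly c) n" "exec n val mem (compile c) s t (sem n val mem c s)"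
    using PSeq by fastforce
  have "sem n val mem c s ''n'' 0 = int n"
    using PSeq.prems by (simp add: sem_unwritten)
  then obtain u where "u \<le> poly (time_poly d) n"
      "exec n val mem (compile d) (sem n val mem c s) u (sem n val mem d (sem n val mem c s))"
    using PSeq by fastforce
  then show ?case
    using exec.Seq[OF t(2)] t(1) by (intro exI[of _ "t + u"]) (simp add: add_mono)
next
  case (PCond b c d)
  show ?case
  proof (cases "bval b s")
    case True
    then obtain t where "t \<le> poly (time_poly c) n" "exec n val mem (compile c) s t (sem n val mem c s)"
      using PCond by fastforce
    then show ?thesis using exec.CondTrue[OF True] True
      by (intro exI[of _ "bcost b + t + 1"]) simp
  next
    case False
    then obtain t where "t \<le> poly (time_poly d) n" "exec n val mem (compile d) s t (sem n val mem d s)"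
      using PCond by fastforce
    then show ?thesis using exec.CondFalse[OF False] False
      by (intro exI[of _ "bcost b + t + 1"]) simp
  qed
next
  case (PFor x a b c)
  let ?f = "\<lambda>i s. store (sem n val mem c s) x 0 (int (Suc i))"
  let ?g = "Less (Read x (Const 0)) (Add (Mul (Const (int a)) (Read ''n'' (Const 0))) (Const (int b)))"
  let ?inc = "Assign x (Const 0) (Add (Read x (Const 0)) (Const 1))"
  let ?N = "a * n + b"
  define T where "T = poly (time_poly c) n"
  \<comment> \<open>\<open>k\<close> counts the rounds still to come, so that the induction step
    peels off the first of them, as \<open>WhileTrue\<close> does.\<close>
  have loop: "\<exists>u \<le> k * (T + 20) + 20.
      exec n val mem (While ?g (Seq (compile c) ?inc)) s u (fold ?f [?N - k..<?N] s)"
    if "k \<le> ?N" "s x 0 = int (?N - k)" "s ''n'' 0 = int n" for k s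
    using that
  proof (induction k arbitrary: s)
    case 0
    then have "\<not> bval ?g s" by simp
    then show ?case using exec.WhileFalse[of ?g s n val mem "Seq (compile c) ?inc"]
      by (intro exI[of _ "bcost ?g + 1"]) simp
  next
    case (Suc k)
    let ?i = "?N - Suc k"
    have g: "bval ?g s"
    proof -
      have "s x 0 < int ?N" using Suc.prems by simp
      then show ?thesis using Suc.prems(3) by simp
    qed
    obtain t where t: "t \<le> T" "exec n val mem (compile c) s t (sem n val mem c s)"
      using PFor.IH[of s] PFor.prems Suc.prems(3) by (auto simp: T_def)
    have sx: "sem n val mem c s x 0 = int ?i"
      using PFor.prems Suc.prems(2) by (simp add: sem_unwritten)
    let ?s' = "?f ?i s"
    have "exec n val mem ?inc (sem n val mem c s) 6 ?s'"
      using exec.Assign[of n val mem x "Const 0" "Add (Read x (Const 0)) (Const 1)" "sem n val mem c s"]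
      by (simp add: sx numeral_eq_Suc add.commute)
    then have body: "exec n val mem (Seq (compile c) ?inc) s (t + 6) ?s'"
      by (rule exec.Seq[OF t(2)])
    have "?s' x 0 = int (?N - k)" using Suc.prems(1) by simp
    moreover have "?s' ''n'' 0 = int n"
      using PFor.prems Suc.prems(3) by (simp add: sem_unwritten)
    ultimately obtain u where u: "u \<le> k * (T + 20) + 20"
        "exec n val mem (While ?g (Seq (compile c) ?inc)) ?s' u (fold ?f [?N - k..<?N] ?s')"
      using Suc.IH[of ?s'] Suc.prems(1) by auto
    have up: "[?i..<?N] = ?i # [?N - k..<?N]"
      using Suc.prems(1) by (simp add: upt_conv_Cons Suc_diff_Suc)
    have "exec n val mem (While ?g (Seq (compile c) ?inc)) s (bcost ?g + (t + 6) + u + 1)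
        (fold ?f [?i..<?N] s)"
      using exec.WhileTrue[OF g body u(2)] unfolding up by simp
    moreover have "bcost ?g + (t + 6) + u + 1 \<le> Suc k * (T + 20) + 20"
      using t(1) u(1) by simp
    ultimately show ?case by blast
  qed
  let ?s0 = "store s x 0 0"
  have a: "exec n val mem (Assign x (Const 0) (Const 0)) s 3 ?s0"
    using exec.Assign[of n val mem x "Const 0" "Const 0" s] by (simp add: numeral_eq_Suc)
  have "?s0 ''n'' 0 = int n" using PFor.prems by auto
  then obtain u where u: "u \<le> ?N * (T + 20) + 20"
      "exec n val mem (While ?g (Seq (compile c) ?inc)) ?s0 u (fold ?f [0..<?N] ?s0)"
    using loop[of ?N ?s0] by auto
  have "exec n val mem (compile (PFor x a b c)) s (3 + u) (sem n val mem (PFor x a b c) s)"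
    using exec.Seq[OF a u(2)] by (simp add: sem.simps(7))
  then show ?case using u(1) unfolding T_def
    by (intro exI[of _ "3 + u"]) (simp add: algebra_simps)
qed

section \<open>Bases of a submodular function\<close>

abbreviation lex_less ::
  "nat \<Rightarrow> nat \<Rightarrow> nat \<Rightarrow> nat \<Rightarrow> nat \<Rightarrow> nat \<Rightarrow> nat \<Rightarrow> nat \<Rightarrow> nat \<Rightarrow> nat \<Rightarrow> bool"
where
  "lex_less a' b' c' d' e' a b c d e \<equiv>
    a' < a \<or> a' = a \<and> (b' < b \<or> b' = b \<and> (c' < c \<or> c' = c \<and> (d' < d \<or> d' = d \<and> e' < e)))"

text \<open>\<open>g\<close> is not normalized at the empty set, since oracle values enter
  unchanged; this is the origin of the terms \<open>- g {}\<close>.\<close>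

locale submodular_ground =
  fixes n :: nat and g :: "nat set \<Rightarrow> int"
  assumes submod: "X \<subseteq> {..<n} \<Longrightarrow> Y \<subseteq> {..<n} \<Longrightarrow> g (X \<union> Y) + g (X \<inter> Y) \<le> g X + g Y"
begin

text \<open>The greedy vertex of the base polytope that belongs to the order. Orders are given by
  integer positions rather than lists; only the comparisons between positions matter, so
  \<open>move\<close> can double them instead of renumbering.\<close>

definition base :: "(nat \<Rightarrow> int) \<Rightarrow> nat \<Rightarrow> int" where
  "base p v = g {w. w < n \<and> p w \<le> p v} - g {w. w < n \<and> p w < p v}"

lemma base_cong:
  assumes "\<And>w. w < n \<Longrightarrow> p w = q w" "v < n"
  shows "base p v = base q v"
proof -
  have "{w. w < n \<and> p w \<le> p v} = {w. w < n \<and> q w \<le> q v}"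
    "{w. w < n \<and> p w < p v} = {w. w < n \<and> q w < q v}"
    using assms by auto
  then show ?thesis by (simp add: base_def)
qed

text \<open>Remove the last element v of U. The union of U with the strict predecessors of v is the
  closed prefix of v, and the intersection is U - {v}; submodularity bounds the marginal value at v
  by that of U. If U is a lower set, the strict predecessors are exactly U - {v} and the bound is
  attained.\<close>

lemma base_sum:
  assumes inj: "inj_on p {..<n}" and U: "U \<subseteq> {..<n}"
  shows "sum (base p) U \<le> g U - g {}"
    and "(\<And>v w. v \<in> U \<Longrightarrow> w < n \<Longrightarrow> p w < p v \<Longrightarrow> w \<in> U) \<Longrightarrow> sum (base p) U = g U - g {}"
proof -
  have "sum (base p) U \<le> g U - g {} \<and>
    ((\<forall>v\<in>U. \<forall>w<n. p w < p v \<longrightarrow> w \<in> U) \<longrightarrow> sum (base p) U = g U - g {})"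
    using U
  proof (induction "card U" arbitrary: U)
    case 0
    then have "U = {}" using finite_subset[OF 0(2)] by auto
    then show ?case by simp
  next
    case (Suc k)
    have fin: "finite U" using finite_subset[OF Suc.prems] by simp
    have "U \<noteq> {}" using Suc.hyps(2) by auto
    then have "Max (p ` U) \<in> p ` U" using fin by (intro Max_in) auto
    then obtain v where v: "v \<in> U" "p v = Max (p ` U)" by auto
    have vmax: "p w \<le> p v" if "w \<in> U" for w using v(2) fin that by simp
    let ?W = "U - {v}"
    have "k = card ?W" "?W \<subseteq> {..<n}"
      using Suc.hyps(2) Suc.prems v(1) fin by auto
    note IH = conjunct1[OF Suc.hyps(1)[OF this]] conjunct2[OF Suc.hyps(1)[OF this]]
    have sum: "sum (base p) U = base p v + sum (base p) ?W"
      using fin v(1) by (simp add: sum.remove)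
    let ?le = "{w. w < n \<and> p w \<le> p v}" and ?lt = "{w. w < n \<and> p w < p v}"
    have vn: "v < n" using v(1) Suc.prems by auto
    have "p w = p v \<longleftrightarrow> w = v" if "w < n" for w
      using inj that vn by (auto dest: inj_onD)
    then have "w \<in> ?le \<longleftrightarrow> w \<in> insert v ?lt" for w
      using vn by (cases "w < n") (auto simp: order_le_less)
    then have le: "?le = insert v ?lt" by blast
    have W: "?W \<subseteq> ?lt"
    proof
      fix w assume w: "w \<in> ?W"
      then have "p w \<noteq> p v" using inj v(1) Suc.prems by (auto dest!: inj_onD)
      then show "w \<in> ?lt" using w vmax[of w] Suc.prems by auto
    qed
    have eqs: "U \<union> ?lt = ?le" "U \<inter> ?lt = ?W" unfolding le using W v(1) by auto
    have "?lt \<subseteq> {..<n}" by auto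
    from submod[OF Suc.prems this] have "g ?le + g ?W \<le> g U + g ?lt" unfolding eqs .
    then have 1: "sum (base p) U \<le> g U - g {}"
      using IH(1) unfolding sum base_def by linarith
    have 2: "sum (base p) U = g U - g {}" if low: "\<forall>v\<in>U. \<forall>w<n. p w < p v \<longrightarrow> w \<in> U"
    proof -
      have Weq: "?W = ?lt" using W low v(1) by auto
      have "U = ?le" using Weq le v(1) by auto
      moreover have "\<forall>v\<in>?W. \<forall>w<n. p w < p v \<longrightarrow> w \<in> ?W" using low vmax by force
      then have "sum (base p) ?W = g ?W - g {}" using IH(2) by blast
      ultimately show ?thesis using Weq unfolding sum base_def by simp
    qed
    show ?case using 1 2 by blast
  qed
  then show "sum (base p) U \<le> g U - g {}"
    and "(\<And>v w. v \<in> U \<Longrightarrow> w < n \<Longrightarrow> p w < p v \<Longrightarrow> w \<in> U) \<Longrightarrow> sum (base p) U = g U - g {}"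
    by auto
qed

lemma base_total: "inj_on p {..<n} \<Longrightarrow> (\<Sum>v<n. base p v) = g {..<n} - g {}"
  by (rule base_sum(2)) auto

text \<open>Doubling the positions makes room for \<open>u\<close> just before \<open>s\<close>.\<close>

definition move :: "(nat \<Rightarrow> int) \<Rightarrow> nat \<Rightarrow> nat \<Rightarrow> nat \<Rightarrow> int" where
  "move p s u = (\<lambda>v. if v = u then 2 * p s - 1 else 2 * p v)"

text \<open>The effect on the greedy base of moving \<open>u\<close> in front of \<open>s\<close>.
  For \<open>s\<close> before \<open>u\<close> its sign pattern is: at most 0 from \<open>s\<close>
  up to the predecessor of \<open>u\<close>, at least 0 at \<open>u\<close>, and 0
  elsewhere.\<close>

definition exchange :: "(nat \<Rightarrow> int) \<Rightarrow> nat \<Rightarrow> nat \<Rightarrow> nat \<Rightarrow> int" where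
  "exchange p s u v = base (move p s u) v - base p v"

lemma inj_move: "inj_on p {..<n} \<Longrightarrow> inj_on (move p s u) {..<n}"
  unfolding inj_on_def move_def by (auto split: if_splits; presburger)

context
  fixes p :: "nat \<Rightarrow> int" and s u :: nat
  assumes inj: "inj_on p {..<n}" and su: "s < n" "u < n" "p s < p u"
begin

lemma exchange_outside:
  assumes "v < n" "p v < p s \<or> p u < p v"
  shows "exchange p s u v = 0"
proof -
  have "v \<noteq> u" using assms su by auto
  then have "{w. w < n \<and> move p s u w \<le> move p s u v} = {w. w < n \<and> p w \<le> p v}"
    "{w. w < n \<and> move p s u w < move p s u v} = {w. w < n \<and> p w < p v}"
    using assms su unfolding move_def by (auto split: if_splits)
  then show ?thesis by (simp add: exchange_def base_def)
qed

text \<open>Diminishing returns: after the move, \<open>v\<close> is added to its old predecessors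
  together with \<open>u\<close>, so its marginal value cannot grow.\<close>

lemma exchange_between:
  assumes "v < n" "p s \<le> p v" "p v < p u"
  shows "exchange p s u v \<le> 0"
proof -
  let ?le = "{w. w < n \<and> p w \<le> p v}" and ?lt = "{w. w < n \<and> p w < p v}"
  have "v \<noteq> u" using assms by auto
  then have eqs: "{w. w < n \<and> move p s u w \<le> move p s u v} = ?le \<union> insert u ?lt"
    "{w. w < n \<and> move p s u w < move p s u v} = insert u ?lt" "?le \<inter> insert u ?lt = ?lt"
    using assms su unfolding move_def by (auto split: if_splits)
  have "?le \<subseteq> {..<n}" "insert u ?lt \<subseteq> {..<n}" using su by auto
  from submod[OF this] show ?thesis
    unfolding exchange_def base_def eqs by simp
qed

lemma exchange_total: "(\<Sum>v<n. exchange p s u v) = 0"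
  unfolding exchange_def by (simp add: sum_subtractf base_total inj inj_move)

lemma exchange_nonpos:
  assumes "v < n" "v \<noteq> u"
  shows "exchange p s u v \<le> 0"
proof -
  have "p v \<noteq> p u" using inj su assms by (auto dest: inj_onD)
  then show ?thesis
    using exchange_outside[OF assms(1)] exchange_between[OF assms(1)] by (smt (verit))
qed

lemma exchange_moved: "exchange p s u u = - (\<Sum>v\<in>{..<n} - {u}. exchange p s u v)"
  using exchange_total su by (simp add: sum.remove[of _ u])

lemma exchange_moved_nonneg: "0 \<le> exchange p s u u"
proof -
  have "(\<Sum>v\<in>{..<n} - {u}. exchange p s u v) \<le> 0"
    by (rule sum_nonpos) (auto intro: exchange_nonpos)
  then show ?thesis unfolding exchange_moved by simp
qed

end

text \<open>
  A nonnegative multiple of \<open>\<chi>\<^sub>t - \<chi>\<^sub>s\<close> is expressed through the vectors \<open>exchange p s u\<close> with \<open>u\<close> in the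
  interval \<open>(s, t]\<close> of the order \<open>p\<close>: \<open>r\<close> is the current combination, with coefficients \<open>w\<close>, and
  its entries are cleared from the last position downwards. An element with
  \<open>exchange p s u u = 0\<close> needs no special treatment, since the whole vector is then zero.
\<close>

definition elim_inv :: "(nat \<Rightarrow> int) \<Rightarrow> nat \<Rightarrow> nat \<Rightarrow> (nat \<Rightarrow> int) \<Rightarrow> (nat \<Rightarrow> int) \<Rightarrow> bool" where
  "elim_inv p s t w r \<longleftrightarrow>
     (\<forall>u<n. 0 \<le> w u \<and> (w u \<noteq> 0 \<longrightarrow> p s < p u \<and> p u \<le> p t)) \<and> 0 < (\<Sum>u<n. w u) \<and>
     (\<forall>v<n. r v = (\<Sum>u<n. w u * exchange p s u v)) \<and> (\<forall>v<n. v \<noteq> t \<longrightarrow> r v \<le> 0)"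

text \<open>All positions of the open interval up to the highest nonzero entry, not merely the
  nonzero entries: clearing one entry can create new nonzero entries below it, so their number need
  not drop.\<close>

definition pending :: "(nat \<Rightarrow> int) \<Rightarrow> nat \<Rightarrow> nat \<Rightarrow> (nat \<Rightarrow> int) \<Rightarrow> nat set" where
  "pending p s t r = {v. v < n \<and> p s < p v \<and> p v < p t \<and>
     (\<exists>v'<n. p s < p v' \<and> p v' < p t \<and> r v' \<noteq> 0 \<and> p v \<le> p v')}"

lemma elim_init:
  assumes "inj_on p {..<n}" "s < n" "t < n" "p s < p t"
  shows "elim_inv p s t (\<lambda>u. if u = t then 1 else 0) (exchange p s t)"
proof -
  have *: "(\<Sum>u<n. (if u = t then 1 else 0) * h u) = h t" for h :: "nat \<Rightarrow> int"
  proof -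
    have "(\<Sum>u<n. (if u = t then 1 else 0) * h u) = (\<Sum>u<n. if u = t then h u else 0)"
      by (rule sum.cong) auto
    then show ?thesis using assms by simp
  qed
  show ?thesis
    unfolding elim_inv_def using assms *[of "\<lambda>u. 1"] by (auto simp: * exchange_nonpos)
qed

text \<open>Fraction-free elimination with the vector \<open>exchange p s x\<close>. As
  \<open>r x\<close> is negative, \<open>- r x\<close> is a positive contribution to the
  coefficients, so their sum stays positive even when the pivot is 0. Above \<open>x\<close> inside
  the interval nothing reappears, because \<open>exchange p s x\<close> vanishes there.\<close>

lemma elim_step:
  assumes inj: "inj_on p {..<n}" and st: "s < n" "t < n" "p s < p t"
    and inv: "elim_inv p s t w r"
    and x: "x < n" "p s < p x" "p x < p t" "r x \<noteq> 0"
    and x_max: "\<And>v. v < n \<Longrightarrow> p s < p v \<Longrightarrow> p v < p t \<Longrightarrow> r v \<noteq> 0 \<Longrightarrow> p v \<le> p x"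
    and w': "\<And>u. u < n \<Longrightarrow> w' u = exchange p s x x * w u - (if u = x then r x else 0)"
    and r': "\<And>v. v < n \<Longrightarrow> r' v = exchange p s x x * r v - r x * exchange p s x v"
  shows "elim_inv p s t w' r'" and "card (pending p s t r') < card (pending p s t r)"
proof -
  let ?p = "exchange p s x x"
  have p: "0 \<le> ?p" using exchange_moved_nonneg[OF inj st(1) x(1,2)] .
  have xt: "x \<noteq> t" using x by auto
  have rx: "r x < 0" using inv x(1,4) xt unfolding elim_inv_def by force
  have S: "(\<Sum>u<n. w' u * h u) = ?p * (\<Sum>u<n. w u * h u) - r x * h x" for h
  proof -
    have "(\<Sum>u<n. w' u * h u) = (\<Sum>u<n. ?p * (w u * h u) - (if u = x then r u * h u else 0))"
      by (rule sum.cong) (auto simp: w' algebra_simps)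
    then show ?thesis using x(1) by (simp add: sum_subtractf sum_distrib_left)
  qed
  have nonpos: "r' v \<le> 0" if "v < n" "v \<noteq> t" for v
  proof (cases "v = x")
    case True
    then show ?thesis using r'[OF that(1)] by simp
  next
    case False
    have "r v \<le> 0" using inv that unfolding elim_inv_def by blast
    moreover have "exchange p s x v \<le> 0"
      using exchange_nonpos[OF inj st(1) x(1,2) that(1) False] .
    ultimately have "?p * r v \<le> 0" "0 \<le> r x * exchange p s x v"
      using p rx by (auto simp: mult_nonneg_nonpos mult_nonpos_nonpos)
    then show ?thesis using r'[OF that(1)] by linarith
  qed
  have "0 < (\<Sum>u<n. w' u)"
    using S[of "\<lambda>u. 1"] p rx inv by (simp add: elim_inv_def) (smt (verit) mult_nonneg_nonneg)
  moreover have "0 \<le> w' u \<and> (w' u \<noteq> 0 \<longrightarrow> p s < p u \<and> p u \<le> p t)" if "u < n" for u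
  proof (cases "u = x")
    case True
    have "0 \<le> ?p * w x" using inv x p by (simp add: elim_inv_def)
    then show ?thesis using w'[OF that] rx x True by simp
  next
    case False
    then show ?thesis using w'[OF that] inv that p by (auto simp: elim_inv_def)
  qed
  moreover have "r' v = (\<Sum>u<n. w' u * exchange p s u v)" if "v < n" for v
    unfolding S using r'[OF that] inv that unfolding elim_inv_def by simp
  ultimately show "elim_inv p s t w' r'"
    unfolding elim_inv_def using nonpos by blast
  have above: "r' v = 0" if v: "v < n" "p s < p v" "p v < p t" "p x \<le> p v" for v
  proof (cases "v = x")
    case True
    then show ?thesis using r'[OF that(1)] by simp
  next
    case False
    then have "p v \<noteq> p x" using inj v x by (auto dest: inj_onD)
    then have "p x < p v" using v by simp
    then have "r v = 0" "exchange p s x v = 0"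
      using x_max[OF v(1,2,3)] exchange_outside[OF inj st(1) x(1,2) v(1)] by auto
    then show ?thesis using r'[OF v(1)] by simp
  qed
  have "pending p s t r' \<subseteq> pending p s t r - {x}"
  proof
    fix v assume "v \<in> pending p s t r'"
    then obtain v' where v: "v < n" "p s < p v" "p v < p t" "v' < n" "p s < p v'" "p v' < p t"
        "r' v' \<noteq> 0" "p v \<le> p v'" unfolding pending_def by auto
    have "p v' < p x" using above[of v'] v by force
    then show "v \<in> pending p s t r - {x}" using v x unfolding pending_def by fastforce
  qed
  moreover have "x \<in> pending p s t r" using x unfolding pending_def by auto
  moreover have "finite (pending p s t r)" unfolding pending_def by simp
  ultimately show "card (pending p s t r') < card (pending p s t r)"
    by (metis card_Diff1_less card_mono finite_Diff le_less_trans)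
qed

text \<open>Outside the interval from \<open>s\<close> to \<open>t\<close> all participating vectors
  vanish, and inside it nothing is pending, so only the entries at \<open>s\<close> and
  \<open>t\<close> remain. Every exchange vector sums to 0, hence they are opposite, and
  \<open>r s\<close> is at most 0.\<close>

lemma elim_final:
  assumes inj: "inj_on p {..<n}" and st: "s < n" "t < n" "p s < p t"
    and inv: "elim_inv p s t w r" and fin: "pending p s t r = {}" and v: "v < n"
  shows "r v = (if v = t then r t else if v = s then - r t else 0)" and "0 \<le> r t"
proof -
  have zero: "r v = 0" if v: "v < n" "v \<noteq> s" "v \<noteq> t" for v
  proof -
    have ne: "p v \<noteq> p s" "p v \<noteq> p t" using inj v st by (auto dest: inj_onD)
    show ?thesis
    proof (cases "p s < p v \<and> p v < p t")
      case True
      then show ?thesis using fin v unfolding pending_def by blast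
    next
      case False
      have "w u * exchange p s u v = 0" if "u < n" for u
      proof (cases "w u = 0")
        case False
        then have "p s < p u" "p u \<le> p t" using inv that unfolding elim_inv_def by auto
        then have "exchange p s u v = 0"
          using exchange_outside[OF inj st(1) that _ v(1)] ne \<open>\<not> (p s < p v \<and> p v < p t)\<close> by auto
        then show ?thesis by simp
      qed simp
      then have "(\<Sum>u<n. w u * exchange p s u v) = 0" by (intro sum.neutral) auto
      then show ?thesis using inv v unfolding elim_inv_def by simp
    qed
  qed
  have "(\<Sum>v<n. r v) = (\<Sum>v<n. \<Sum>u<n. w u * exchange p s u v)"
    using inv unfolding elim_inv_def by (intro sum.cong) auto
  also have "\<dots> = (\<Sum>u<n. w u * (\<Sum>v<n. exchange p s u v))"
    by (subst sum.swap) (simp add: sum_distrib_left)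
  also have "\<dots> = 0"
  proof (intro sum.neutral ballI)
    fix u assume "u \<in> {..<n}"
    then show "w u * (\<Sum>v<n. exchange p s u v) = 0"
      using exchange_total[OF inj st(1), of u] inv unfolding elim_inv_def by (cases "w u = 0") auto
  qed
  finally have "(\<Sum>v<n. r v) = 0" .
  moreover have "s \<noteq> t" using st by auto
  moreover have "(\<Sum>v\<in>{..<n} - {t} - {s}. r v) = 0" by (intro sum.neutral) (auto simp: zero)
  ultimately have "r t + r s = 0" using st by (simp add: sum.remove[of _ t] sum.remove[of _ s])
  moreover have "r s \<le> 0" using inv st \<open>s \<noteq> t\<close> unfolding elim_inv_def by blast
  ultimately show "r v = (if v = t then r t else if v = s then - r t else 0)" and "0 \<le> r t"
    using zero v by auto
qed


section \<open>Weighted families of orders and labels\<close>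

definition comb :: "nat \<Rightarrow> (nat \<Rightarrow> nat \<Rightarrow> int) \<Rightarrow> (nat \<Rightarrow> int) \<Rightarrow> nat \<Rightarrow> int" where
  "comb m P \<mu> v = (\<Sum>j<m. \<mu> j * base (P j) v)"

text \<open>The total weight is required to be positive instead of 1, which spares the division;
  \<open>comb\<close> is then a positive multiple of a convex combination of bases.\<close>

definition family :: "nat \<Rightarrow> (nat \<Rightarrow> nat \<Rightarrow> int) \<Rightarrow> (nat \<Rightarrow> int) \<Rightarrow> bool" where
  "family m P \<mu> \<longleftrightarrow> (\<forall>j<m. inj_on (P j) {..<n} \<and> 0 \<le> \<mu> j) \<and> 0 < (\<Sum>j<m. \<mu> j)"

text \<open>Lower bounds for the distance from the positive elements in the graph with an arc from
  \<open>v\<close> to \<open>w\<close> whenever \<open>v\<close> precedes \<open>w\<close> in one of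
  the orders. Unlike true distances they stay valid under a push and need no recomputation.\<close>

definition labels :: "nat \<Rightarrow> (nat \<Rightarrow> nat \<Rightarrow> int) \<Rightarrow> (nat \<Rightarrow> int) \<Rightarrow> (nat \<Rightarrow> nat) \<Rightarrow> bool" where
  "labels m P x d \<longleftrightarrow> (\<forall>v<n. d v \<le> n \<and> (0 < x v \<longrightarrow> d v = 0)) \<and>
     (\<forall>j<m. \<forall>v<n. \<forall>w<n. P j v < P j w \<longrightarrow> d w \<le> Suc (d v))"

text \<open>Weak duality: x(T) is at most W (g T - g {}) for every T, with equality for the cut U, a
  lower set of all orders because the label \<open>j\<close> is missing. As x is at most 0 on U and
  at least 0 off it, U minimizes x(T) and therefore \<open>g\<close>. Some \<open>j\<close> is
  missing because \<open>n\<close> elements cannot take n + 1 labels.\<close>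

lemma optimal_cut:
  assumes fam: "family m P \<mu>" and lab: "labels m P (comb m P \<mu>) d"
    and no_cand: "\<And>t. t < n \<Longrightarrow> comb m P \<mu> t < 0 \<Longrightarrow> n \<le> d t"
  shows "\<exists>j\<le>n. \<forall>T\<subseteq>{..<n}. g {v. v < n \<and> j < d v} \<le> g T"
proof -
  have "card (d ` {..<n}) \<le> n" using card_image_le[of "{..<n}" d] by simp
  then have "\<not> {..n} \<subseteq> d ` {..<n}" using card_mono[of "d ` {..<n}" "{..n}"] by force
  then obtain j where j: "j \<le> n" "j \<notin> d ` {..<n}" by auto
  let ?x = "comb m P \<mu>"
  define U where "U = {v. v < n \<and> j < d v}"
  define W where "W = (\<Sum>k<m. \<mu> k)"
  have W: "0 < W" using fam unfolding family_def W_def by simp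
  have Un: "U \<subseteq> {..<n}" unfolding U_def by auto
  have sum_comb: "sum ?x S = (\<Sum>k<m. \<mu> k * sum (base (P k)) S)" for S
    unfolding comb_def sum_distrib_left by (rule sum.swap)
  have le: "sum ?x T \<le> W * (g T - g {})" if "T \<subseteq> {..<n}" for T
    unfolding sum_comb W_def sum_distrib_right using fam base_sum(1)[OF _ that]
    by (intro sum_mono mult_left_mono) (auto simp: family_def)
  have lower: "w \<in> U" if "k < m" "v \<in> U" "w < n" "P k w < P k v" for k v w
  proof -
    have "d v \<le> Suc (d w)" using lab that Un unfolding labels_def by blast
    moreover have "d w \<noteq> j" using j(2) that by auto
    ultimately show ?thesis using that unfolding U_def by auto
  qed
  have eq: "sum ?x U = W * (g U - g {})"
    unfolding sum_comb W_def sum_distrib_right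
    by (intro sum.cong refl, subst base_sum(2)) (use fam Un lower in \<open>auto simp: family_def\<close>)
  have inU: "?x v \<le> 0" if "v \<in> U" for v
    using that lab unfolding labels_def U_def by (metis less_nat_zero_code linorder_not_le mem_Collect_eq)
  have outU: "0 \<le> ?x v" if "v < n" "v \<notin> U" for v
  proof (rule ccontr)
    assume "\<not> 0 \<le> ?x v"
    \<comment> \<open>A negative element has label exactly \<open>n\<close>. Lying outside U it
      would force \<open>j = n\<close>, but \<open>j\<close> is missing among the labels.\<close>
    then have "n \<le> d v" using no_cand[of v] that by simp
    then have "d v \<le> j" "d v = n" using that lab unfolding U_def labels_def by (auto simp: not_less)
    then have "d v = j" using j(1) by simp
    then show False using j(2) that by auto
  qed
  have "g U \<le> g T" if T: "T \<subseteq> {..<n}" for T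
  proof -
    have fin: "finite T" "finite U" using T Un finite_subset by blast+
    have "sum ?x U = sum ?x (U \<inter> T) + sum ?x (U - T)"
      using fin by (metis Int_Diff_Un Int_Diff_disjoint finite_Diff finite_Int sum.union_disjoint)
    moreover have "sum ?x T = sum ?x (T \<inter> U) + sum ?x (T - U)"
      using fin by (metis Int_Diff_Un Int_Diff_disjoint finite_Diff finite_Int sum.union_disjoint)
    moreover have "sum ?x (U - T) \<le> 0" by (rule sum_nonpos) (use inU in auto)
    moreover have "0 \<le> sum ?x (T - U)" by (rule sum_nonneg) (use outU T in auto)
    ultimately have "sum ?x U \<le> sum ?x T" by (simp add: Int_commute)
    then have "W * (g U - g {}) \<le> W * (g T - g {})" using le[OF T] eq by simp
    then show ?thesis using W by simp
  qed
  then show ?thesis using j(1) unfolding U_def by blast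
qed

text \<open>
  The measure that decreases in every step is a lexicographic quintuple: the total distance of the
  labels from \<open>n\<close>, the key of the chosen \<open>t\<close>, the chosen \<open>s\<close>, the size of a largest interval
  \<open>(s, t]\<close>, and the number of orders that attain it. \<open>bounded\<close> says that a quintuple
  bounds the measure of the current state from above.
\<close>

definition interval_size :: "(nat \<Rightarrow> int) \<Rightarrow> nat \<Rightarrow> nat \<Rightarrow> nat" where
  "interval_size p s t = card {v. v < n \<and> p s < p v \<and> p v \<le> p t}"

text \<open>Label first, index as tie-break, written as one number. Below \<open>n\<close> it
  determines the element, so equal keys mean the same \<open>t\<close>.\<close>

definition key :: "(nat \<Rightarrow> nat) \<Rightarrow> nat \<Rightarrow> nat" where
  "key d t = d t * n + t"

definition bounded ::
  "nat \<Rightarrow> (nat \<Rightarrow> nat \<Rightarrow> int) \<Rightarrow> (nat \<Rightarrow> int) \<Rightarrow> (nat \<Rightarrow> nat) \<Rightarrow> nat \<Rightarrow> nat \<Rightarrow> nat \<Rightarrow> nat \<Rightarrow> nat \<Rightarrow> bool"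
where
  "bounded m P x d a b c \<alpha> \<beta> \<longleftrightarrow>
     (\<Sum>v<n. n - d v) \<le> a \<and>
     (\<forall>t<n. x t < 0 \<longrightarrow> d t < n \<longrightarrow> key d t \<le> b \<and> (key d t = b \<longrightarrow>
       (\<forall>s<n. d t = Suc (d s) \<longrightarrow> (\<exists>j<m. P j s < P j t) \<longrightarrow> s \<le> c \<and> (s = c \<longrightarrow>
         (\<forall>j<m. interval_size (P j) s t \<le> \<alpha>) \<and>
         card {j. j < m \<and> interval_size (P j) s t = \<alpha>} \<le> \<beta>))))"

lemma interval_size_le: "interval_size p s t \<le> n"
  unfolding interval_size_def by (metis (no_types, lifting) card_lessThan card_mono finite_lessThan lessThan_iff mem_Collect_eq subsetI)

lemma key_less: "d t < n \<Longrightarrow> t < n \<Longrightarrow> key d t < n * n"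
  unfolding key_def by (metis less_Suc_eq_le less_le_trans add.commute add_less_mono1 mult_Suc mult_le_mono1 Suc_leI)

lemma key_inj: "key d t = key d t' \<Longrightarrow> t < n \<Longrightarrow> t' < n \<Longrightarrow> t = t'"
  unfolding key_def by (metis mod_less mod_mult_self3)

text \<open>The largest possible values of the last four components. They serve at the start, and
  after a relabeling, when the first component has dropped and the others may be reset.\<close>

lemma bounded_trivial:
  assumes "m \<le> Suc n"
  shows "bounded m P x d (\<Sum>v<n. n - d v) (n * n) n n (Suc n)"
proof -
  have "card {j. j < m \<and> interval_size (P j) s t = n} \<le> Suc n" for s t
    using card_mono[of "{..<m}" "{j. j < m \<and> interval_size (P j) s t = n}"] assms by fastforce
  then show ?thesis
    unfolding bounded_def using interval_size_le key_less[of d] by (auto simp: less_imp_le)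
qed

text \<open>Without an arc from a label one smaller, every predecessor of \<open>t\<close> has label
  at least \<open>d t\<close>, so arcs into \<open>t\<close> tolerate the increase; arcs out of
  \<open>t\<close> only gain slack.\<close>

lemma labels_relabel:
  assumes lab: "labels m P x d" and t: "t < n" "x t \<le> 0" "d t < n"
    and no_arc: "\<And>s. s < n \<Longrightarrow> d t = Suc (d s) \<Longrightarrow> \<not> (\<exists>j<m. P j s < P j t)"
  shows "labels m P x (d(t := Suc (d t)))"
    and "(\<Sum>v<n. n - (d(t := Suc (d t))) v) < (\<Sum>v<n. n - d v)"
proof -
  have below: "d t \<le> d v" if "j < m" "v < n" "P j v < P j t" for j v
  proof -
    have "d t \<le> Suc (d v)" using lab that t unfolding labels_def by blast
    moreover have "d t \<noteq> Suc (d v)" using no_arc that by blast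
    ultimately show ?thesis by simp
  qed
  have "(d(t := Suc (d t))) w \<le> Suc ((d(t := Suc (d t))) v)"
    if "j < m" "v < n" "w < n" "P j v < P j w" for j v w
  proof -
    have "d w \<le> Suc (d v)" using lab that unfolding labels_def by blast
    moreover have "w = t \<Longrightarrow> d t \<le> d v" using below that by blast
    ultimately show ?thesis by auto
  qed
  then show "labels m P x (d(t := Suc (d t)))"
    using lab t unfolding labels_def by auto
  show "(\<Sum>v<n. n - (d(t := Suc (d t))) v) < (\<Sum>v<n. n - d v)"
    by (rule sum_strict_mono_ex1) (use t in auto)
qed

text \<open>The only new comparisons are those of \<open>u\<close> with the elements from
  \<open>s\<close> up to \<open>u\<close>. The last case stands for ties, which
  \<open>push_progress\<close> excludes by injectivity.\<close>

lemma move_arc_cases: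
  assumes "move p s u v < move p s u w" "p s < p u"
  shows "p v < p w \<or> v = u \<and> p s \<le> p w \<and> p w < p u \<or> v = u \<and> p w = p u \<and> w \<noteq> u"
  using assms unfolding move_def by (auto split: if_splits)

text \<open>No element enters the interval, and \<open>u\<close> leaves it because it now precedes
  \<open>s\<close>. For \<open>u = t\<close> nothing remains in it.\<close>

lemma interval_size_move:
  assumes "p s < p u" "p u \<le> p t" "s < n" "t < n" "u < n"
  shows "interval_size (move p s u) s t < interval_size p s t"
  unfolding interval_size_def
proof (rule psubset_card_mono)
  let ?N = "{v. v < n \<and> move p s u s < move p s u v \<and> move p s u v \<le> move p s u t}"
  have "?N \<subseteq> {v. v < n \<and> p s < p v \<and> p v \<le> p t}"
    using assms unfolding move_def by (auto split: if_splits)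
  moreover have "u \<notin> ?N" using assms unfolding move_def by (auto split: if_splits)
  moreover have "u \<in> {v. v < n \<and> p s < p v \<and> p v \<le> p t}" using assms by auto
  ultimately show "?N \<subset> {v. v < n \<and> p s < p v \<and> p v \<le> p t}" by blast
qed simp

lemma interval_size_cong:
  "(\<And>v. v < n \<Longrightarrow> p v = q v) \<Longrightarrow> s < n \<Longrightarrow> t < n \<Longrightarrow> interval_size p s t = interval_size q s t"
  unfolding interval_size_def by (rule arg_cong[where f = card]) auto

text \<open>Isolates what the measure needs to know about a push. \<open>K\<close>, \<open>A\<close>
  and \<open>e\<close> are the scale factors and the step length; \<open>\<pi>\<close> sends a
  surviving order to its index before the reductions, where indices from \<open>m\<close> on stand
  for the newly created moves of order \<open>i\<close>. Either \<open>t\<close> ceases to be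
  negative, or order \<open>i\<close> is gone and one order fewer attains the maximal
  interval.\<close>

lemma push_progress:
  fixes P P' :: "nat \<Rightarrow> nat \<Rightarrow> int"
  assumes inj: "\<And>j. j < m \<Longrightarrow> inj_on (P j) {..<n}" and lab: "labels m P x d"
    and t: "t < n" "x t < 0" "d t < n"
    and t_max: "\<And>v. v < n \<Longrightarrow> x v < 0 \<Longrightarrow> d v < n \<Longrightarrow> key d v \<le> key d t"
    and s: "s < n" "d t = Suc (d s)"
    and s_max: "\<And>v j. v < n \<Longrightarrow> d t = Suc (d v) \<Longrightarrow> j < m \<Longrightarrow> P j v < P j t \<Longrightarrow> v \<le> s"
    and i: "i < m" "P i s < P i t"
    and i_max: "\<And>j. j < m \<Longrightarrow> interval_size (P j) s t \<le> interval_size (P i) s t"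
    and x': "\<And>v. v < n \<Longrightarrow> x' v = K * (A * x v + (if v = t then e else if v = s then - e else 0))"
    and pos: "0 < K" "0 < A" "0 \<le> e" "x' t \<le> 0"
    and \<pi>: "inj_on \<pi> {..<m'}" "x' t < 0 \<Longrightarrow> i \<notin> \<pi> ` {..<m'}"
    and old: "\<And>j v. j < m' \<Longrightarrow> \<pi> j < m \<Longrightarrow> v < n \<Longrightarrow> P' j v = P (\<pi> j) v"
    and new: "\<And>j. j < m' \<Longrightarrow> \<not> \<pi> j < m \<Longrightarrow>
      \<exists>u<n. P i s < P i u \<and> P i u \<le> P i t \<and> (\<forall>v<n. P' j v = move (P i) s u v)"
    and bd: "bounded m P x d a b c \<alpha> \<beta>"
  shows "labels m' P' x' d"
    and "\<exists>a' b' c' \<alpha>' \<beta>'. bounded m' P' x' d a' b' c' \<alpha>' \<beta>' \<and>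
      b' < n * n \<and> c' < n \<and> \<alpha>' \<le> n \<and> \<beta>' < m \<and>
      lex_less a' b' c' \<alpha>' \<beta>' a b c \<alpha> \<beta>"
proof -
  have arc_label: "d w \<le> Suc (d v)" if "j < m" "v < n" "w < n" "P j v < P j w" for j v w
    using lab that unfolding labels_def by blast
  have same: "v = w" if "v < n" "w < n" "P i v = P i w" for v w
    using inj[OF i(1)] that by (auto dest: inj_onD)
  have sgn: "K * (A * y) < 0 \<longleftrightarrow> y < 0" "0 < K * (A * y) \<longleftrightarrow> 0 < y" for y
    using pos by (simp_all add: mult_less_0_iff zero_less_mult_iff)
  have st: "s \<noteq> t" using s(2) by auto
  have xpos: "0 < x v" if "v < n" "0 < x' v" for v
  proof -
    have "v \<noteq> t" using that pos by auto
    then have "0 < A * x v + (if v = s then - e else 0)"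
      using x'[OF that(1)] that(2) pos(1) by (simp add: zero_less_mult_iff)
    then have "0 < A * x v" using pos(3) by (auto split: if_splits)
    then show ?thesis using pos(2) by (simp add: zero_less_mult_iff)
  qed
  have new_label: "d w \<le> Suc (d v)"
    if u: "u < n" "P i s < P i u" "P i u \<le> P i t" and vw: "v < n" "w < n"
      and arc: "move (P i) s u v < move (P i) s u w" for u v w
  proof -
    consider "P i v < P i w" | "v = u" "P i s \<le> P i w" | "v = u" "P i w = P i u" "w \<noteq> u"
      using move_arc_cases[OF arc u(2)] by blast
    then show ?thesis
    proof cases
      case 1
      then show ?thesis using arc_label i(1) vw by blast
    next
      case 2
      \<comment> \<open>The new arc goes from \<open>u\<close> to \<open>w\<close>. Since
        \<open>s\<close> is at or before \<open>w\<close> and \<open>u\<close> is at or before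
        \<open>t\<close> in order \<open>i\<close>, the chain is d w <= d s + 1 = d t <= d u +
        1.\<close>
      have "d w \<le> d t"
      proof (cases "P i w = P i s")
        case True
        then have "w = s" using same vw s by blast
        then show ?thesis using s by simp
      next
        case False
        then have "d w \<le> Suc (d s)" using arc_label[OF i(1) s(1) vw(2)] 2 by simp
        then show ?thesis using s by simp
      qed
      moreover have "d t \<le> Suc (d u)"
      proof (cases "P i u = P i t")
        case True
        then have "u = t" using same u t by blast
        then show ?thesis by simp
      next
        case False
        then show ?thesis using arc_label[OF i(1) u(1) t(1)] u by simp
      qed
      ultimately show ?thesis using 2 by simp
    next
      case 3
      then show ?thesis using same vw u by blast
    qed
  qed
  have "d w \<le> Suc (d v)" if j: "j < m'" "v < n" "w < n" "P' j v < P' j w" for j v w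
  proof (cases "\<pi> j < m")
    case True
    then show ?thesis using old[OF j(1) True] arc_label[of "\<pi> j" v w] j by simp
  next
    case False
    then show ?thesis using new[OF j(1) False] new_label j by metis
  qed
  then show "labels m' P' x' d"
    using lab xpos unfolding labels_def by blast
  let ?\<alpha> = "interval_size (P i) s t"
  let ?\<beta> = "card {j. j < m \<and> interval_size (P j) s t = ?\<alpha>}"
  have \<beta>: "card ({j. j < m \<and> interval_size (P j) s t = ?\<alpha>} - {i}) = ?\<beta> - 1" "0 < ?\<beta>" "?\<beta> \<le> m"
  proof -
    have "i \<in> {j. j < m \<and> interval_size (P j) s t = ?\<alpha>}" using i by simp
    then show "card ({j. j < m \<and> interval_size (P j) s t = ?\<alpha>} - {i}) = ?\<beta> - 1" "0 < ?\<beta>"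
      by (auto simp: card_gt_0_iff)
    show "?\<beta> \<le> m"
      using card_mono[of "{..<m}" "{j. j < m \<and> interval_size (P j) s t = ?\<alpha>}"] by fastforce
  qed
  \<comment> \<open>A move gives \<open>t\<close> no new predecessors: \<open>u\<close> preceded
    \<open>t\<close> before, unless \<open>u = t\<close>, and then \<open>t\<close> itself moves
    forward.\<close>
  have new_arc: "P i v < P i t"
    if u: "u < n" "P i s < P i u" "P i u \<le> P i t" and v: "v < n"
      and arc: "move (P i) s u v < move (P i) s u t" for u v
  proof (cases "u = t")
    case True
    then show ?thesis using arc u unfolding move_def by (auto split: if_splits)
  next
    case False
    then have "P i u \<noteq> P i t" using same u t by blast
    then show ?thesis using arc u False unfolding move_def by (auto split: if_splits)
  qed
  have bd': "bounded m' P' x' d (\<Sum>v<n. n - d v) (key d t) s ?\<alpha> (?\<beta> - 1)"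
    unfolding bounded_def
  proof (intro conjI allI impI)
    fix t' assume t': "t' < n" "x' t' < 0" "d t' < n"
    show "key d t' \<le> key d t"
    \<comment> \<open>Only \<open>s\<close> can become negative through the push, and its label is
      one smaller than that of \<open>t\<close>.\<close>
    proof (cases "t' = s")
      case True
      have "d s * n + s \<le> d t * n" using s by simp
      then show ?thesis using True unfolding key_def by simp
    next
      case False
      show ?thesis
      proof (cases "t' = t")
        case False
        then have "x t' < 0" using x'[OF t'(1)] t'(2) \<open>t' \<noteq> s\<close> sgn by simp
        then show ?thesis using t_max t' by simp
      qed simp
    qed
    fix s' assume "key d t' = key d t" and s': "s' < n" "d t' = Suc (d s')" "\<exists>j<m'. P' j s' < P' j t'"
    then have tt: "t' = t" using key_inj t' t by blast
    obtain j where j: "j < m'" "P' j s' < P' j t" using s' tt by auto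
    show "s' \<le> s"
    proof (cases "\<pi> j < m")
      case True
      then show ?thesis using s_max[of s' "\<pi> j"] old[OF j(1) True] j s' t tt by simp
    next
      case False
      obtain u where u: "u < n" "P i s < P i u" "P i u \<le> P i t" "\<forall>v<n. P' j v = move (P i) s u v"
        using new[OF j(1) False] by blast
      then have "P i s' < P i t" using new_arc[OF u(1,2,3) s'(1)] j(2) s'(1) t(1) by simp
      then show ?thesis using s_max i s' tt by blast
    qed
    assume ss: "s' = s"
    have le: "interval_size (P' j) s t \<le> ?\<alpha>" and
      lt: "interval_size (P' j) s t = ?\<alpha> \<Longrightarrow> \<pi> j < m \<and> interval_size (P (\<pi> j)) s t = ?\<alpha>" if j: "j < m'" for j
    proof -
      have "interval_size (P' j) s t \<le> ?\<alpha> \<and>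
        (interval_size (P' j) s t = ?\<alpha> \<longrightarrow> \<pi> j < m \<and> interval_size (P (\<pi> j)) s t = ?\<alpha>)"
      proof (cases "\<pi> j < m")
        case True
        have "interval_size (P' j) s t = interval_size (P (\<pi> j)) s t"
          using old[OF j True] s t by (intro interval_size_cong) auto
        then show ?thesis using i_max[OF True] True by simp
      next
        case False
        obtain u where u: "u < n" "P i s < P i u" "P i u \<le> P i t" "\<forall>v<n. P' j v = move (P i) s u v"
          using new[OF j False] by blast
        have "interval_size (P' j) s t = interval_size (move (P i) s u) s t"
          using u s t by (intro interval_size_cong) auto
        also have "\<dots> < ?\<alpha>" using interval_size_move u s t by blast
        finally show ?thesis by simp
      qed
      then show "interval_size (P' j) s t \<le> ?\<alpha>"
        and "interval_size (P' j) s t = ?\<alpha> \<Longrightarrow> \<pi> j < m \<and> interval_size (P (\<pi> j)) s t = ?\<alpha>" by auto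
    qed
    show "interval_size (P' j) s' t' \<le> ?\<alpha>" if "j < m'" for j
      using le[OF that] ss tt by simp
    \<comment> \<open>Orders that attain the old maximum must be old ones, as moves have shorter
      intervals. \<open>\<pi>\<close> embeds them into the old maximizers without \<open>i\<close>,
      which is absent because \<open>x' t\<close> is still negative here.\<close>
    let ?J = "{j. j < m' \<and> interval_size (P' j) s t = ?\<alpha>}"
    have "card ?J = card (\<pi> ` ?J)"
      by (rule card_image[symmetric]) (rule inj_on_subset[OF \<pi>(1)], auto)
    also have "\<dots> \<le> card ({j. j < m \<and> interval_size (P j) s t = ?\<alpha>} - {i})"
      using \<pi>(2) t' tt lt by (intro card_mono) auto
    also have "\<dots> = ?\<beta> - 1" using \<beta> by simp
    finally show "card {j. j < m' \<and> interval_size (P' j) s' t' = ?\<alpha>} \<le> ?\<beta> - 1"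
      using ss tt by simp
  qed simp
  have Db: "(\<Sum>v<n. n - d v) \<le> a" using bd unfolding bounded_def by blast
  have kb: "key d t \<le> b" using bd t unfolding bounded_def by blast
  have sb: "s \<le> c" if "key d t = b"
    using bd t s i that unfolding bounded_def by blast
  have ab: "?\<alpha> \<le> \<alpha>" and bb: "?\<alpha> = \<alpha> \<Longrightarrow> ?\<beta> \<le> \<beta>" if "key d t = b" "s = c"
    using bd t s i that unfolding bounded_def by blast+
  show "\<exists>a' b' c' \<alpha>' \<beta>'. bounded m' P' x' d a' b' c' \<alpha>' \<beta>' \<and>
      b' < n * n \<and> c' < n \<and> \<alpha>' \<le> n \<and> \<beta>' < m \<and>
      lex_less a' b' c' \<alpha>' \<beta>' a b c \<alpha> \<beta>"
    apply (rule exI[of _ "\<Sum>v<n. n - d v"], rule exI[of _ "key d t"], rule exI[of _ s],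
        rule exI[of _ ?\<alpha>], rule exI[of _ "?\<beta> - 1"])
    using bd' key_less[of d t, OF t(3,1)] s(1) interval_size_le[of "P i" s t] \<beta>(2,3) Db kb sb ab bb
    by linarith
qed

end

section \<open>Lexicographic descent as descent of numbers in base B\<close>

lemma lex_digit: "x < y \<Longrightarrow> r < B \<Longrightarrow> x * B + r < y * B + r'" for x y r r' B :: nat
  by (metis add.commute add_less_le_mono le_add2 le_less_trans less_le_trans mult.commute mult_Suc_right
      mult_le_mono2 Suc_leI add_less_cancel_left add_lessD1 nat_add_left_cancel_less)

definition lex_code :: "nat \<Rightarrow> nat \<Rightarrow> nat \<Rightarrow> nat \<Rightarrow> nat \<Rightarrow> nat \<Rightarrow> nat" where
  "lex_code B a b c d e = (((a * B + b) * B + c) * B + d) * B + e"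

text \<open>Only the lower digits of the smaller tuple have to be genuine digits; the larger tuple
  may be any upper bound.\<close>

lemma lex_code_less:
  assumes "b' < B" "c' < B" "d' < B" "e' < B"
    and "lex_less a' b' c' d' e' a b c d e"
  shows "lex_code B a' b' c' d' e' < lex_code B a b c d e"
  using assms unfolding lex_code_def by (elim disjE conjE) (simp_all add: lex_digit)

section \<open>Caratheodory reduction\<close>

text \<open>Subtracting \<open>\<mu> i / c i\<close> times the dependency \<open>c\<close>, scaled
  by \<open>c i\<close>. The minimal ratio keeps all weights nonnegative and makes weight
  \<open>i\<close> zero; every sum that the dependency annihilates is merely multiplied by
  \<open>c i\<close>.\<close>

lemma ratio_step:
  fixes \<mu> c :: "nat \<Rightarrow> int"
  assumes \<mu>: "\<And>j. j < m \<Longrightarrow> 0 \<le> \<mu> j" and i: "i < m" "0 < c i"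
    and min: "\<And>j. j < m \<Longrightarrow> 0 < c j \<Longrightarrow> \<mu> i * c j \<le> \<mu> j * c i"
  shows "j < m \<Longrightarrow> 0 \<le> c i * \<mu> j - \<mu> i * c j"
    and "(\<Sum>j<m. c j * h j) = 0 \<Longrightarrow>
      (\<Sum>j<m. (c i * \<mu> j - \<mu> i * c j) * h j) = c i * (\<Sum>j<m. \<mu> j * h j)"
proof -
  show "0 \<le> c i * \<mu> j - \<mu> i * c j" if "j < m"
  proof (cases "0 < c j")
    case True
    then show ?thesis using min[OF that] by (simp add: mult.commute)
  next
    case False
    then have "\<mu> i * c j \<le> 0" "0 \<le> c i * \<mu> j"
      using \<mu> i that by (auto simp: mult_nonneg_nonpos)
    then show ?thesis by simp
  qed
  assume "(\<Sum>j<m. c j * h j) = 0"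
  then show "(\<Sum>j<m. (c i * \<mu> j - \<mu> i * c j) * h j) = c i * (\<Sum>j<m. \<mu> j * h j)"
    by (simp add: left_diff_distrib sum_subtractf sum_distrib_left[symmetric] mult.assoc)
qed

lemma sum_delete:
  fixes F G :: "nat \<Rightarrow> int"
  assumes "i < m" "\<And>j. j < m - 1 \<Longrightarrow> G j = F (if j = i then m - 1 else j)"
  shows "(\<Sum>j<m - 1. G j) = (\<Sum>j<m. F j) - F i"
proof -
  obtain k where k: "m = Suc k" using assms by (cases m) auto
  show ?thesis
  proof (cases "i = k")
    case True
    then show ?thesis using assms k by simp
  next
    case False
    have "(\<Sum>j<k. G j) = G i + (\<Sum>j\<in>{..<k} - {i}. G j)"
      using assms k False by (simp add: sum.remove[of _ i])
    also have "\<dots> = F k + (\<Sum>j\<in>{..<k} - {i}. F j)"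
      using assms k False by auto
    also have "\<dots> = F k + (\<Sum>j<k. F j) - F i"
      using assms k False by (simp add: sum.remove[of _ i])
    finally show ?thesis using k by simp
  qed
qed

text \<open>
  Row \<open>r\<close> of \<open>C\<close> satisfies the equations that were processed so far, unless it was used as a pivot
  (\<open>us r \<noteq> 0\<close>).
\<close>

definition kernel_inv :: "nat \<Rightarrow> (nat \<Rightarrow> nat \<Rightarrow> int) \<Rightarrow> nat \<Rightarrow> (nat \<Rightarrow> int) \<Rightarrow> (nat \<Rightarrow> nat \<Rightarrow> int) \<Rightarrow> bool" where
  "kernel_inv N M c us C \<longleftrightarrow> card {r. r < N \<and> us r \<noteq> 0} \<le> c \<and>
     (\<forall>r<N. us r = 0 \<longrightarrow> C r r \<noteq> 0 \<and> (\<forall>r'<N. r' \<noteq> r \<longrightarrow> C r' r = 0) \<and>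
       (\<forall>c'<c. (\<Sum>j<N. C r j * M j c') = 0))"

lemma kernel_skip:
  assumes "kernel_inv N M c us C"
    and "\<And>r. r < N \<Longrightarrow> us r = 0 \<Longrightarrow> (\<Sum>j<N. C r j * M j c) = 0"
  shows "kernel_inv N M (Suc c) us C"
  using assms unfolding kernel_inv_def by (auto simp: less_Suc_eq)

text \<open>Cross multiplication with row \<open>q\<close> cancels equation \<open>c\<close> in
  every row that stays free. A free row \<open>r\<close> remains nonzero because
  \<open>C q r = 0\<close>: its diagonal entry is only multiplied by \<open>l q\<close>. For the
  same reason column \<open>r\<close> stays zero in all other rows.\<close>

lemma kernel_pivot:
  assumes inv: "kernel_inv N M c us C"
    and l: "\<And>r. r < N \<Longrightarrow> l r = (\<Sum>j<N. C r j * M j c)"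
    and q: "q < N" "us q = 0" "l q \<noteq> 0"
    and us': "\<And>r. r < N \<Longrightarrow> us' r = (if r = q then 1 else us r)"
    and C': "\<And>r j. r < N \<Longrightarrow> j < N \<Longrightarrow> C' r j = (if us' r = 0 then l q * C r j - l r * C q j else C r j)"
  shows "kernel_inv N M (Suc c) us' C'"
proof -
  have "us' r \<noteq> 0 \<longleftrightarrow> r = q \<or> us r \<noteq> 0" if "r < N" for r
    using us'[OF that] by simp
  then have "{r. r < N \<and> us' r \<noteq> 0} = insert q {r. r < N \<and> us r \<noteq> 0}"
    using q(1) by blast
  then have 1: "card {r. r < N \<and> us' r \<noteq> 0} \<le> Suc c"
    using inv unfolding kernel_inv_def by (simp add: card_insert_if)
  have "C' r r \<noteq> 0 \<and> (\<forall>r'<N. r' \<noteq> r \<longrightarrow> C' r' r = 0) \<and> (\<forall>c'<Suc c. (\<Sum>j<N. C' r j * M j c') = 0)"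
    if r: "r < N" "us' r = 0" for r
  proof -
    have rq: "r \<noteq> q" "us r = 0" using us'[OF r(1)] r(2) by (auto split: if_splits)
    have R: "C r r \<noteq> 0" "\<And>r'. r' < N \<Longrightarrow> r' \<noteq> r \<Longrightarrow> C r' r = 0"
      "\<And>c'. c' < c \<Longrightarrow> (\<Sum>j<N. C r j * M j c') = 0"
      using inv r(1) rq(2) unfolding kernel_inv_def by auto
    have Q: "\<And>c'. c' < c \<Longrightarrow> (\<Sum>j<N. C q j * M j c') = 0"
      using inv q unfolding kernel_inv_def by auto
    have S: "(\<Sum>j<N. C' r j * M j c') = l q * (\<Sum>j<N. C r j * M j c') - l r * (\<Sum>j<N. C q j * M j c')" for c'
    proof -
      have "(\<Sum>j<N. C' r j * M j c') = (\<Sum>j<N. l q * (C r j * M j c') - l r * (C q j * M j c'))"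
        by (rule sum.cong) (simp_all add: C'[OF r(1)] r(2) algebra_simps)
      then show ?thesis by (simp add: sum_subtractf sum_distrib_left)
    qed
    have "(\<Sum>j<N. C' r j * M j c') = 0" if "c' < Suc c" for c'
      using that S[of c'] R(3) Q l[OF r(1)] l[OF q(1)] by (cases "c' = c") (auto simp: mult.commute)
    moreover have "C' r r \<noteq> 0" using C'[OF r(1,1)] r(2) R(1) R(2)[OF q(1)] rq q(3) by simp
    moreover have "C' r' r = 0" if "r' < N" "r' \<noteq> r" for r'
      using C'[OF that(1) r(1)] R(2)[OF that] R(2)[OF q(1)] rq by simp
    ultimately show ?thesis by blast
  qed
  then show ?thesis using 1 unfolding kernel_inv_def by blast
qed

lemma kernel_unused:
  assumes "kernel_inv N M c us C" "c < N"
  shows "\<exists>r<N. us r = 0"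
proof (rule ccontr)
  assume "\<not> (\<exists>r<N. us r = 0)"
  then have "{r. r < N \<and> us r \<noteq> 0} = {..<N}" by auto
  then show False using assms unfolding kernel_inv_def by simp
qed

section \<open>Selecting the exchange\<close>

text \<open>
  Row \<open>j\<close> of the arrays \<open>pos\<close> and \<open>b\<close>, stored from cell \<open>j * n\<close> on, holds the positions of order \<open>j\<close> and its
  greedy base; \<open>mu\<close> holds the weights, \<open>m\<close> the number of orders, \<open>x\<close> the combination, \<open>d\<close> the labels.
  The oracle is queried at \<open>(S \<union> A) - B\<close>, which turns the minimization between \<open>A\<close> and \<open>V - B\<close> into an
  unconstrained one: \<open>S \<mapsto> (S \<union> A) - B\<close> preserves unions and intersections.
\<close>

abbreviation var :: "vname \<Rightarrow> aexp" where
  "var x \<equiv> Read x (Const 0)"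

abbreviation vec :: "vname \<Rightarrow> vname \<Rightarrow> aexp" where
  "vec a i \<equiv> Read a (var i)"

abbreviation index2 :: "aexp \<Rightarrow> aexp \<Rightarrow> aexp" where
  "index2 i j \<equiv> Add (Mul i (var ''n'')) j"

abbreviation cell :: "vname \<Rightarrow> vname \<Rightarrow> vname \<Rightarrow> aexp" where
  "cell a i j \<equiv> Read a (index2 (var i) (var j))"

abbreviation set_var :: "vname \<Rightarrow> aexp \<Rightarrow> prog" (infix "::=" 65) where
  "x ::= e \<equiv> PAssign x (Const 0) e"

abbreviation at_most :: "aexp \<Rightarrow> aexp \<Rightarrow> bexp" where
  "at_most d e \<equiv> BNot (Less e d)"

abbreviation either :: "bexp \<Rightarrow> bexp \<Rightarrow> bexp" where
  "either b c \<equiv> BNot (BAnd (BNot b) (BNot c))"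

abbreviation guarded :: "bexp \<Rightarrow> prog \<Rightarrow> prog" where
  "guarded b c \<equiv> PCond b c PSkip"

definition query_set :: "bexp \<Rightarrow> prog" where
  "query_set c = PFor ''w'' 1 0
    (PCond (BAnd (Equal (vec ''B'' ''w'') (Const 0)) (either c (BNot (Equal (vec ''A'' ''w'') (Const 0)))))
      (PAssign ''Y'' (var ''w'') (Const 1)) (PAssign ''Y'' (var ''w'') (Const 0)))"

definition base_row :: prog where
  "base_row = PFor ''v'' 1 0
    (query_set (at_most (cell ''pos'' ''k'' ''w'') (cell ''pos'' ''k'' ''v'')) ;;
     PValue ''h'' (Const 0) ''Y'' ;;
     query_set (Less (cell ''pos'' ''k'' ''w'') (cell ''pos'' ''k'' ''v'')) ;;
     PValue ''h'' (Const 1) ''Y'' ;;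
     PAssign ''b'' (index2 (var ''k'') (var ''v'')) (Sub (Read ''h'' (Const 0)) (Read ''h'' (Const 1))))"

text \<open>Loop lengths are linear expressions in \<open>n\<close>, so loops over the orders run a
  fixed \<open>2 * n + 3\<close> times with a guard. This is enough: at most n + 1 orders exist
  before a push, and it adds \<open>n\<close>.\<close>

definition add_column :: prog where
  "add_column = PFor ''j'' 2 3 (guarded (Less (var ''j'') (var ''m''))
    (PAssign ''x'' (var ''v'') (Add (vec ''x'' ''v'') (Mul (vec ''mu'' ''j'') (cell ''b'' ''j'' ''v'')))))"

definition compute_x :: prog where
  "compute_x = PFor ''v'' 1 0
    (PAssign ''x'' (var ''v'') (Const 0) ;; add_column)"

text \<open>The comparison of labels is not strict and indices increase, so among equal labels the
  last one wins. This maximizes \<open>key\<close>.\<close>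

definition select_t :: prog where
  "select_t = ''t'' ::= Const (-1) ;;
    PFor ''v'' 1 0 (guarded (BAnd (BAnd (Less (vec ''x'' ''v'') (Const 0)) (Less (vec ''d'' ''v'') (var ''n'')))
        (either (Less (var ''t'') (Const 0)) (at_most (vec ''d'' ''t'') (vec ''d'' ''v''))))
      (''t'' ::= var ''v''))"

text \<open>A later \<open>v\<close> overwrites an earlier one, so \<open>select_s\<close> ends with
  the largest admissible index, as the third component of the measure demands.\<close>

definition test_s :: prog where
  "test_s = PFor ''j'' 2 3 (guarded (BAnd (Less (var ''j'') (var ''m''))
        (BAnd (Equal (vec ''d'' ''t'') (Add (vec ''d'' ''v'') (Const 1)))
          (Less (cell ''pos'' ''j'' ''v'') (cell ''pos'' ''j'' ''t''))))
      (''s'' ::= var ''v''))"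

definition select_s :: prog where
  "select_s = ''s'' ::= Const (-1) ;; PFor ''v'' 1 0 test_s"

definition in_interval :: "vname \<Rightarrow> vname \<Rightarrow> bexp" where
  "in_interval i v = BAnd (Less (cell ''pos'' i ''s'') (cell ''pos'' i v))
    (at_most (cell ''pos'' i v) (cell ''pos'' i ''t''))"

definition count_interval :: prog where
  "count_interval = ''c'' ::= Const 0 ;;
    PFor ''v'' 1 0 (guarded (in_interval ''j'' ''v'') (''c'' ::= Add (var ''c'') (Const 1)))"

definition select_i :: prog where
  "select_i = ''best'' ::= Const 0 ;;
    PFor ''j'' 2 3 (guarded (Less (var ''j'') (var ''m''))
      (count_interval ;;
       guarded (Less (var ''best'') (var ''c'')) (''best'' ::= var ''c'' ;; ''i'' ::= var ''j'')))"

lemma written_basic [simp]: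
  "written (query_set c) = {''w'', ''Y''}"
  "written base_row = {''v'', ''w'', ''Y'', ''h'', ''b''}"
  "written add_column = {''x'', ''j''}"
  "written test_s = {''s'', ''j''}"
  "written compute_x = {''v'', ''x'', ''j''}"
  "written select_t = {''t'', ''v''}"
  "written select_s = {''s'', ''v'', ''j''}"
  "written count_interval = {''c'', ''v''}"
  "written select_i = {''best'', ''j'', ''c'', ''v'', ''i''}"
  by (auto simp: query_set_def base_row_def add_column_def test_s_def compute_x_def select_t_def select_s_def
      count_interval_def select_i_def)

lemma counters_safe_basic [simp]:
  "counters_safe (query_set c)" "counters_safe base_row" "counters_safe compute_x"
  "counters_safe select_t" "counters_safe select_s" "counters_safe count_interval"
  "counters_safe select_i"
  by (simp_all add: query_set_def)
    (simp_all add: base_row_def add_column_def test_s_def compute_x_def select_t_def select_s_def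
      count_interval_def select_i_def query_set_def)

text \<open>Row-major addressing is injective as long as column indices stay below the row
  length.\<close>

lemma index2_eq_iff [simp]:
  "int j < K \<Longrightarrow> int j' < K \<Longrightarrow> int i * K + int j = int i' * K + int j' \<longleftrightarrow> i = i' \<and> j = j'"
proof
  assume *: "int j < K" "int j' < K" "int i * K + int j = int i' * K + int j'"
  have "int i = (int i * K + int j) div K" "int i' = (int i' * K + int j') div K"
    using *(1,2) by simp_all
  then have "int i = int i'" using *(3) by metis
  then show "i = i' \<and> j = j'" using * by auto
qed simp

locale oracles =
  fixes n :: nat and val :: "nat set \<Rightarrow> int" and mem :: "nat set \<Rightarrow> bool"
begin

abbreviation run :: "prog \<Rightarrow> state \<Rightarrow> state" where
  "run \<equiv> sem n val mem"

lemma query_set: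
  assumes n: "s ''n'' 0 = int n"
    and c: "\<And>w t. w < n \<Longrightarrow> t ''w'' 0 = int w \<Longrightarrow>
      (\<And>y. y \<noteq> ''w'' \<Longrightarrow> y \<noteq> ''Y'' \<Longrightarrow> t y = s y) \<Longrightarrow> bval c t \<longleftrightarrow> Q w"
  shows "array_set n (run (query_set c) s ''Y'') = ({w. w < n \<and> Q w} \<union> array_set n (s ''A'')) - array_set n (s ''B'')"
proof -
  let ?Q = "({w. w < n \<and> Q w} \<union> array_set n (s ''A'')) - array_set n (s ''B'')"
  have "\<forall>j<n. run (query_set c) s ''Y'' (int j) \<noteq> 0 \<longleftrightarrow> j \<in> ?Q"
    unfolding query_set_def
  proof (rule For_induct[where I = "\<lambda>i t. \<forall>j<i. t ''Y'' (int j) \<noteq> 0 \<longleftrightarrow> j \<in> ?Q"])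
    fix i t
    assume i: "i < 1 * n + 0" "t ''w'' 0 = int i"
      and fr: "\<And>y. y \<noteq> ''w'' \<Longrightarrow> y \<notin> written (PCond (BAnd (Equal (vec ''B'' ''w'') (Const 0))
        (either c (BNot (Equal (vec ''A'' ''w'') (Const 0))))) (PAssign ''Y'' (var ''w'') (Const 1))
        (PAssign ''Y'' (var ''w'') (Const 0))) \<Longrightarrow> t y = s y"
      and IH: "\<forall>j<i. t ''Y'' (int j) \<noteq> 0 \<longleftrightarrow> j \<in> ?Q"
    have "bval c t \<longleftrightarrow> Q i" using c[of i t] i fr by simp
    then show "\<forall>j<Suc i. store (run (PCond (BAnd (Equal (vec ''B'' ''w'') (Const 0))
        (either c (BNot (Equal (vec ''A'' ''w'') (Const 0))))) (PAssign ''Y'' (var ''w'') (Const 1))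
        (PAssign ''Y'' (var ''w'') (Const 0))) t) ''w'' 0 (int (Suc i)) ''Y'' (int j) \<noteq> 0 \<longleftrightarrow> j \<in> ?Q"
      using i fr IH by (auto simp: array_set_def less_Suc_eq)
  qed simp_all
  then show ?thesis unfolding array_set_def by auto
qed

end

text \<open>The assumption concerns the transformed function only, so that overlapping
  \<open>A\<close> and \<open>B\<close>, which the enumeration of all pairs also produces, are
  covered.\<close>

locale minimization = oracles +
  fixes A B :: "nat set"
  assumes cut_submod: "X \<subseteq> {..<n} \<Longrightarrow> Y \<subseteq> {..<n} \<Longrightarrow>
    val (((X \<union> Y) \<union> A) - B) + val (((X \<inter> Y) \<union> A) - B) \<le> val ((X \<union> A) - B) + val ((Y \<union> A) - B)"

sublocale minimization \<subseteq> submodular_ground n "\<lambda>S. val ((S \<union> A) - B)"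
  by unfold_locales (rule cut_submod)

context minimization
begin

definition env :: "state \<Rightarrow> bool" where
  "env s \<longleftrightarrow> s ''n'' 0 = int n \<and> array_set n (s ''A'') = A \<and> array_set n (s ''B'') = B"

definition row :: "state \<Rightarrow> nat \<Rightarrow> nat \<Rightarrow> int" where
  "row s j v = s ''pos'' (int j * int n + int v)"

definition brow :: "state \<Rightarrow> nat \<Rightarrow> nat \<Rightarrow> int" where
  "brow s j v = s ''b'' (int j * int n + int v)"

definition wt :: "state \<Rightarrow> nat \<Rightarrow> int" where
  "wt s j = s ''mu'' (int j)"

definition orders :: "nat \<Rightarrow> state \<Rightarrow> bool" where
  "orders m s \<longleftrightarrow> (\<forall>j<m. inj_on (row s j) {..<n} \<and> (\<forall>v<n. brow s j v = base (row s j) v))"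

lemma base_row:
  assumes "env s" "s ''k'' 0 = int k"
  shows "v < n \<Longrightarrow> brow (run base_row s) k v = base (row s k) v"
    and "v < n \<Longrightarrow> j \<noteq> k \<Longrightarrow> brow (run base_row s) j v = brow s j v"
proof -
  let ?I = "\<lambda>i t. (\<forall>v<i. v < n \<longrightarrow> brow t k v = base (row s k) v) \<and> (\<forall>j v. v < n \<longrightarrow> j \<noteq> k \<longrightarrow> brow t j v = brow s j v)"
  have "?I n (run base_row s)"
    unfolding base_row_def
  proof (rule For_induct[where I = ?I], goal_cases)
    case 1
    then show ?case by (simp add: brow_def)
  next
    case (2 i t)
    note i = 2(1,2) and fr = 2(3) and IH = 2(4)
    have t: "t ''n'' 0 = int n" "array_set n (t ''A'') = A" "array_set n (t ''B'') = B"
      "t ''k'' 0 = int k" "t ''pos'' = s ''pos''"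
      using assms fr by (simp_all add: env_def)
    let ?q1 = "query_set (at_most (cell ''pos'' ''k'' ''w'') (cell ''pos'' ''k'' ''v''))"
    let ?q2 = "query_set (Less (cell ''pos'' ''k'' ''w'') (cell ''pos'' ''k'' ''v''))"
    have tv: "t ''v'' 0 = int i" using i by simp
    have "array_set n (run ?q1 t ''Y'') = ({w. w < n \<and> row s k w \<le> row s k i} \<union> array_set n (t ''A'')) - array_set n (t ''B'')"
      by (rule query_set) (simp_all add: t tv row_def not_less)
    then have q1: "array_set n (run ?q1 t ''Y'') = ({w. w < n \<and> row s k w \<le> row s k i} \<union> A) - B"
      using t by simp
    define t1 where "t1 = store (run ?q1 t) ''h'' 0 (val (array_set n (run ?q1 t ''Y'')))"
    have t1: "t1 y = t y" if "y \<notin> {''w'', ''Y'', ''h''}" for y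
      using that by (simp add: t1_def sem_unwritten)
    have "array_set n (run ?q2 t1 ''Y'') = ({w. w < n \<and> row s k w < row s k i} \<union> array_set n (t1 ''A'')) - array_set n (t1 ''B'')"
      by (rule query_set) (simp_all add: t t1 tv row_def not_less)
    then have q2: "array_set n (run ?q2 t1 ''Y'') = ({w. w < n \<and> row s k w < row s k i} \<union> A) - B"
      using t t1 by simp
    define t2 where "t2 = store (run ?q2 t1) ''h'' 1 (val (array_set n (run ?q2 t1 ''Y'')))"
    have t2: "t2 y = t y" if "y \<notin> {''w'', ''Y'', ''h''}" for y
      using that by (simp add: t2_def sem_unwritten t1)
    have h: "t2 ''h'' 0 - t2 ''h'' 1 = base (row s k) i"
    proof -
      have "t2 ''h'' 0 = t1 ''h'' 0" "t2 ''h'' 1 = val (array_set n (run ?q2 t1 ''Y''))"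
        by (simp_all add: t2_def sem_unwritten)
      moreover have "t1 ''h'' 0 = val (array_set n (run ?q1 t ''Y''))"
        by (simp add: t1_def)
      ultimately show ?thesis unfolding q1 q2 base_def by simp
    qed
    have "run (?q1 ;; PValue ''h'' (Const 0) ''Y'' ;; ?q2 ;; PValue ''h'' (Const 1) ''Y'' ;;
        PAssign ''b'' (index2 (var ''k'') (var ''v'')) (Sub (Read ''h'' (Const 0)) (Read ''h'' (Const 1)))) t =
      store t2 ''b'' (int k * int n + int i) (base (row s k) i)"
      by (simp add: t2_def[unfolded t1_def, symmetric] h t2 t tv)
    then show ?case
      using IH i t2 by (auto simp: less_Suc_eq brow_def)
  qed simp
  then show "v < n \<Longrightarrow> brow (run base_row s) k v = base (row s k) v"
    and "v < n \<Longrightarrow> j \<noteq> k \<Longrightarrow> brow (run base_row s) j v = brow s j v" by auto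
qed


lemma add_column:
  assumes s: "s ''n'' 0 = int n" "s ''m'' 0 = int m" "s ''v'' 0 = int v" and m: "m \<le> 2 * n + 3"
  shows "run add_column s ''x'' = (s ''x'')(int v := s ''x'' (int v) + (\<Sum>j<m. wt s j * brow s j v))"
proof -
  let ?I = "\<lambda>i t. t ''x'' = (s ''x'')(int v := s ''x'' (int v) + (\<Sum>j<min i m. wt s j * brow s j v))"
  have "?I (2 * n + 3) (run add_column s)"
    unfolding add_column_def
  proof (rule For_induct[where I = ?I], goal_cases)
    case (2 i t)
    note i = 2(1,2) and fr = 2(3) and IH = 2(4)
    have t: "t y = s y" if "y \<notin> {''j'', ''x''}" for y using fr that by simp
    show ?case
    proof (cases "i < m")
      case True
      then have "min i m = i" "min (Suc i) m = Suc i" by simp_all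
      then show ?thesis using True i IH s t by (simp add: wt_def brow_def fun_eq_iff)
    next
      case False
      then have "min i m = m" "min (Suc i) m = m" by simp_all
      then show ?thesis using False i IH s t by (simp add: fun_eq_iff)
    qed
  qed simp_all
  then show ?thesis using m by (simp add: min_absorb2)
qed

lemma compute_x:
  assumes s: "s ''n'' 0 = int n" "s ''m'' 0 = int m" and m: "m \<le> 2 * n + 3" and o: "orders m s"
    and v: "v < n"
  shows "run compute_x s ''x'' (int v) = comb m (row s) (wt s) v"
proof -
  let ?I = "\<lambda>i t. \<forall>v<i. v < n \<longrightarrow> t ''x'' (int v) = (\<Sum>j<m. wt s j * brow s j v)"
  have "?I n (run compute_x s)"
    unfolding compute_x_def
  proof (rule For_induct[where I = ?I], goal_cases)
    case (2 i t)
    note i = 2(1,2) and fr = 2(3) and IH = 2(4)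
    have t: "t y = s y" if "y \<notin> {''v'', ''j'', ''x''}" for y using fr that by simp
    let ?t = "store t ''x'' (int i) 0"
    have "run add_column ?t ''x'' = (?t ''x'')(int i := ?t ''x'' (int i) + (\<Sum>j<m. wt ?t j * brow ?t j i))"
      by (rule add_column) (use s m i t in simp_all)
    then show ?case
      using i IH t by (simp add: less_Suc_eq wt_def brow_def)
  qed simp_all
  moreover have "comb m (row s) (wt s) v = (\<Sum>j<m. wt s j * brow s j v)"
    using o v unfolding comb_def orders_def by (intro sum.cong) auto
  ultimately show ?thesis using v by simp
qed

lemma select_t:
  fixes d :: "nat \<Rightarrow> nat" and x :: "nat \<Rightarrow> int"
  assumes s: "s ''n'' 0 = int n" "\<And>v. v < n \<Longrightarrow> s ''d'' (int v) = int (d v)"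
    "\<And>v. v < n \<Longrightarrow> s ''x'' (int v) = x v"
  shows "(run select_t s ''t'' 0 < 0 \<and> (\<forall>v<n. x v < 0 \<longrightarrow> n \<le> d v)) \<or>
    (\<exists>t<n. run select_t s ''t'' 0 = int t \<and> x t < 0 \<and> d t < n \<and>
      (\<forall>v<n. x v < 0 \<longrightarrow> d v < n \<longrightarrow> key d v \<le> key d t))"
proof -
  let ?I = "\<lambda>i s. (s ''t'' 0 < 0 \<and> (\<forall>v<i. x v < 0 \<longrightarrow> n \<le> d v)) \<or>
    (\<exists>t<i. s ''t'' 0 = int t \<and> x t < 0 \<and> d t < n \<and>
      (\<forall>v<i. x v < 0 \<longrightarrow> d v < n \<longrightarrow> key d v \<le> key d t))"
  let ?s = "store s ''t'' 0 (-1)"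
  let ?c = "guarded (BAnd (BAnd (Less (vec ''x'' ''v'') (Const 0)) (Less (vec ''d'' ''v'') (var ''n'')))
        (either (Less (var ''t'') (Const 0)) (at_most (vec ''d'' ''t'') (vec ''d'' ''v''))))
      (''t'' ::= var ''v'')"
  have "?I n (run (PFor ''v'' 1 0 ?c) ?s)"
  proof (rule For_induct[where I = ?I], goal_cases)
    case (2 i t)
    note i = 2(1,2) and fr = 2(3) and IH = 2(4)
    have t: "t y = s y" if "y \<notin> {''v'', ''t''}" for y using fr that by simp
    have i': "i < n" using i by simp
    let ?t = "store (run ?c t) ''v'' 0 (int (Suc i))"
    show ?case
    proof (cases "x i < 0 \<and> d i < n")
      case False
      then have "?t ''t'' = t ''t''" using i i' t s by (cases "x i < 0") simp_all
      then show ?thesis using IH False by (auto simp: less_Suc_eq)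
    next
      case cand: True
      from IH show ?thesis
      proof (elim disjE exE conjE)
        assume "t ''t'' 0 < 0" "\<forall>v<i. x v < 0 \<longrightarrow> n \<le> d v"
        moreover from this have "?t ''t'' 0 = int i" using i i' t s cand by simp
        ultimately show ?thesis using cand by (intro disjI2 exI[of _ i]) (auto simp: less_Suc_eq)
      next
        fix u assume u: "u < i" "t ''t'' 0 = int u" "x u < 0" "d u < n"
          "\<forall>v<i. x v < 0 \<longrightarrow> d v < n \<longrightarrow> key d v \<le> key d u"
        show ?thesis
        proof (cases "d u \<le> d i")
          case True
          then have "?t ''t'' 0 = int i" using i i' t s cand u by simp
          moreover have "key d u \<le> key d i"
            using True u(1) unfolding key_def by (intro add_mono mult_le_mono1) auto
          ultimately show ?thesis
            using cand u by (intro disjI2 exI[of _ i]) (auto simp: less_Suc_eq)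
        next
          case False
          then have "?t ''t'' 0 = int u" using i i' t s cand u by simp
          moreover have "key d i \<le> key d u"
          proof -
            have "key d i \<le> d i * n + n" using i' unfolding key_def by simp
            also have "\<dots> = Suc (d i) * n" by simp
            also have "\<dots> \<le> d u * n" using False by (intro mult_le_mono1) simp
            finally show ?thesis unfolding key_def by simp
          qed
          ultimately show ?thesis
            using cand u by (intro disjI2 exI[of _ u]) (auto simp: less_Suc_eq)
        qed
      qed
    qed
  qed simp_all
  then show ?thesis by (simp add: select_t_def)
qed

lemma test_s:
  fixes d :: "nat \<Rightarrow> nat"
  assumes s: "s ''n'' 0 = int n" "s ''m'' 0 = int m" "s ''t'' 0 = int t" "s ''v'' 0 = int v"
    "s ''d'' (int v) = int (d v)" "s ''d'' (int t) = int (d t)" and m: "m \<le> 2 * n + 3"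
  shows "run test_s s ''s'' 0 =
    (if d t = Suc (d v) \<and> (\<exists>j<m. row s j v < row s j t) then int v else s ''s'' 0)"
proof -
  let ?I = "\<lambda>i u. u ''s'' 0 = (if d t = Suc (d v) \<and> (\<exists>j<i. j < m \<and> row s j v < row s j t) then int v else s ''s'' 0)"
  have "?I (2 * n + 3) (run test_s s)"
    unfolding test_s_def
  proof (rule For_induct[where I = ?I], goal_cases)
    case (2 i u)
    note i = 2(1,2) and fr = 2(3) and IH = 2(4)
    have u: "u y = s y" if "y \<notin> {''j'', ''s''}" for y using fr that by simp
    show ?case
      using i IH s u by (auto simp: row_def less_Suc_eq)
  qed simp_all
  moreover have "(\<exists>j<2 * n + 3. j < m \<and> row s j v < row s j t) \<longleftrightarrow> (\<exists>j<m. row s j v < row s j t)"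
    using m by (meson less_le_trans)
  ultimately show ?thesis by simp
qed

lemma select_s:
  fixes d :: "nat \<Rightarrow> nat"
  assumes s: "s ''n'' 0 = int n" "s ''m'' 0 = int m" "s ''t'' 0 = int t"
    "\<And>v. v < n \<Longrightarrow> s ''d'' (int v) = int (d v)" and m: "m \<le> 2 * n + 3" and t: "t < n"
  shows "(run select_s s ''s'' 0 < 0 \<and> (\<forall>v<n. \<not> (d t = Suc (d v) \<and> (\<exists>j<m. row s j v < row s j t)))) \<or>
    (\<exists>a<n. run select_s s ''s'' 0 = int a \<and> d t = Suc (d a) \<and> (\<exists>j<m. row s j a < row s j t) \<and>
      (\<forall>v<n. d t = Suc (d v) \<longrightarrow> (\<exists>j<m. row s j v < row s j t) \<longrightarrow> v \<le> a))"
proof -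
  let ?E = "\<lambda>v. d t = Suc (d v) \<and> (\<exists>j<m. row s j v < row s j t)"
  let ?I = "\<lambda>i u. (u ''s'' 0 < 0 \<and> (\<forall>v<i. \<not> ?E v)) \<or>
    (\<exists>a<i. u ''s'' 0 = int a \<and> ?E a \<and> (\<forall>v<i. ?E v \<longrightarrow> v \<le> a))"
  let ?s = "store s ''s'' 0 (-1)"
  have "?I n (run (PFor ''v'' 1 0 test_s) ?s)"
  proof (rule For_induct[where I = ?I], goal_cases)
    case (2 i u)
    note i = 2(1,2) and fr = 2(3) and IH = 2(4)
    have u: "u y = s y" if "y \<notin> {''v'', ''j'', ''s''}" for y using fr that by simp
    have row: "row u j v = row s j v" for j v using u by (simp add: row_def)
    have "run test_s u ''s'' 0 = (if ?E i then int i else u ''s'' 0)"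
      by (subst test_s[where m = m and t = t and v = i and d = d])
        (use s m i u t in \<open>simp_all add: row\<close>)
    then show ?case
      using IH by (auto simp: less_Suc_eq)
  qed simp_all
  then show ?thesis by (auto simp: select_s_def)
qed

lemma count_interval:
  assumes s: "s ''n'' 0 = int n" "s ''j'' 0 = int j" "s ''s'' 0 = int a" "s ''t'' 0 = int t"
  shows "run count_interval s ''c'' 0 = int (interval_size (row s j) a t)"
proof -
  let ?C = "\<lambda>i. {v. v < i \<and> row s j a < row s j v \<and> row s j v \<le> row s j t}"
  let ?I = "\<lambda>i u. u ''c'' 0 = int (card (?C i))"
  have "?I n (run (PFor ''v'' 1 0 (guarded (in_interval ''j'' ''v'') (''c'' ::= Add (var ''c'') (Const 1))))
      (store s ''c'' 0 0))"
  proof (rule For_induct[where I = ?I], goal_cases)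
    case (2 i u)
    note i = 2(1,2) and fr = 2(3) and IH = 2(4)
    have u: "u y = s y" if "y \<notin> {''v'', ''c''}" for y using fr that by simp
    have "?C (Suc i) = (if row s j a < row s j i \<and> row s j i \<le> row s j t then insert i (?C i) else ?C i)"
      by (auto simp: less_Suc_eq)
    then show ?case
      using i IH s u by (simp add: in_interval_def row_def not_less)
  qed simp_all
  then show ?thesis by (simp add: count_interval_def interval_size_def)
qed

text \<open>The start value 0 of \<open>best\<close> is safe: an order with \<open>a\<close> before
  \<open>t\<close> has \<open>t\<close> itself in its interval. Conversely, a positive size shows
  that the chosen order places \<open>a\<close> before \<open>t\<close>.\<close>

lemma select_i:
  assumes s: "s ''n'' 0 = int n" "s ''m'' 0 = int m" "s ''s'' 0 = int a" "s ''t'' 0 = int t"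
    and m: "m \<le> 2 * n + 3" and t: "t < n" and ex: "\<exists>j<m. row s j a < row s j t"
  shows "\<exists>i<m. run select_i s ''i'' 0 = int i \<and> row s i a < row s i t \<and>
    (\<forall>j<m. interval_size (row s j) a t \<le> interval_size (row s i) a t)"
proof -
  let ?z = "\<lambda>j. interval_size (row s j) a t"
  let ?I = "\<lambda>k u. \<exists>M. u ''best'' 0 = int M \<and> (\<forall>j<k. j < m \<longrightarrow> ?z j \<le> M) \<and>
    (M = 0 \<or> (\<exists>i<m. u ''i'' 0 = int i \<and> ?z i = M))"
  let ?s = "store s ''best'' 0 0"
  let ?c = "guarded (Less (var ''j'') (var ''m'')) (count_interval ;;
       guarded (Less (var ''best'') (var ''c'')) (''best'' ::= var ''c'' ;; ''i'' ::= var ''j''))"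
  have "?I (2 * n + 3) (run (PFor ''j'' 2 3 ?c) ?s)"
  proof (rule For_induct[where I = ?I], goal_cases)
    case (2 k u)
    note i = 2(1,2) and fr = 2(3) and IH = 2(4)
    have u: "u y = s y" if "y \<notin> {''best'', ''j'', ''c'', ''v'', ''i''}" for y using fr that by simp
    have row: "row u j = row s j" for j using u by (simp add: row_def fun_eq_iff)
    have c: "run count_interval u ''c'' 0 = int (?z k)"
      by (subst count_interval[where j = k and a = a and t = t]) (use s i u in \<open>simp_all add: row\<close>)
    obtain M where M: "u ''best'' 0 = int M" "\<forall>j<k. j < m \<longrightarrow> ?z j \<le> M"
      "M = 0 \<or> (\<exists>i<m. u ''i'' 0 = int i \<and> ?z i = M)" using IH by blast
    let ?u = "store (run ?c u) ''j'' 0 (int (Suc k))"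
    show ?case
    proof (cases "k < m \<and> M < ?z k")
      case True
      then have "?u ''best'' 0 = int (?z k)" "?u ''i'' 0 = int k"
        using i u s c M by (simp_all add: sem_unwritten)
      then show ?thesis using True M by (intro exI[of _ "?z k"]) (auto simp: less_Suc_eq)
    next
      case False
      then have "?u ''best'' 0 = int M" "?u ''i'' 0 = u ''i'' 0"
        using i u s c M by (auto simp: sem_unwritten)
      then show ?thesis using False M by (intro exI[of _ M]) (auto simp: less_Suc_eq)
    qed
  qed simp_all
  then obtain M where M: "run select_i s ''best'' 0 = int M" "\<forall>j<m. ?z j \<le> M"
      "M = 0 \<or> (\<exists>i<m. run select_i s ''i'' 0 = int i \<and> ?z i = M)"
    using m unfolding select_i_def by fastforce
  obtain j where j: "j < m" "row s j a < row s j t" using ex by blast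
  have "t \<in> {v. v < n \<and> row s j a < row s j v \<and> row s j v \<le> row s j t}" using j t by simp
  then have "0 < ?z j" unfolding interval_size_def by (auto simp: card_gt_0_iff)
  then have "0 < M" using M(2) j(1) by force
  then obtain i where i: "i < m" "run select_i s ''i'' 0 = int i" "?z i = M" using M(3) by auto
  then have "{v. v < n \<and> row s i a < row s i v \<and> row s i v \<le> row s i t} \<noteq> {}"
    using \<open>0 < M\<close> unfolding interval_size_def by (metis card.empty less_nat_zero_code)
  then have "row s i a < row s i t" by auto
  then show ?thesis using i M(2) by blast
qed

end

section \<open>Exchange combinations\<close>

definition move_row :: prog where
  "move_row = PFor ''v'' 1 0 (PCond (Equal (var ''v'') (var ''q''))
    (PAssign ''pos'' (index2 (var ''k'') (var ''v'')) (Sub (Mul (Const 2) (cell ''pos'' ''i'' ''s'')) (Const 1)))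
    (PAssign ''pos'' (index2 (var ''k'') (var ''v'')) (Mul (Const 2) (cell ''pos'' ''i'' ''v''))))"

text \<open>
  For \<open>u\<close> outside the interval the move of \<open>t\<close> is appended once more, with coefficient 0, so that
  always \<open>n\<close> rows are added and row \<open>m + u\<close> belongs to \<open>u\<close>.
\<close>

definition append_move :: prog where
  "append_move = ''k'' ::= Add (var ''m'') (var ''u'') ;;
    PCond (in_interval ''i'' ''u'') (''q'' ::= var ''u'') (''q'' ::= var ''t'') ;;
    move_row ;; base_row"

definition append_moves :: prog where
  "append_moves = PFor ''u'' 1 0 append_move"

definition difference :: "vname \<Rightarrow> vname \<Rightarrow> aexp" where
  "difference u v = Sub (Read ''b'' (index2 (Add (var ''m'') (var u)) (var v))) (cell ''b'' ''i'' v)"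

definition elim_start :: prog where
  "elim_start = PFor ''u'' 1 0
    (PCond (Equal (var ''u'') (var ''t'')) (PAssign ''co'' (var ''u'') (Const 1)) (PAssign ''co'' (var ''u'') (Const 0)) ;;
     PAssign ''r'' (var ''u'') (difference ''t'' ''u''))"

definition find_pending :: prog where
  "find_pending = ''z'' ::= Const (-1) ;;
    PFor ''v'' 1 0 (guarded
      (BAnd (BAnd (Less (cell ''pos'' ''i'' ''s'') (cell ''pos'' ''i'' ''v'')) (Less (cell ''pos'' ''i'' ''v'') (cell ''pos'' ''i'' ''t'')))
        (BAnd (BNot (Equal (vec ''r'' ''v'') (Const 0)))
          (either (Less (var ''z'') (Const 0)) (Less (cell ''pos'' ''i'' ''z'') (cell ''pos'' ''i'' ''v'')))))
      (''z'' ::= var ''v''))"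

definition combine :: prog where
  "combine = PFor ''u'' 1 0
    (PAssign ''co'' (var ''u'') (Mul (var ''p'') (vec ''co'' ''u'')) ;;
     PAssign ''r'' (var ''u'') (Sub (Mul (var ''p'') (vec ''r'' ''u'')) (Mul (var ''e'') (difference ''z'' ''u''))))"

text \<open>\<open>e\<close> saves the entry of \<open>r\<close> at \<open>z\<close>, which
  \<open>combine\<close> overwrites. That entry is negative, so subtracting it increases the
  coefficient of \<open>z\<close>.\<close>

definition eliminate :: prog where
  "eliminate = ''p'' ::= difference ''z'' ''z'' ;; ''e'' ::= vec ''r'' ''z'' ;; combine ;;
    PAssign ''co'' (var ''z'') (Sub (vec ''co'' ''z'') (var ''e''))"

definition elimination :: prog where
  "elimination = elim_start ;;
    PFor ''q'' 1 0 (find_pending ;; guarded (BNot (Less (var ''z'') (Const 0))) eliminate)"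

lemma written_elimination [simp]:
  "written move_row = {''v'', ''pos''}"
  "written append_move = {''k'', ''q'', ''v'', ''pos'', ''w'', ''Y'', ''h'', ''b''}"
  "written append_moves = {''u'', ''k'', ''q'', ''v'', ''pos'', ''w'', ''Y'', ''h'', ''b''}"
  "written elim_start = {''u'', ''co'', ''r''}"
  "written find_pending = {''z'', ''v''}"
  "written combine = {''u'', ''co'', ''r''}"
  "written eliminate = {''p'', ''e'', ''u'', ''co'', ''r''}"
  "written elimination = {''q'', ''z'', ''v'', ''p'', ''e'', ''u'', ''co'', ''r''}"
  by (auto simp: move_row_def append_move_def append_moves_def elim_start_def find_pending_def
      combine_def eliminate_def elimination_def)

lemma counters_safe_elimination [simp]:
  "counters_safe move_row" "counters_safe append_move" "counters_safe append_moves"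
  "counters_safe elim_start" "counters_safe find_pending" "counters_safe combine"
  "counters_safe eliminate" "counters_safe elimination"
proof -
  show 1: "counters_safe move_row" "counters_safe elim_start" "counters_safe find_pending"
    "counters_safe combine"
    by (simp_all add: move_row_def elim_start_def find_pending_def combine_def)
  show 2: "counters_safe append_move" "counters_safe eliminate"
    using 1 by (simp_all add: append_move_def eliminate_def)
  show "counters_safe append_moves" "counters_safe elimination"
    using 1 2 by (simp_all add: append_moves_def elimination_def)
qed

context minimization
begin

lemma orders_cong:
  assumes "orders m s"
    and "\<And>j v. j < m \<Longrightarrow> v < n \<Longrightarrow> row s' j v = row s j v"
    and "\<And>j v. j < m \<Longrightarrow> v < n \<Longrightarrow> brow s' j v = brow s j v"
  shows "orders m s'"
  unfolding orders_def
proof (intro allI impI conjI)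
  fix j assume j: "j < m"
  have "inj_on (row s' j) {..<n} \<longleftrightarrow> inj_on (row s j) {..<n}"
    using assms(2)[OF j] by (intro inj_on_cong) simp
  then show "inj_on (row s' j) {..<n}" using assms(1) j unfolding orders_def by blast
  fix v assume v: "v < n"
  have "base (row s' j) v = base (row s j) v"
    using assms(2)[OF j] v by (intro base_cong) auto
  then show "brow s' j v = base (row s' j) v"
    using assms(1,3) j v unfolding orders_def by simp
qed

lemma move_row:
  assumes s: "s ''n'' 0 = int n" "s ''k'' 0 = int k" "s ''i'' 0 = int i" "s ''s'' 0 = int a" "s ''q'' 0 = int q"
    and ik: "i \<noteq> k" and a: "a < n"
  shows "v < n \<Longrightarrow> row (run move_row s) k v = move (row s i) a q v"
    and "v < n \<Longrightarrow> j \<noteq> k \<Longrightarrow> row (run move_row s) j v = row s j v"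
proof -
  let ?I = "\<lambda>x t. (\<forall>v<x. v < n \<longrightarrow> row t k v = move (row s i) a q v) \<and> (\<forall>j v. v < n \<longrightarrow> j \<noteq> k \<longrightarrow> row t j v = row s j v)"
  have "?I n (run move_row s)"
    unfolding move_row_def
  proof (rule For_induct[where I = ?I], goal_cases)
    case (2 x t)
    note x = 2(1,2) and fr = 2(3) and IH = 2(4)
    have t: "t y = s y" if "y \<notin> {''v'', ''pos''}" for y using fr that by simp
    let ?c = "PCond (Equal (var ''v'') (var ''q''))
      (PAssign ''pos'' (index2 (var ''k'') (var ''v'')) (Sub (Mul (Const 2) (cell ''pos'' ''i'' ''s'')) (Const 1)))
      (PAssign ''pos'' (index2 (var ''k'') (var ''v'')) (Mul (Const 2) (cell ''pos'' ''i'' ''v'')))"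
    have "row t i a = row s i a" "row t i x = row s i x" using IH ik a x by auto
    then have "run ?c t = store t ''pos'' (int k * int n + int x) (move (row s i) a q x)"
      using s t x by (simp add: row_def move_def)
    then show ?case
      using IH x by (simp add: row_def less_Suc_eq)
  qed (simp_all add: row_def)
  then show "v < n \<Longrightarrow> row (run move_row s) k v = move (row s i) a q v"
    and "v < n \<Longrightarrow> j \<noteq> k \<Longrightarrow> row (run move_row s) j v = row s j v" by auto
qed

lemma env_run: "env s \<Longrightarrow> {''n'', ''A'', ''B''} \<inter> written c = {} \<Longrightarrow> env (run c s)"
  unfolding env_def by (simp add: sem_unwritten)

lemma row_run: "''pos'' \<notin> written c \<Longrightarrow> row (run c s) = row s"
  unfolding row_def by (simp add: sem_unwritten)

lemma brow_run: "''b'' \<notin> written c \<Longrightarrow> brow (run c s) = brow s"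
  unfolding brow_def by (simp add: sem_unwritten)

lemma row_store [simp]: "x \<noteq> ''pos'' \<Longrightarrow> row (store s x i v) = row s"
  by (simp add: row_def fun_eq_iff)

lemma brow_store [simp]: "x \<noteq> ''b'' \<Longrightarrow> brow (store s x i v) = brow s"
  by (simp add: brow_def fun_eq_iff)

lemma wt_store [simp]: "x \<noteq> ''mu'' \<Longrightarrow> wt (store s x i v) = wt s"
  by (simp add: wt_def fun_eq_iff)

lemma env_store [simp]: "x \<notin> {''n'', ''A'', ''B''} \<Longrightarrow> env (store s x i v) = env s"
  by (auto simp: env_def)

definition target :: "(nat \<Rightarrow> int) \<Rightarrow> nat \<Rightarrow> nat \<Rightarrow> nat \<Rightarrow> nat" where
  "target p a t u = (if p a < p u \<and> p u \<le> p t then u else t)"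

lemma append_move:
  assumes s: "env s" "s ''m'' 0 = int m" "s ''u'' 0 = int u" "s ''i'' 0 = int i" "s ''s'' 0 = int a" "s ''t'' 0 = int t"
    and i: "i < m" and a: "a < n"
  shows "v < n \<Longrightarrow> row (run append_move s) (m + u) v = move (row s i) a (target (row s i) a t u) v"
    and "v < n \<Longrightarrow> j \<noteq> m + u \<Longrightarrow> row (run append_move s) j v = row s j v"
    and "v < n \<Longrightarrow> brow (run append_move s) (m + u) v = base (row (run append_move s) (m + u)) v"
    and "v < n \<Longrightarrow> j \<noteq> m + u \<Longrightarrow> brow (run append_move s) j v = brow s j v"
proof -
  define s1 where "s1 = run (''k'' ::= Add (var ''m'') (var ''u'') ;;
    PCond (in_interval ''i'' ''u'') (''q'' ::= var ''u'') (''q'' ::= var ''t'')) s"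
  have n: "s ''n'' 0 = int n" using s unfolding env_def by simp
  have s1: "s1 y = s y" if "y \<notin> {''k'', ''q''}" for y
    using that by (simp add: s1_def)
  have k: "s1 ''k'' 0 = int (m + u)" using s by (simp add: s1_def)
  have q: "s1 ''q'' 0 = int (target (row s i) a t u)"
    using s n by (simp add: s1_def in_interval_def target_def row_def not_less)
  have rows: "row s1 = row s" "brow s1 = brow s"
    by (simp_all add: row_def brow_def s1 fun_eq_iff)
  define s2 where "s2 = run move_row s1"
  have run: "run append_move s = run base_row s2"
    by (simp add: append_move_def s1_def s2_def)
  have m1: "row s2 (m + u) v = move (row s i) a (target (row s i) a t u) v" if "v < n" for v
    using move_row(1)[of s1 "m + u" i a _ v] that s n k q i a by (simp add: s1 s2_def rows)
  have m2: "row s2 j v = row s j v" if "v < n" "j \<noteq> m + u" for j v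
    using move_row(2)[of s1 "m + u" i a _ v j] that s n k q i a by (simp add: s1 s2_def rows)
  have s2: "env s2" "s2 ''k'' 0 = int (m + u)" "brow s2 = brow s"
    using s k by (simp_all add: s2_def env_def s1 sem_unwritten brow_run rows)
  have r: "row (run base_row s2) = row s2" by (simp add: row_run)
  show "v < n \<Longrightarrow> row (run append_move s) (m + u) v = move (row s i) a (target (row s i) a t u) v"
    and "v < n \<Longrightarrow> j \<noteq> m + u \<Longrightarrow> row (run append_move s) j v = row s j v"
    using m1 m2 by (simp_all add: run r)
  show "v < n \<Longrightarrow> brow (run append_move s) (m + u) v = base (row (run append_move s) (m + u)) v"
    and "v < n \<Longrightarrow> j \<noteq> m + u \<Longrightarrow> brow (run append_move s) j v = brow s j v"
    using base_row[OF s2(1,2)] s2(3) by (simp_all add: run r)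
qed

lemma append_moves:
  assumes s: "env s" "s ''m'' 0 = int m" "s ''i'' 0 = int i" "s ''s'' 0 = int a" "s ''t'' 0 = int t"
    and i: "i < m" and a: "a < n" "t < n" and o: "orders m s"
  shows "j < m + n \<Longrightarrow> v < n \<Longrightarrow> row (run append_moves s) j v =
      (if j < m then row s j v else move (row s i) a (target (row s i) a t (j - m)) v)"
    and "orders (m + n) (run append_moves s)"
proof -
  let ?m = "\<lambda>u. move (row s i) a (target (row s i) a t u)"
  let ?I = "\<lambda>u w. (\<forall>j v. v < n \<longrightarrow> j < m + u \<longrightarrow> row w j v = (if j < m then row s j v else ?m (j - m) v)) \<and> orders (m + u) w"
  have "?I n (run append_moves s)"
    unfolding append_moves_def
  proof (rule For_induct[where I = ?I], goal_cases)
    case 1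
    show ?case using orders_cong[OF o] by simp
  next
    case (2 u w)
    note u = 2(1,2) and fr = 2(3)
    have IH: "\<And>j v. v < n \<Longrightarrow> j < m + u \<Longrightarrow> row w j v = (if j < m then row s j v else ?m (j - m) v)"
      "orders (m + u) w" using 2(4) by blast+
    have w: "w y = s y" if "y \<notin> {''u'', ''k'', ''q'', ''v'', ''pos'', ''w'', ''Y'', ''h'', ''b''}" for y
      using fr that by simp
    have pre: "env w" "w ''m'' 0 = int m" "w ''u'' 0 = int u" "w ''i'' 0 = int i" "w ''s'' 0 = int a" "w ''t'' 0 = int t"
      using s u w by (simp_all add: env_def)
    note A = append_move[OF pre i a(1)]
    let ?w = "run append_move w"
    have ri: "row w i v = row s i v" if "v < n" for v using IH(1)[OF that] i by simp
    have mv: "move (row w i) a (target (row w i) a t u) v = ?m u v" if "v < n" for v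
    proof -
      have "target (row w i) a t u = target (row s i) a t u"
        using ri a u by (simp add: target_def)
      then show ?thesis using ri that a unfolding move_def by simp
    qed
    have new: "row ?w (m + u) v = ?m u v" if "v < n" for v
      using A(1)[OF that] mv[OF that] by simp
    have 1: "row ?w j v = (if j < m then row s j v else ?m (j - m) v)" if "v < n" "j < m + Suc u" for j v
      using that new A(2)[OF that(1)] IH(1)[OF that(1)] by (cases "j = m + u") auto
    have "orders (m + u) ?w"
      using A(2,4) by (intro orders_cong[OF IH(2)]) simp_all
    moreover have "inj_on (row ?w (m + u)) {..<n}"
    proof -
      have "inj_on (row s i) {..<n}" using o i unfolding orders_def by blast
      then have "inj_on (?m u) {..<n}" by (rule inj_move)
      then show ?thesis using new by (subst inj_on_cong[where g = "?m u"]) auto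
    qed
    ultimately have "orders (m + Suc u) ?w"
      using A(3) unfolding orders_def by (auto simp: less_Suc_eq)
    then show ?case using 1 by (simp add: orders_def)
  qed simp
  then show "j < m + n \<Longrightarrow> v < n \<Longrightarrow> row (run append_moves s) j v =
      (if j < m then row s j v else move (row s i) a (target (row s i) a t (j - m)) v)"
    and "orders (m + n) (run append_moves s)" by simp_all
qed

lemma difference:
  assumes "s ''n'' 0 = int n" "s ''m'' 0 = int m" "s ''i'' 0 = int i" "s x 0 = int u" "s y 0 = int v"
  shows "aval (difference x y) s = brow s (m + u) v - brow s i v"
  using assms by (simp add: difference_def brow_def)

lemma elim_start:
  assumes s: "s ''n'' 0 = int n" "s ''m'' 0 = int m" "s ''i'' 0 = int i" "s ''t'' 0 = int t"
    and u: "u < n"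
  shows "run elim_start s ''co'' (int u) = (if u = t then 1 else 0) \<and>
    run elim_start s ''r'' (int u) = brow s (m + t) u - brow s i u"
proof -
  let ?I = "\<lambda>k w. \<forall>u<k. w ''co'' (int u) = (if u = t then 1 else 0) \<and> w ''r'' (int u) = brow s (m + t) u - brow s i u"
  have "?I n (run elim_start s)"
    unfolding elim_start_def
  proof (rule For_induct[where I = ?I], goal_cases)
    case (2 k w)
    note k = 2(1,2) and fr = 2(3) and IH = 2(4)
    have w: "w y = s y" if "y \<notin> {''u'', ''co'', ''r''}" for y using fr that by simp
    have "brow w = brow s" using w by (simp add: brow_def fun_eq_iff)
    then have "aval (difference ''t'' ''u'') (store w ''co'' x y) = brow s (m + t) k - brow s i k" for x y
      by (subst difference[where m = m and i = i and u = t and v = k]) (use s w k in simp_all)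
    then show ?case using IH k s w by (simp add: less_Suc_eq)
  qed simp_all
  then show ?thesis using u by blast
qed

lemma combine:
  assumes s: "s ''n'' 0 = int n" "s ''m'' 0 = int m" "s ''i'' 0 = int i" "s ''z'' 0 = int z"
  shows "u < n \<Longrightarrow> run combine s ''co'' (int u) = s ''p'' 0 * s ''co'' (int u)"
    and "u < n \<Longrightarrow> run combine s ''r'' (int u) = s ''p'' 0 * s ''r'' (int u) - s ''e'' 0 * (brow s (m + z) u - brow s i u)"
proof -
  let ?I = "\<lambda>k w. (\<forall>u. w ''co'' (int u) = (if u < k then s ''p'' 0 * s ''co'' (int u) else s ''co'' (int u))) \<and>
    (\<forall>u. w ''r'' (int u) = (if u < k then s ''p'' 0 * s ''r'' (int u) - s ''e'' 0 * (brow s (m + z) u - brow s i u) else s ''r'' (int u)))"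
  have "?I n (run combine s)"
    unfolding combine_def
  proof (rule For_induct[where I = ?I], goal_cases)
    case (2 k w)
    note k = 2(1,2) and fr = 2(3) and IH = 2(4)
    have w: "w y = s y" if "y \<notin> {''u'', ''co'', ''r''}" for y using fr that by simp
    have "brow w = brow s" using w by (simp add: brow_def fun_eq_iff)
    then have "aval (difference ''z'' ''u'') (store w ''co'' x y) = brow s (m + z) k - brow s i k" for x y
      by (subst difference[where m = m and i = i and u = z and v = k]) (use s w k in simp_all)
    then show ?case using IH k s w by (simp add: less_Suc_eq)
  qed simp_all
  then show "u < n \<Longrightarrow> run combine s ''co'' (int u) = s ''p'' 0 * s ''co'' (int u)"
    and "u < n \<Longrightarrow> run combine s ''r'' (int u) = s ''p'' 0 * s ''r'' (int u) - s ''e'' 0 * (brow s (m + z) u - brow s i u)"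
    by simp_all
qed

lemma eliminate:
  assumes s: "s ''n'' 0 = int n" "s ''m'' 0 = int m" "s ''i'' 0 = int i" "s ''z'' 0 = int z" and z: "z < n"
  shows "u < n \<Longrightarrow> run eliminate s ''co'' (int u) =
      (brow s (m + z) z - brow s i z) * s ''co'' (int u) - (if u = z then s ''r'' (int z) else 0)"
    and "u < n \<Longrightarrow> run eliminate s ''r'' (int u) =
      (brow s (m + z) z - brow s i z) * s ''r'' (int u) - s ''r'' (int z) * (brow s (m + z) u - brow s i u)"
proof -
  define s1 where "s1 = store (store s ''p'' 0 (brow s (m + z) z - brow s i z)) ''e'' 0 (s ''r'' (int z))"
  have run: "run eliminate s = run (PAssign ''co'' (var ''z'') (Sub (vec ''co'' ''z'') (var ''e''))) (run combine s1)"
    using difference[of s m i "''z''" z "''z''" z] by (simp add: eliminate_def s1_def s)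
  have s1: "s1 y = s y" if "y \<notin> {''p'', ''e''}" for y using that by (simp add: s1_def)
  have "s1 ''p'' 0 = brow s (m + z) z - brow s i z" "s1 ''e'' 0 = s ''r'' (int z)" "brow s1 = brow s"
    by (simp_all add: s1_def)
  moreover have "s1 ''n'' 0 = int n" "s1 ''m'' 0 = int m" "s1 ''i'' 0 = int i" "s1 ''z'' 0 = int z"
    using s s1 by simp_all
  note combine[of s1 m i z, OF this]
  ultimately show "u < n \<Longrightarrow> run eliminate s ''co'' (int u) =
      (brow s (m + z) z - brow s i z) * s ''co'' (int u) - (if u = z then s ''r'' (int z) else 0)"
    and "u < n \<Longrightarrow> run eliminate s ''r'' (int u) =
      (brow s (m + z) z - brow s i z) * s ''r'' (int u) - s ''r'' (int z) * (brow s (m + z) u - brow s i u)"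
    unfolding run by (simp_all add: sem_unwritten s1 s z)
qed

lemma find_pending:
  assumes s: "s ''n'' 0 = int n" "s ''i'' 0 = int i" "s ''s'' 0 = int a" "s ''t'' 0 = int t"
  shows "(run find_pending s ''z'' 0 < 0 \<and>
      (\<forall>v<n. row s i a < row s i v \<longrightarrow> row s i v < row s i t \<longrightarrow> s ''r'' (int v) = 0)) \<or>
    (\<exists>z<n. run find_pending s ''z'' 0 = int z \<and> row s i a < row s i z \<and> row s i z < row s i t \<and>
      s ''r'' (int z) \<noteq> 0 \<and>
      (\<forall>v<n. row s i a < row s i v \<longrightarrow> row s i v < row s i t \<longrightarrow> s ''r'' (int v) \<noteq> 0 \<longrightarrow> row s i v \<le> row s i z))"
proof -
  let ?E = "\<lambda>v. row s i a < row s i v \<and> row s i v < row s i t \<and> s ''r'' (int v) \<noteq> 0"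
  let ?I = "\<lambda>k w. (w ''z'' 0 < 0 \<and> (\<forall>v<k. \<not> ?E v)) \<or>
    (\<exists>z<k. w ''z'' 0 = int z \<and> ?E z \<and> (\<forall>v<k. ?E v \<longrightarrow> row s i v \<le> row s i z))"
  let ?c = "guarded
      (BAnd (BAnd (Less (cell ''pos'' ''i'' ''s'') (cell ''pos'' ''i'' ''v'')) (Less (cell ''pos'' ''i'' ''v'') (cell ''pos'' ''i'' ''t'')))
        (BAnd (BNot (Equal (vec ''r'' ''v'') (Const 0)))
          (either (Less (var ''z'') (Const 0)) (Less (cell ''pos'' ''i'' ''z'') (cell ''pos'' ''i'' ''v'')))))
      (''z'' ::= var ''v'')"
  have "?I n (run (PFor ''v'' 1 0 ?c) (store s ''z'' 0 (-1)))"
  proof (rule For_induct[where I = ?I], goal_cases)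
    case (2 k w)
    note k = 2(1,2) and fr = 2(3) and IH = 2(4)
    have w: "w y = s y" if "y \<notin> {''v'', ''z''}" for y using fr that by simp
    have body: "store (run ?c w) ''v'' 0 (int (Suc k)) ''z'' 0 =
      (if ?E k \<and> (w ''z'' 0 < 0 \<or> s ''pos'' (int i * int n + w ''z'' 0) < row s i k) then int k else w ''z'' 0)"
      using k s w by (auto simp: row_def)
    show ?case
    proof (cases "?E k")
      case False
      then show ?thesis using IH unfolding body by (auto simp: less_Suc_eq)
    next
      case True
      from IH show ?thesis
      proof (elim disjE exE conjE)
        assume "w ''z'' 0 < 0" "\<forall>v<k. \<not> ?E v"
        then show ?thesis using True unfolding body by (intro disjI2 exI[of _ k]) (auto simp: less_Suc_eq)
      next
        fix z assume z: "z < k" "w ''z'' 0 = int z" "row s i a < row s i z" "row s i z < row s i t" "s ''r'' (int z) \<noteq> 0"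
          "\<forall>v<k. ?E v \<longrightarrow> row s i v \<le> row s i z"
        have r: "s ''pos'' (int i * int n + w ''z'' 0) = row s i z" using z(2) by (simp add: row_def)
        show ?thesis
        proof (cases "row s i z < row s i k")
          case less: True
          have "\<forall>v<Suc k. ?E v \<longrightarrow> row s i v \<le> row s i k"
            using z(6) less by (metis less_Suc_eq order.strict_implies_order order.trans order_refl)
          then show ?thesis using True less unfolding body r by (intro disjI2 exI[of _ k]) simp
        next
          case False
          then have "\<forall>v<Suc k. ?E v \<longrightarrow> row s i v \<le> row s i z"
            using z(6) by (simp add: less_Suc_eq)
          then show ?thesis using False z unfolding body r by (intro disjI2 exI[of _ z]) simp
        qed
      qed
    qed
  qed simp_all
  then show ?thesis by (simp add: find_pending_def) blast
qed

text \<open>\<open>n\<close> rounds are enough: the pending set has at most \<open>n\<close>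
  elements and shrinks in each round that finds one. Once it is empty, the remaining rounds leave
  coefficients and vector as they are.\<close>

lemma elimination:
  assumes s: "s ''n'' 0 = int n" "s ''m'' 0 = int m" "s ''i'' 0 = int i" "s ''s'' 0 = int a" "s ''t'' 0 = int t"
    and p: "inj_on (row s i) {..<n}" "a < n" "t < n" "row s i a < row s i t"
    and ex: "\<And>u v. u < n \<Longrightarrow> v < n \<Longrightarrow> row s i a < row s i u \<Longrightarrow> row s i u \<le> row s i t \<Longrightarrow>
      brow s (m + u) v - brow s i v = exchange (row s i) a u v"
  shows "elim_inv (row s i) a t (\<lambda>u. run elimination s ''co'' (int u)) (\<lambda>v. run elimination s ''r'' (int v))"
    and "pending (row s i) a t (\<lambda>v. run elimination s ''r'' (int v)) = {}"
proof -
  let ?p = "row s i"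
  let ?co = "\<lambda>w u. w ''co'' (int u)" and ?r = "\<lambda>w v. w ''r'' (int v)"
  let ?I = "\<lambda>k w. elim_inv ?p a t (?co w) (?r w) \<and> card (pending ?p a t (?r w)) \<le> n - k"
  let ?s = "run elim_start s"
  have cong: "elim_inv ?p a t w r \<Longrightarrow> (\<And>u. u < n \<Longrightarrow> w' u = w u) \<Longrightarrow> (\<And>u. u < n \<Longrightarrow> r' u = r u) \<Longrightarrow>
      elim_inv ?p a t w' r'" for w r w' r'
    unfolding elim_inv_def
    by (elim conjE, intro conjI) (simp_all cong: sum.cong_simp)
  have init: "elim_inv ?p a t (?co ?s) (?r ?s)"
    using elim_start[of s m i t, OF s(1,2,3,5)] ex p by (intro cong[OF elim_init[OF p]]) simp_all
  have card0: "card (pending ?p a t r) \<le> n" for r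
  proof -
    have "pending ?p a t r \<subseteq> {..<n}" unfolding pending_def by auto
    then show ?thesis by (metis card_lessThan card_mono finite_lessThan)
  qed
  have "?I n (run (PFor ''q'' 1 0 (find_pending ;; guarded (BNot (Less (var ''z'') (Const 0))) eliminate)) ?s)"
  proof (rule For_induct[where I = ?I], goal_cases)
    case 1
    then show ?case using init card0 by simp
  next
    case (2 k w)
    note k = 2(1,2) and fr = 2(3)
    have IH: "elim_inv ?p a t (?co w) (?r w)" "card (pending ?p a t (?r w)) \<le> n - k" using 2(4) by auto
    have w: "w y = s y" if "y \<notin> {''q'', ''z'', ''v'', ''p'', ''e'', ''u'', ''co'', ''r''}" for y
      using fr that by (simp add: sem_unwritten)
    define w1 where "w1 = run find_pending w"
    have w1: "w1 y = w y" if "y \<notin> {''z'', ''v''}" for y using that by (simp add: w1_def sem_unwritten)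
    have rw: "row w = row s" "brow w1 = brow s" using w w1 by (simp_all add: row_def brow_def fun_eq_iff)
    have pre: "w ''n'' 0 = int n" "w ''i'' 0 = int i" "w ''s'' 0 = int a" "w ''t'' 0 = int t"
      using s w by simp_all
    have run: "run (find_pending ;; guarded (BNot (Less (var ''z'') (Const 0))) eliminate) w =
      (if w1 ''z'' 0 < 0 then w1 else run eliminate w1)" by (simp add: w1_def)
    from find_pending[of w i a t, OF pre, folded w1_def, unfolded rw] show ?case
    proof (elim disjE exE conjE)
      assume z: "w1 ''z'' 0 < 0" "\<forall>v<n. ?p a < ?p v \<longrightarrow> ?p v < ?p t \<longrightarrow> ?r w v = 0"
      then have "pending ?p a t (?r w) = {}" unfolding pending_def by auto
      then show ?case using z(1) IH w1 unfolding run by simp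
    next
      fix z assume z: "z < n" "w1 ''z'' 0 = int z" "?p a < ?p z" "?p z < ?p t" "?r w z \<noteq> 0"
        "\<forall>v<n. ?p a < ?p v \<longrightarrow> ?p v < ?p t \<longrightarrow> ?r w v \<noteq> 0 \<longrightarrow> ?p v \<le> ?p z"
      have pre1: "w1 ''n'' 0 = int n" "w1 ''m'' 0 = int m" "w1 ''i'' 0 = int i"
        using s w w1 by simp_all
      have e: "brow s (m + z) v - brow s i v = exchange ?p a z v" if "v < n" for v
        using ex[OF z(1) that] z by simp
      let ?w = "run eliminate w1"
      have 1: "?co ?w u = exchange ?p a z z * ?co w u - (if u = z then ?r w z else 0)" if "u < n" for u
        using eliminate(1)[of w1 m i z, OF pre1 z(2,1) that] e z(1) w1 by (simp add: rw)
      have 2: "?r ?w u = exchange ?p a z z * ?r w u - ?r w z * exchange ?p a z u" if "u < n" for u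
        using eliminate(2)[of w1 m i z, OF pre1 z(2,1) that] e that z(1) w1 by (simp add: rw)
      have max: "?p v \<le> ?p z" if "v < n" "?p a < ?p v" "?p v < ?p t" "?r w v \<noteq> 0" for v
        using z(6) that by blast
      note E = elim_step[OF p IH(1) z(1,3,4,5) max 1 2]
      have "run (find_pending ;; guarded (BNot (Less (var ''z'') (Const 0))) eliminate) w = ?w"
        using z(2) unfolding run by simp
      then have "?co (store (run (find_pending ;; guarded (BNot (Less (var ''z'') (Const 0))) eliminate) w) ''q'' 0 (int (Suc k))) = ?co ?w"
        "?r (store (run (find_pending ;; guarded (BNot (Less (var ''z'') (Const 0))) eliminate) w) ''q'' 0 (int (Suc k))) = ?r ?w"
        by (simp_all only:) simp_all
      moreover have "card (pending ?p a t (?r ?w)) \<le> n - Suc k" using E(2) IH(2) by linarith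
      ultimately show ?case using E(1) by presburger
    qed
  qed simp
  then have "?I n (run elimination s)" by (simp add: elimination_def)
  moreover have "finite (pending ?p a t r)" for r unfolding pending_def by simp
  ultimately show "elim_inv ?p a t (?co (run elimination s)) (?r (run elimination s))"
    and "pending ?p a t (?r (run elimination s)) = {}" by simp_all
qed

end

section \<open>New weights and removal of redundant orders\<close>

definition sum_co :: prog where
  "sum_co = ''W'' ::= Const 0 ;; PFor ''u'' 1 0 (''W'' ::= Add (var ''W'') (vec ''co'' ''u''))"

text \<open>
  The step is the full replacement of order \<open>i\<close> if this keeps \<open>x t \<le> 0\<close>, and otherwise the one that
  makes \<open>x t = 0\<close>; both are scaled to integer weights.
\<close>

definition choose_scale :: prog where
  "choose_scale = PCond (at_most (Mul (vec ''r'' ''t'') (vec ''mu'' ''i'')) (Mul (var ''W'') (Sub (Const 0) (vec ''x'' ''t''))))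
    (''ca'' ::= var ''W'' ;; ''cb'' ::= vec ''mu'' ''i'')
    (''ca'' ::= vec ''r'' ''t'' ;; ''cb'' ::= Sub (Const 0) (vec ''x'' ''t''))"

definition scale_old :: prog where
  "scale_old = PFor ''j'' 2 3 (guarded (Less (var ''j'') (var ''m''))
    (PAssign ''mu'' (var ''j'') (Mul (var ''ca'') (vec ''mu'' ''j''))))"

definition set_new :: prog where
  "set_new = PFor ''u'' 1 0 (PAssign ''mu'' (Add (var ''m'') (var ''u'')) (Mul (var ''cb'') (vec ''co'' ''u'')))"

text \<open>Order \<open>i\<close> gives up the weight \<open>cb * W\<close>, which the new orders
  share in the proportions \<open>co\<close>. The total weight is thus multiplied by
  \<open>ca\<close> alone.\<close>

definition reweigh :: prog where
  "reweigh = sum_co ;; choose_scale ;; scale_old ;;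
    PAssign ''mu'' (var ''i'') (Sub (vec ''mu'' ''i'') (Mul (var ''cb'') (var ''W''))) ;;
    set_new ;; ''m'' ::= Add (var ''m'') (var ''n'')"

definition copy_row :: prog where
  "copy_row = PFor ''v'' 1 0
    (PAssign ''pos'' (index2 (var ''z'') (var ''v'')) (cell ''pos'' ''m'' ''v'') ;;
     PAssign ''b'' (index2 (var ''z'') (var ''v'')) (cell ''b'' ''m'' ''v''))"

definition drop_row :: prog where
  "drop_row = ''m'' ::= Sub (var ''m'') (Const 1) ;; copy_row ;; PAssign ''mu'' (var ''z'') (vec ''mu'' ''m'')"

abbreviation kernel_index :: "aexp \<Rightarrow> aexp \<Rightarrow> aexp" where
  "kernel_index i j \<equiv> Add (Mul i (Add (var ''n'') (Const 2))) j"

definition unit_row :: prog where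
  "unit_row = PFor ''j'' 1 2 (PCond (Equal (var ''u'') (var ''j''))
    (PAssign ''C'' (kernel_index (var ''u'') (var ''j'')) (Const 1))
    (PAssign ''C'' (kernel_index (var ''u'') (var ''j'')) (Const 0)))"

definition kernel_start :: prog where
  "kernel_start = PFor ''u'' 1 2 (PAssign ''us'' (var ''u'') (Const 0) ;; unit_row)"

text \<open>The equations below \<open>n\<close> say that the combination of bases vanishes,
  equation \<open>n\<close> that the coefficients sum to 0. Together they describe affine
  dependencies of n + 2 points in dimension \<open>n\<close>, of which a nontrivial one always
  exists.\<close>

definition dot :: prog where
  "dot = PFor ''j'' 1 2 (PCond (Less (var ''c'') (var ''n''))
    (PAssign ''l'' (var ''u'') (Add (vec ''l'' ''u'')
      (Mul (Read ''C'' (kernel_index (var ''u'') (var ''j''))) (cell ''b'' ''j'' ''c''))))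
    (PAssign ''l'' (var ''u'') (Add (vec ''l'' ''u'') (Read ''C'' (kernel_index (var ''u'') (var ''j''))))))"

definition dots :: prog where
  "dots = PFor ''u'' 1 2 (PAssign ''l'' (var ''u'') (Const 0) ;; dot)"

definition find_pivot :: prog where
  "find_pivot = ''z'' ::= Const (-1) ;;
    PFor ''u'' 1 2 (guarded (BAnd (Equal (vec ''us'' ''u'') (Const 0)) (BNot (Equal (vec ''l'' ''u'') (Const 0))))
      (''z'' ::= var ''u''))"

definition pivot_row :: prog where
  "pivot_row = PFor ''j'' 1 2 (PAssign ''C'' (kernel_index (var ''u'') (var ''j''))
    (Sub (Mul (vec ''l'' ''z'') (Read ''C'' (kernel_index (var ''u'') (var ''j''))))
         (Mul (vec ''l'' ''u'') (Read ''C'' (kernel_index (var ''z'') (var ''j''))))))"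

definition pivot :: prog where
  "pivot = PAssign ''us'' (var ''z'') (Const 1) ;;
    PFor ''u'' 1 2 (guarded (Equal (vec ''us'' ''u'') (Const 0)) pivot_row)"

definition kernel :: prog where
  "kernel = kernel_start ;;
    PFor ''c'' 1 1 (dots ;; find_pivot ;; guarded (BNot (Less (var ''z'') (Const 0))) pivot)"

text \<open>Padding with zeros turns a dependency among the first n + 2 orders into one among all of
  them, so \<open>rescale\<close> can treat all weights alike.\<close>

definition coefficients :: prog where
  "coefficients = PFor ''u'' 1 2 (guarded (Equal (vec ''us'' ''u'') (Const 0)) (''z'' ::= var ''u'')) ;;
    PFor ''j'' 2 3 (PCond (Less (var ''j'') (Add (var ''n'') (Const 2)))
      (PAssign ''cc'' (var ''j'') (Read ''C'' (kernel_index (var ''z'') (var ''j''))))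
      (PAssign ''cc'' (var ''j'') (Const 0)))"

definition min_ratio :: prog where
  "min_ratio = ''z'' ::= Const (-1) ;;
    PFor ''j'' 1 2 (guarded (BAnd (Less (Const 0) (vec ''cc'' ''j''))
        (either (Less (var ''z'') (Const 0))
          (Less (Mul (vec ''mu'' ''j'') (vec ''cc'' ''z'')) (Mul (vec ''mu'' ''z'') (vec ''cc'' ''j'')))))
      (''z'' ::= var ''j''))"

text \<open>\<open>my\<close> has to be saved: the loop sets entry \<open>z\<close> of
  \<open>mu\<close> to 0 on its way.\<close>

definition rescale :: prog where
  "rescale = ''cy'' ::= vec ''cc'' ''z'' ;; ''my'' ::= vec ''mu'' ''z'' ;;
    PFor ''j'' 2 3 (guarded (Less (var ''j'') (var ''m''))
      (PAssign ''mu'' (var ''j'') (Sub (Mul (var ''cy'') (vec ''mu'' ''j'')) (Mul (var ''my'') (vec ''cc'' ''j'')))))"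

definition reduce :: prog where
  "reduce = guarded (Less (Add (var ''n'') (Const 1)) (var ''m''))
    (kernel ;; coefficients ;; min_ratio ;; rescale ;; drop_row)"

lemma written_reduce [simp]:
  "written sum_co = {''W'', ''u''}"
  "written choose_scale = {''ca'', ''cb''}"
  "written scale_old = {''j'', ''mu''}"
  "written set_new = {''u'', ''mu''}"
  "written reweigh = {''W'', ''u'', ''ca'', ''cb'', ''j'', ''mu'', ''m''}"
  "written copy_row = {''v'', ''pos'', ''b''}"
  "written drop_row = {''m'', ''v'', ''pos'', ''b'', ''mu''}"
  "written unit_row = {''j'', ''C''}"
  "written kernel_start = {''u'', ''us'', ''j'', ''C''}"
  "written dot = {''j'', ''l''}"
  "written dots = {''u'', ''j'', ''l''}"
  "written find_pivot = {''z'', ''u''}"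
  "written pivot_row = {''j'', ''C''}"
  "written pivot = {''us'', ''u'', ''j'', ''C''}"
  "written kernel = {''c'', ''z'', ''l'', ''u'', ''us'', ''j'', ''C''}"
  "written coefficients = {''u'', ''z'', ''j'', ''cc''}"
  "written min_ratio = {''z'', ''j''}"
  "written rescale = {''cy'', ''my'', ''j'', ''mu''}"
  "written reduce = {''c'', ''l'', ''u'', ''us'', ''C'', ''z'', ''cc'', ''cy'', ''my'', ''j'', ''m'', ''v'', ''pos'', ''b'', ''mu''}"
  by (auto simp: sum_co_def choose_scale_def scale_old_def set_new_def reweigh_def copy_row_def
      drop_row_def unit_row_def kernel_start_def dot_def dots_def find_pivot_def pivot_row_def
      pivot_def kernel_def coefficients_def min_ratio_def rescale_def reduce_def)

lemma counters_safe_reduce [simp]: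
  "counters_safe reweigh" "counters_safe drop_row" "counters_safe reduce"
proof -
  have "counters_safe sum_co" "counters_safe choose_scale" "counters_safe scale_old" "counters_safe set_new"
    by (simp_all add: sum_co_def choose_scale_def scale_old_def set_new_def)
  then show "counters_safe reweigh" by (simp add: reweigh_def)
  have "counters_safe copy_row" by (simp add: copy_row_def)
  then show *: "counters_safe drop_row" by (simp add: drop_row_def)
  have "counters_safe unit_row" "counters_safe dot" "counters_safe pivot_row" "counters_safe find_pivot"
    "counters_safe coefficients" "counters_safe min_ratio" "counters_safe rescale"
    by (simp_all add: unit_row_def dot_def pivot_row_def find_pivot_def coefficients_def min_ratio_def rescale_def)
  moreover from this have "counters_safe kernel_start" "counters_safe dots" "counters_safe pivot"
    by (simp_all add: kernel_start_def dots_def pivot_def)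
  ultimately show "counters_safe reduce" using * by (simp add: reduce_def kernel_def)
qed

context minimization
begin

lemma sum_co:
  assumes "s ''n'' 0 = int n"
  shows "run sum_co s ''W'' 0 = (\<Sum>u<n. s ''co'' (int u))"
proof -
  let ?I = "\<lambda>k w. w ''W'' 0 = (\<Sum>u<k. s ''co'' (int u))"
  have "?I n (run (PFor ''u'' 1 0 (''W'' ::= Add (var ''W'') (vec ''co'' ''u''))) (store s ''W'' 0 0))"
    by (rule For_induct[where I = ?I]) simp_all
  then show ?thesis by (simp add: sum_co_def)
qed

lemma scale_old:
  assumes s: "s ''n'' 0 = int n" "s ''m'' 0 = int m" and m: "m \<le> 2 * n + 3"
  shows "wt (run scale_old s) j = (if j < m then s ''ca'' 0 * wt s j else wt s j)"
proof -
  let ?I = "\<lambda>k w. \<forall>j. wt w j = (if j < k \<and> j < m then s ''ca'' 0 * wt s j else wt s j)"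
  have "?I (2 * n + 3) (run scale_old s)"
    unfolding scale_old_def
  proof (rule For_induct[where I = ?I], goal_cases)
    case (2 k w)
    note k = 2(1,2) and fr = 2(3) and IH = 2(4)
    have w: "w y = s y" if "y \<notin> {''j'', ''mu''}" for y using fr that by simp
    show ?case using IH k s w by (auto simp: wt_def less_Suc_eq)
  qed (simp_all add: wt_def)
  then show ?thesis using m by simp
qed

lemma set_new:
  assumes s: "s ''n'' 0 = int n" "s ''m'' 0 = int m"
  shows "wt (run set_new s) j = (if m \<le> j \<and> j < m + n then s ''cb'' 0 * s ''co'' (int (j - m)) else wt s j)"
proof -
  let ?I = "\<lambda>k w. \<forall>j. wt w j = (if m \<le> j \<and> j < m + k then s ''cb'' 0 * s ''co'' (int (j - m)) else wt s j)"
  have "?I n (run set_new s)"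
    unfolding set_new_def
  proof (rule For_induct[where I = ?I], goal_cases)
    case (2 k w)
    note k = 2(1,2) and fr = 2(3) and IH = 2(4)
    have w: "w y = s y" if "y \<notin> {''u'', ''mu''}" for y using fr that by simp
    show ?case
    proof
      fix j
      show "wt (store (run (PAssign ''mu'' (Add (var ''m'') (var ''u'')) (Mul (var ''cb'') (vec ''co'' ''u''))) w) ''u'' 0 (int (Suc k))) j =
        (if m \<le> j \<and> j < m + Suc k then s ''cb'' 0 * s ''co'' (int (j - m)) else wt s j)"
        using IH[rule_format, of j] k s w by (cases "j = m + k") (auto simp: wt_def)
    qed
  qed (simp_all add: wt_def)
  then show ?thesis by simp
qed

lemma reweigh:
  assumes s: "s ''n'' 0 = int n" "s ''m'' 0 = int m" "s ''i'' 0 = int i" "s ''t'' 0 = int t"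
    and m: "m \<le> 2 * n + 3" "i < m" and W: "W = (\<Sum>u<n. s ''co'' (int u))"
  shows "run reweigh s ''m'' 0 = int (m + n)"
    and "\<exists>ca cb. (s ''r'' (int t) * wt s i \<le> W * - s ''x'' (int t) \<and> ca = W \<and> cb = wt s i \<or>
        W * - s ''x'' (int t) < s ''r'' (int t) * wt s i \<and> ca = s ''r'' (int t) \<and> cb = - s ''x'' (int t)) \<and>
      (\<forall>j<m. wt (run reweigh s) j = ca * wt s j - (if j = i then cb * W else 0)) \<and>
      (\<forall>u<n. wt (run reweigh s) (m + u) = cb * s ''co'' (int u))"
proof -
  define s1 where "s1 = run choose_scale (run sum_co s)"
  have s1: "s1 y = s y" if "y \<notin> {''W'', ''u'', ''ca'', ''cb''}" for y
    using that by (simp add: s1_def sem_unwritten)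
  have W1: "s1 ''W'' 0 = W" using sum_co[of s] s W by (simp add: s1_def sem_unwritten)
  have c: "s ''r'' (int t) * wt s i \<le> W * - s ''x'' (int t) \<and> s1 ''ca'' 0 = W \<and> s1 ''cb'' 0 = wt s i \<or>
        W * - s ''x'' (int t) < s ''r'' (int t) * wt s i \<and> s1 ''ca'' 0 = s ''r'' (int t) \<and> s1 ''cb'' 0 = - s ''x'' (int t)"
    using sum_co[of s] s W by (auto simp: s1_def choose_scale_def sem_unwritten wt_def not_less)
  define s2 where "s2 = run (PAssign ''mu'' (var ''i'') (Sub (vec ''mu'' ''i'') (Mul (var ''cb'') (var ''W'')))) (run scale_old s1)"
  have s2: "s2 y = s1 y" if "y \<notin> {''j'', ''mu''}" for y
    using that by (simp add: s2_def sem_unwritten)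
  have "wt s1 = wt s" by (simp add: wt_def s1 fun_eq_iff)
  then have wt2: "wt s2 j = s1 ''ca'' 0 * wt s j - (if j = i then s1 ''cb'' 0 * W else 0)" if "j < m" for j
    using scale_old[of s1 m] s m that W1 by (simp add: s2_def s1 wt_def sem_unwritten)
  have run: "run reweigh s = run (''m'' ::= Add (var ''m'') (var ''n'')) (run set_new s2)"
    by (simp add: reweigh_def s1_def s2_def)
  show "run reweigh s ''m'' 0 = int (m + n)"
    using s unfolding run by (simp add: sem_unwritten s2 s1)
  have "wt (run reweigh s) j = wt (run set_new s2) j" for j unfolding run by simp
  then have "(\<forall>j<m. wt (run reweigh s) j = s1 ''ca'' 0 * wt s j - (if j = i then s1 ''cb'' 0 * W else 0)) \<and>
      (\<forall>u<n. wt (run reweigh s) (m + u) = s1 ''cb'' 0 * s ''co'' (int u))"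
    using set_new[of s2 m] s wt2 by (simp add: s2 s1)
  with c show "\<exists>ca cb. (s ''r'' (int t) * wt s i \<le> W * - s ''x'' (int t) \<and> ca = W \<and> cb = wt s i \<or>
        W * - s ''x'' (int t) < s ''r'' (int t) * wt s i \<and> ca = s ''r'' (int t) \<and> cb = - s ''x'' (int t)) \<and>
      (\<forall>j<m. wt (run reweigh s) j = ca * wt s j - (if j = i then cb * W else 0)) \<and>
      (\<forall>u<n. wt (run reweigh s) (m + u) = cb * s ''co'' (int u))" by blast
qed

lemma copy_row:
  assumes s: "s ''n'' 0 = int n" "s ''m'' 0 = int m" "s ''z'' 0 = int z" and z: "z \<le> m" and v: "v < n"
  shows "row (run copy_row s) j v = row s (if j = z then m else j) v \<and>
    brow (run copy_row s) j v = brow s (if j = z then m else j) v"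
proof -
  let ?I = "\<lambda>k w. \<forall>j v. v < n \<longrightarrow> row w j v = row s (if j = z \<and> v < k then m else j) v \<and>
    brow w j v = brow s (if j = z \<and> v < k then m else j) v"
  have "?I n (run copy_row s)"
    unfolding copy_row_def
  proof (rule For_induct[where I = ?I], goal_cases)
    case (2 k w)
    note k = 2(1,2) and fr = 2(3) and IH = 2(4)
    have w: "w y = s y" if "y \<notin> {''v'', ''pos'', ''b''}" for y using fr that by simp
    let ?c = "PAssign ''pos'' (index2 (var ''z'') (var ''v'')) (cell ''pos'' ''m'' ''v'') ;;
     PAssign ''b'' (index2 (var ''z'') (var ''v'')) (cell ''b'' ''m'' ''v'')"
    have "row w m k = row s m k" "brow w m k = brow s m k" using IH k z by auto
    then have c: "run ?c w = store (store w ''pos'' (int z * int n + int k) (row s m k)) ''b'' (int z * int n + int k) (brow s m k)"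
      using k s w by (simp add: row_def brow_def)
    show ?case
    proof (intro allI impI)
      fix j v assume v: "v < n"
      show "row (store (run ?c w) ''v'' 0 (int (Suc k))) j v = row s (if j = z \<and> v < Suc k then m else j) v \<and>
        brow (store (run ?c w) ''v'' 0 (int (Suc k))) j v = brow s (if j = z \<and> v < Suc k then m else j) v"
        using IH[rule_format, OF v, of j] v k unfolding c
        by (cases "j = z \<and> v = k") (auto simp: row_def brow_def less_Suc_eq)
    qed
  qed (simp_all add: row_def brow_def)
  then show ?thesis using v by auto
qed

section \<open>Shrinking a weighted family without changing its combination up to scale\<close>

definition weighted_orders :: "nat \<Rightarrow> state \<Rightarrow> bool" where
  "weighted_orders m s \<longleftrightarrow> s ''m'' 0 = int m \<and> orders m s \<and> (\<forall>j<m. 0 \<le> wt s j)"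

text \<open>\<open>J\<close> contains the old indices that may survive. That one particular order
  has disappeared is expressed by omitting its index from \<open>J\<close>; the progress argument
  needs this for order \<open>i\<close>.\<close>

definition shrinks :: "nat set \<Rightarrow> nat \<Rightarrow> state \<Rightarrow> nat \<Rightarrow> state \<Rightarrow> bool" where
  "shrinks J m s m' s' \<longleftrightarrow> (\<exists>K>0. \<exists>\<pi>. inj_on \<pi> {..<m'} \<and> \<pi> ` {..<m'} \<subseteq> J \<and>
     (\<forall>j<m'. \<forall>v<n. row s' j v = row s (\<pi> j) v) \<and>
     (\<forall>v<n. comb m' (row s') (wt s') v = K * comb m (row s) (wt s) v) \<and>
     (\<Sum>j<m'. wt s' j) = K * (\<Sum>j<m. wt s j))"

lemma shrinks_mono: "shrinks J m s m' s' \<Longrightarrow> J \<subseteq> J' \<Longrightarrow> shrinks J' m s m' s'"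
  unfolding shrinks_def by (meson order_trans)

lemma shrinks_refl: "shrinks {..<m} m s m s"
  unfolding shrinks_def by (intro exI[of _ 1] conjI exI[of _ id]) auto

lemma shrinks_trans:
  assumes "shrinks J m s m1 s1" "shrinks {..<m1} m1 s1 m2 s2"
  shows "shrinks J m s m2 s2"
proof -
  obtain K \<pi> where 1: "0 < K" "inj_on \<pi> {..<m1}" "\<pi> ` {..<m1} \<subseteq> J"
     "\<forall>j<m1. \<forall>v<n. row s1 j v = row s (\<pi> j) v"
     "\<forall>v<n. comb m1 (row s1) (wt s1) v = K * comb m (row s) (wt s) v"
     "(\<Sum>j<m1. wt s1 j) = K * (\<Sum>j<m. wt s j)" using assms(1) unfolding shrinks_def by auto
  obtain L \<rho> where 2: "0 < L" "inj_on \<rho> {..<m2}" "\<rho> ` {..<m2} \<subseteq> {..<m1}"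
     "\<forall>j<m2. \<forall>v<n. row s2 j v = row s1 (\<rho> j) v"
     "\<forall>v<n. comb m2 (row s2) (wt s2) v = L * comb m1 (row s1) (wt s1) v"
     "(\<Sum>j<m2. wt s2 j) = L * (\<Sum>j<m1. wt s1 j)" using assms(2) unfolding shrinks_def by auto
  have "inj_on (\<pi> \<circ> \<rho>) {..<m2}" using 1 2 by (intro comp_inj_on) (auto intro: inj_on_subset)
  moreover have "(\<pi> \<circ> \<rho>) ` {..<m2} \<subseteq> J" using 1(3) 2(3) by force
  moreover have "row s2 j v = row s ((\<pi> \<circ> \<rho>) j) v" if "j < m2" "v < n" for j v
  proof -
    have "\<rho> j < m1" using 2(3) that by blast
    then show ?thesis using 1(4) 2(4) that by simp
  qed
  ultimately show ?thesis
    unfolding shrinks_def using 1 2 by (intro exI[of _ "L * K"] conjI exI[of _ "\<pi> \<circ> \<rho>"]) auto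
qed

lemma drop_row:
  assumes n: "s ''n'' 0 = int n" and w: "weighted_orders m s" and z: "s ''z'' 0 = int z" "z < m" "wt s z = 0"
  shows "weighted_orders (m - 1) (run drop_row s)"
    and "shrinks ({..<m} - {z}) m s (m - 1) (run drop_row s)"
proof -
  let ?\<pi> = "\<lambda>j. if j = z then m - 1 else j"
  let ?s = "run drop_row s"
  have m: "s ''m'' 0 = int m" using w unfolding weighted_orders_def by simp
  have m1: "int m - 1 = int (m - 1)" using z(2) by simp
  define s1 where "s1 = store s ''m'' 0 (int (m - 1))"
  have run: "?s = run (PAssign ''mu'' (var ''z'') (vec ''mu'' ''m'')) (run copy_row s1)"
    by (simp add: drop_row_def s1_def m m1)
  have "row (run copy_row s1) j v = row s1 (?\<pi> j) v \<and> brow (run copy_row s1) j v = brow s1 (?\<pi> j) v" if "v < n" for j v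
    by (rule copy_row[OF _ _ _ _ that]) (use n z in \<open>auto simp: s1_def\<close>)
  then have rb: "row ?s j v = row s (?\<pi> j) v" "brow ?s j v = brow s (?\<pi> j) v" if "v < n" for j v
    using that unfolding run s1_def by simp_all
  have wt: "wt ?s j = wt s (?\<pi> j)" for j
    unfolding run using z by (simp add: s1_def wt_def sem_unwritten)
  have \<pi>: "?\<pi> j < m" "?\<pi> j \<noteq> z" if "j < m - 1" for j using that z by auto
  have "?s ''m'' 0 = int (m - 1)" unfolding run by (simp add: sem_unwritten s1_def)
  moreover have "orders (m - 1) ?s"
    unfolding orders_def
  proof (intro allI impI conjI)
    fix j assume j: "j < m - 1"
    have o: "inj_on (row s (?\<pi> j)) {..<n}" "\<forall>v<n. brow s (?\<pi> j) v = base (row s (?\<pi> j)) v"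
      using w \<pi>(1)[OF j] unfolding weighted_orders_def orders_def by blast+
    show "inj_on (row ?s j) {..<n}" using o(1) rb(1) by (subst inj_on_cong[where g = "row s (?\<pi> j)"]) auto
    fix v assume v: "v < n"
    have "base (row ?s j) v = base (row s (?\<pi> j)) v" using rb(1) v by (intro base_cong) auto
    then show "brow ?s j v = base (row ?s j) v" using o(2) rb(2) v by simp
  qed
  moreover have "\<forall>j<m - 1. 0 \<le> wt ?s j" using w \<pi>(1) unfolding wt weighted_orders_def by blast
  ultimately show "weighted_orders (m - 1) ?s" unfolding weighted_orders_def by blast
  have "comb (m - 1) (row ?s) (wt ?s) v = comb m (row s) (wt s) v" if v: "v < n" for v
  proof -
    have "wt ?s j * base (row ?s j) v = wt s (?\<pi> j) * base (row s (?\<pi> j)) v" for j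
      unfolding wt using rb(1) v by (intro arg_cong2[where f = times] base_cong) auto
    then show ?thesis
      unfolding comb_def using z(3)
      by (subst sum_delete[OF z(2), where F = "\<lambda>j. wt s j * base (row s j) v"]) simp_all
  qed
  moreover have "(\<Sum>j<m - 1. wt ?s j) = (\<Sum>j<m. wt s j)"
    using z(3) by (subst sum_delete[OF z(2), where F = "wt s"]) (simp_all add: wt)
  moreover have "inj_on ?\<pi> {..<m - 1}" by (auto simp: inj_on_def)
  moreover have "?\<pi> ` {..<m - 1} \<subseteq> {..<m} - {z}" using \<pi> by auto
  ultimately show "shrinks ({..<m} - {z}) m s (m - 1) ?s"
    unfolding shrinks_def using rb(1) by (intro exI[of _ 1] conjI exI[of _ ?\<pi>]) simp_all
qed


section \<open>Affine dependencies by fraction-free elimination\<close>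

definition ksize :: nat where
  "ksize = n + 2"

lemma ksize_eq: "1 * n + 2 = ksize"
  by (simp add: ksize_def)

lemma less_ksize: "int j < int n + 2 \<longleftrightarrow> j < ksize"
  unfolding ksize_def by linarith

definition ker :: "state \<Rightarrow> nat \<Rightarrow> nat \<Rightarrow> int" where
  "ker s r j = s ''C'' (int r * (int n + 2) + int j)"

definition equation :: "state \<Rightarrow> nat \<Rightarrow> nat \<Rightarrow> int" where
  "equation s j c = (if c < n then brow s j c else 1)"

lemma ker_store [simp]: "x \<noteq> ''C'' \<Longrightarrow> ker (store s x i v) = ker s"
  by (simp add: ker_def fun_eq_iff)

lemma ker_update:
  "j < ksize \<Longrightarrow> j' < ksize \<Longrightarrow> ker (store s ''C'' (int r * (int n + 2) + int j) v) r' j' =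
    (if r' = r \<and> j' = j then v else ker s r' j')"
  by (simp add: ker_def less_ksize)

lemma unit_row:
  assumes s: "s ''n'' 0 = int n" "s ''u'' 0 = int u" and j: "j < ksize"
  shows "ker (run unit_row s) r j = (if r = u then (if r = j then 1 else 0) else ker s r j)"
proof -
  let ?I = "\<lambda>k w. \<forall>r. \<forall>j<ksize. ker w r j = (if r = u \<and> j < k then (if r = j then 1 else 0) else ker s r j)"
  have "?I (ksize) (run unit_row s)"
    unfolding unit_row_def
  proof (rule For_induct[where I = ?I], goal_cases)
    case (2 k w)
    note k = 2(1,2)[unfolded ksize_eq] and fr = 2(3) and IH = 2(4)
    have w: "w y = s y" if "y \<notin> {''j'', ''C''}" for y using fr that by simp
    have "run (PCond (Equal (var ''u'') (var ''j''))
        (PAssign ''C'' (kernel_index (var ''u'') (var ''j'')) (Const 1))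
        (PAssign ''C'' (kernel_index (var ''u'') (var ''j'')) (Const 0))) w =
      store w ''C'' (int u * (int n + 2) + int k) (if u = k then 1 else 0)"
      using k s w by simp
    then show ?case using IH k by (simp add: ker_update less_Suc_eq)
  qed (simp_all add: ksize_def)
  then show ?thesis using j by simp
qed

lemma kernel_start:
  assumes s: "s ''n'' 0 = int n"
  shows "kernel_inv (ksize) M 0 (\<lambda>r. run kernel_start s ''us'' (int r)) (ker (run kernel_start s))"
proof -
  let ?I = "\<lambda>k w. \<forall>r<k. w ''us'' (int r) = 0 \<and> (\<forall>j<ksize. ker w r j = (if r = j then 1 else 0))"
  have "?I (ksize) (run kernel_start s)"
    unfolding kernel_start_def
  proof (rule For_induct[where I = ?I], goal_cases)
    case (2 k w)
    note k = 2(1,2)[unfolded ksize_eq] and fr = 2(3) and IH = 2(4)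
    have w: "w y = s y" if "y \<notin> {''u'', ''us'', ''j'', ''C''}" for y using fr that by simp
    let ?w = "store w ''us'' (int k) 0"
    have "ker (run unit_row ?w) r j = (if r = k then (if r = j then 1 else 0) else ker w r j)" if "j < ksize" for r j
      using unit_row[of ?w k j r] s w k that by simp
    moreover have "run unit_row ?w ''us'' = ?w ''us''" by (rule sem_unwritten) simp
    ultimately show ?case using IH k by (auto simp: less_Suc_eq)
  qed (simp_all add: ksize_def)
  moreover from this have "{r. r < ksize \<and> run kernel_start s ''us'' (int r) \<noteq> 0} = {}" by auto
  ultimately show ?thesis unfolding kernel_inv_def by simp
qed

lemma dot:
  assumes s: "s ''n'' 0 = int n" "s ''u'' 0 = int u" "s ''c'' 0 = int c"
  shows "run dot s ''l'' = (s ''l'')(int u := s ''l'' (int u) + (\<Sum>j<ksize. ker s u j * equation s j c))"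
proof -
  let ?I = "\<lambda>k w. w ''l'' = (s ''l'')(int u := s ''l'' (int u) + (\<Sum>j<k. ker s u j * equation s j c))"
  show ?thesis
    unfolding dot_def
  proof (rule For_induct[where I = ?I], goal_cases)
    case (2 k w)
    note k = 2(1,2)[unfolded ksize_eq] and fr = 2(3) and IH = 2(4)
    have w: "w y = s y" if "y \<notin> {''j'', ''l''}" for y using fr that by simp
    show ?case
      using IH k s w by (simp add: ker_def equation_def brow_def fun_eq_iff)
  qed (simp_all add: ksize_def)
qed

lemma dots:
  assumes s: "s ''n'' 0 = int n" "s ''c'' 0 = int c" and r: "r < ksize"
  shows "run dots s ''l'' (int r) = (\<Sum>j<ksize. ker s r j * equation s j c)"
proof -
  let ?I = "\<lambda>k w. \<forall>r<k. w ''l'' (int r) = (\<Sum>j<ksize. ker s r j * equation s j c)"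
  have "?I (ksize) (run dots s)"
    unfolding dots_def
  proof (rule For_induct[where I = ?I], goal_cases)
    case (2 k w)
    note k = 2(1,2)[unfolded ksize_eq] and fr = 2(3) and IH = 2(4)
    have w: "w y = s y" if "y \<notin> {''u'', ''j'', ''l''}" for y using fr that by simp
    let ?w = "store w ''l'' (int k) 0"
    have "ker ?w = ker s" "equation ?w = equation s" using w by (simp_all add: ker_def equation_def brow_def fun_eq_iff)
    then have "run dot ?w ''l'' = (?w ''l'')(int k := ?w ''l'' (int k) + (\<Sum>j<ksize. ker s k j * equation s j c))"
      using dot[of ?w k c] s w k by simp
    then show ?case using IH k by (auto simp: less_Suc_eq)
  qed (simp_all add: ksize_def)
  then show ?thesis using r by blast
qed

lemma find_pivot:
  assumes s: "s ''n'' 0 = int n"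
  shows "(run find_pivot s ''z'' 0 < 0 \<and> (\<forall>r<ksize. s ''us'' (int r) = 0 \<longrightarrow> s ''l'' (int r) = 0)) \<or>
    (\<exists>q<ksize. run find_pivot s ''z'' 0 = int q \<and> s ''us'' (int q) = 0 \<and> s ''l'' (int q) \<noteq> 0)"
proof -
  let ?I = "\<lambda>k w. (w ''z'' 0 < 0 \<and> (\<forall>r<k. s ''us'' (int r) = 0 \<longrightarrow> s ''l'' (int r) = 0)) \<or>
    (\<exists>q<k. w ''z'' 0 = int q \<and> s ''us'' (int q) = 0 \<and> s ''l'' (int q) \<noteq> 0)"
  let ?c = "guarded (BAnd (Equal (vec ''us'' ''u'') (Const 0)) (BNot (Equal (vec ''l'' ''u'') (Const 0))))
      (''z'' ::= var ''u'')"
  have "?I (ksize) (run (PFor ''u'' 1 2 ?c) (store s ''z'' 0 (-1)))"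
  proof (rule For_induct[where I = ?I], goal_cases)
    case (2 k w)
    note k = 2(1,2)[unfolded ksize_eq] and fr = 2(3) and IH = 2(4)
    have w: "w y = s y" if "y \<notin> {''u'', ''z''}" for y using fr that by simp
    have "store (run ?c w) ''u'' 0 (int (Suc k)) ''z'' 0 =
        (if s ''us'' (int k) = 0 \<and> s ''l'' (int k) \<noteq> 0 then int k else w ''z'' 0)"
      using k w by simp
    then show ?case using IH by (auto simp: less_Suc_eq)
  qed (simp_all add: ksize_def)
  then show ?thesis unfolding find_pivot_def by simp
qed

lemma pivot_row:
  assumes s: "s ''n'' 0 = int n" "s ''u'' 0 = int u" "s ''z'' 0 = int z" "u \<noteq> z" and j: "j < ksize"
  shows "ker (run pivot_row s) r j =
    (if r = u then s ''l'' (int z) * ker s u j - s ''l'' (int u) * ker s z j else ker s r j)"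
proof -
  let ?I = "\<lambda>k w. \<forall>r. \<forall>j<ksize. ker w r j =
    (if r = u \<and> j < k then s ''l'' (int z) * ker s u j - s ''l'' (int u) * ker s z j else ker s r j)"
  have "?I (ksize) (run pivot_row s)"
    unfolding pivot_row_def
  proof (rule For_induct[where I = ?I], goal_cases)
    case (2 k w)
    note k = 2(1,2)[unfolded ksize_eq] and fr = 2(3) and IH = 2(4)
    have w: "w y = s y" if "y \<notin> {''j'', ''C''}" for y using fr that by simp
    have "ker w u k = ker s u k" "ker w z k = ker s z k" using IH k s(4) by simp_all
    then have "run (PAssign ''C'' (kernel_index (var ''u'') (var ''j''))
        (Sub (Mul (vec ''l'' ''z'') (Read ''C'' (kernel_index (var ''u'') (var ''j''))))
         (Mul (vec ''l'' ''u'') (Read ''C'' (kernel_index (var ''z'') (var ''j'')))))) w =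
      store w ''C'' (int u * (int n + 2) + int k) (s ''l'' (int z) * ker s u k - s ''l'' (int u) * ker s z k)"
      using k s w by (simp add: ker_def)
    then show ?case using IH k by (simp add: ker_update less_Suc_eq)
  qed (simp_all add: ksize_def)
  then show ?thesis using j by simp
qed

lemma pivot:
  assumes s: "s ''n'' 0 = int n" "s ''z'' 0 = int z" and r: "r < ksize" and z: "z < ksize"
  shows "run pivot s ''us'' (int r) = (if r = z then 1 else s ''us'' (int r))"
    and "j < ksize \<Longrightarrow> ker (run pivot s) r j =
      (if run pivot s ''us'' (int r) = 0 then s ''l'' (int z) * ker s r j - s ''l'' (int r) * ker s z j else ker s r j)"
proof -
  define s1 where "s1 = store s ''us'' (int z) 1"
  let ?c = "guarded (Equal (vec ''us'' ''u'') (Const 0)) pivot_row"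
  have run: "run pivot s = run (PFor ''u'' 1 2 ?c) s1" using s by (simp add: pivot_def s1_def)
  have us: "run pivot s ''us'' = s1 ''us''" unfolding run by (rule sem_unwritten) simp
  show "run pivot s ''us'' (int r) = (if r = z then 1 else s ''us'' (int r))"
    unfolding us by (simp add: s1_def)
  let ?K = "\<lambda>r j. s ''l'' (int z) * ker s r j - s ''l'' (int r) * ker s z j"
  let ?I = "\<lambda>k w. \<forall>r. \<forall>j<ksize. ker w r j = (if r < k \<and> s1 ''us'' (int r) = 0 then ?K r j else ker s r j)"
  have "?I (ksize) (run (PFor ''u'' 1 2 ?c) s1)"
  proof (rule For_induct[where I = ?I], goal_cases)
    case 1
    then show ?case by (simp add: s1_def)
  next
    case (2 k w)
    note k = 2(1,2)[unfolded ksize_eq] and fr = 2(3) and IH = 2(4)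
    have w: "w y = s1 y" if "y \<notin> {''u'', ''j'', ''C''}" for y using fr that by simp
    have w': "w y = s y" if "y \<notin> {''us'', ''u'', ''j'', ''C''}" for y using w that by (simp add: s1_def)
    show ?case
    proof (cases "s1 ''us'' (int k) = 0")
      case True
      then have kz: "k \<noteq> z" by (auto simp: s1_def)
      have "ker (run pivot_row w) r j = (if r = k then ?K k j else ker w r j)" if "j < ksize" for r j
        using pivot_row[of w k z j r] s w' k kz that IH by (simp add: s1_def)
      then show ?thesis using True k w IH by (simp add: less_Suc_eq)
    next
      case False
      then show ?thesis using k w IH by (auto simp: less_Suc_eq)
    qed
  qed (simp add: ksize_def)
  then show "j < ksize \<Longrightarrow> ker (run pivot s) r j =
      (if run pivot s ''us'' (int r) = 0 then s ''l'' (int z) * ker s r j - s ''l'' (int r) * ker s z j else ker s r j)"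
    unfolding us unfolding run using r by simp
qed

lemma kernel:
  assumes s: "s ''n'' 0 = int n"
  shows "kernel_inv (ksize) (equation s) (n + 1) (\<lambda>r. run kernel s ''us'' (int r)) (ker (run kernel s))"
proof -
  let ?I = "\<lambda>k w. kernel_inv (ksize) (equation s) k (\<lambda>r. w ''us'' (int r)) (ker w)"
  let ?c = "dots ;; find_pivot ;; guarded (BNot (Less (var ''z'') (Const 0))) pivot"
  have "?I (n + 1) (run (PFor ''c'' 1 1 ?c) (run kernel_start s))"
  proof (rule For_induct[where I = ?I], goal_cases)
    case 1
    then show ?case using kernel_start[of s] s by simp
  next
    case (2 k w)
    note k = 2(1,2) and fr = 2(3) and IH = 2(4)
    have w: "w y = s y" if "y \<notin> {''c'', ''z'', ''l'', ''u'', ''us'', ''j'', ''C''}" for y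
      using fr that by (simp add: sem_unwritten)
    have eq: "equation w = equation s" using w by (simp add: equation_def brow_def fun_eq_iff)
    define w1 where "w1 = run dots w"
    have n: "w ''n'' 0 = int n" using s w by simp
    have l: "w1 ''l'' (int r) = (\<Sum>j<ksize. ker w r j * equation s j k)" if "r < ksize" for r
      using dots[of w k r, OF n k(2) that] by (simp add: w1_def eq)
    define w2 where "w2 = run find_pivot w1"
    have w1: "w1 y = w y" if "y \<notin> {''u'', ''j'', ''l''}" for y using that by (simp add: w1_def sem_unwritten)
    have w2: "w2 y = w1 y" if "y \<notin> {''z'', ''u''}" for y using that by (simp add: w2_def sem_unwritten)
    have ker: "ker w2 = ker w" by (simp add: ker_def w1 w2 fun_eq_iff)
    have run: "run ?c w = (if w2 ''z'' 0 < 0 then w2 else run pivot w2)" by (simp add: w2_def w1_def)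
    have n1: "w1 ''n'' 0 = int n" using n w1 by simp
    have res: "kernel_inv (ksize) (equation s) (Suc k) (\<lambda>r. run ?c w ''us'' (int r)) (ker (run ?c w))"
      using find_pivot[of w1, OF n1, folded w2_def]
    proof (elim disjE exE conjE)
      assume z: "w2 ''z'' 0 < 0" "\<forall>r<ksize. w1 ''us'' (int r) = 0 \<longrightarrow> w1 ''l'' (int r) = 0"
      have "kernel_inv (ksize) (equation s) (Suc k) (\<lambda>r. w ''us'' (int r)) (ker w)"
        using z(2) l w1 by (intro kernel_skip[OF IH]) auto
      then show ?thesis using z(1) unfolding run by (simp add: ker w2 w1)
    next
      fix q assume q: "q < ksize" "w2 ''z'' 0 = int q" "w1 ''us'' (int q) = 0" "w1 ''l'' (int q) \<noteq> 0"
      have n2: "w2 ''n'' 0 = int n" using n1 w2 by simp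
      have "run ?c w = run pivot w2" using q(2) unfolding run by simp
      moreover have "kernel_inv (ksize) (equation s) (Suc k) (\<lambda>r. run pivot w2 ''us'' (int r)) (ker (run pivot w2))"
      proof (rule kernel_pivot[OF IH, where l = "\<lambda>r. w1 ''l'' (int r)" and q = q])
        show "w1 ''l'' (int r) = (\<Sum>j<ksize. ker w r j * equation s j k)" if "r < ksize" for r
          using l that .
        show "w ''us'' (int q) = 0" using q(3) w1 by simp
        show "run pivot w2 ''us'' (int r) = (if r = q then 1 else w ''us'' (int r))" if "r < ksize" for r
          using pivot(1)[of w2 q r, OF n2 q(2) that q(1)] by (simp add: w1 w2)
        show "ker (run pivot w2) r j = (if run pivot w2 ''us'' (int r) = 0
            then w1 ''l'' (int q) * ker w r j - w1 ''l'' (int r) * ker w q j else ker w r j)"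
          if "r < ksize" "j < ksize" for r j
          using pivot(2)[of w2 q r j, OF n2 q(2) that(1) q(1) that(2)] by (simp add: w2 ker)
      qed (use q in simp_all)
      ultimately show ?thesis by simp
    qed
    then show ?case by simp
  qed simp
  then show ?thesis by (simp add: kernel_def)
qed

lemma coefficients:
  assumes s: "s ''n'' 0 = int n" and ex: "\<exists>r<ksize. s ''us'' (int r) = 0"
  shows "\<exists>r<ksize. s ''us'' (int r) = 0 \<and>
    (\<forall>j<2 * n + 3. run coefficients s ''cc'' (int j) = (if j < ksize then ker s r j else 0))"
proof -
  let ?I = "\<lambda>k w. (\<exists>r<k. s ''us'' (int r) = 0) \<longrightarrow> (\<exists>r<ksize. w ''z'' 0 = int r \<and> s ''us'' (int r) = 0)"
  let ?c = "guarded (Equal (vec ''us'' ''u'') (Const 0)) (''z'' ::= var ''u'')"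
  define s1 where "s1 = run (PFor ''u'' 1 2 ?c) s"
  have s1: "s1 y = s y" if "y \<notin> {''z'', ''u''}" for y
    unfolding s1_def by (rule sem_unwritten) (use that in simp)
  have "?I (ksize) s1"
    unfolding s1_def
  proof (rule For_induct[where I = ?I], goal_cases)
    case (2 k w)
    note k = 2(1,2)[unfolded ksize_eq] and fr = 2(3) and IH = 2(4)
    have w: "w y = s y" if "y \<notin> {''u'', ''z''}" for y using fr that by simp
    show ?case using IH k w by (auto simp: less_Suc_eq)
  qed (simp_all add: ksize_def)
  then obtain r where r: "r < ksize" "s1 ''z'' 0 = int r" "s ''us'' (int r) = 0" using ex by blast
  let ?d = "PCond (Less (var ''j'') (Add (var ''n'') (Const 2)))
      (PAssign ''cc'' (var ''j'') (Read ''C'' (kernel_index (var ''z'') (var ''j''))))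
      (PAssign ''cc'' (var ''j'') (Const 0))"
  let ?J = "\<lambda>k w. \<forall>j<k. w ''cc'' (int j) = (if j < ksize then ker s r j else 0)"
  have "?J (2 * n + 3) (run (PFor ''j'' 2 3 ?d) s1)"
  proof (rule For_induct[where I = ?J], goal_cases)
    case (2 k w)
    note k = 2(1,2) and fr = 2(3) and IH = 2(4)
    have w: "w y = s1 y" if "y \<notin> {''j'', ''cc''}" for y using fr that by simp
    show ?case using IH k s r w s1 by (simp add: ker_def less_Suc_eq less_ksize)
  qed simp_all
  then show ?thesis using r by (auto simp: coefficients_def s1_def)
qed

lemma min_ratio:
  assumes s: "s ''n'' 0 = int n" and ex: "\<exists>j<ksize. 0 < s ''cc'' (int j)"
  shows "\<exists>z<ksize. run min_ratio s ''z'' 0 = int z \<and> 0 < s ''cc'' (int z) \<and>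
    (\<forall>j<ksize. 0 < s ''cc'' (int j) \<longrightarrow> wt s z * s ''cc'' (int j) \<le> wt s j * s ''cc'' (int z))"
proof -
  let ?cc = "\<lambda>j. s ''cc'' (int j)"
  let ?P = "\<lambda>k z. 0 < ?cc z \<and> (\<forall>j<k. 0 < ?cc j \<longrightarrow> wt s z * ?cc j \<le> wt s j * ?cc z)"
  let ?I = "\<lambda>k w. (w ''z'' 0 < 0 \<and> (\<forall>j<k. \<not> 0 < ?cc j)) \<or> (\<exists>z<k. w ''z'' 0 = int z \<and> ?P k z)"
  let ?c = "guarded (BAnd (Less (Const 0) (vec ''cc'' ''j''))
        (either (Less (var ''z'') (Const 0))
          (Less (Mul (vec ''mu'' ''j'') (vec ''cc'' ''z'')) (Mul (vec ''mu'' ''z'') (vec ''cc'' ''j'')))))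
      (''z'' ::= var ''j'')"
  have "?I (ksize) (run (PFor ''j'' 1 2 ?c) (store s ''z'' 0 (-1)))"
  proof (rule For_induct[where I = ?I], goal_cases)
    case (2 k w)
    note k = 2(1,2)[unfolded ksize_eq] and fr = 2(3) and IH = 2(4)
    have w: "w y = s y" if "y \<notin> {''j'', ''z''}" for y using fr that by simp
    have body: "store (run ?c w) ''j'' 0 (int (Suc k)) ''z'' 0 =
        (if 0 < ?cc k \<and> (w ''z'' 0 < 0 \<or> s ''mu'' (int k) * s ''cc'' (w ''z'' 0) < s ''mu'' (w ''z'' 0) * s ''cc'' (int k))
         then int k else w ''z'' 0)"
      using k w by auto
    show ?case
    proof (cases "0 < ?cc k")
      case False
      then show ?thesis using IH unfolding body by (auto simp: less_Suc_eq)
    next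
      case True
      from IH show ?thesis
      proof (elim disjE exE conjE)
        assume "w ''z'' 0 < 0" "\<forall>j<k. \<not> 0 < ?cc j"
        then show ?thesis using True unfolding body by (intro disjI2 exI[of _ k]) (auto simp: less_Suc_eq)
      next
        fix z assume z: "z < k" "w ''z'' 0 = int z" "0 < ?cc z" "\<forall>j<k. 0 < ?cc j \<longrightarrow> wt s z * ?cc j \<le> wt s j * ?cc z"
        show ?thesis
        proof (cases "wt s k * ?cc z < wt s z * ?cc k")
          case less: True
          have "wt s k * ?cc j \<le> wt s j * ?cc k" if j: "j < k" "0 < ?cc j" for j
          proof -
            have "(wt s k * ?cc z) * ?cc j \<le> (wt s z * ?cc k) * ?cc j"
              using less j by (intro mult_right_mono) auto
            also have "\<dots> = (wt s z * ?cc j) * ?cc k" by (simp add: mult_ac)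
            also have "\<dots> \<le> (wt s j * ?cc z) * ?cc k" using z(4) j True by (intro mult_right_mono) auto
            finally have "(wt s k * ?cc j) * ?cc z \<le> (wt s j * ?cc k) * ?cc z" by (simp add: mult_ac)
            then show ?thesis using z(3) by simp
          qed
          then have "?P (Suc k) k" using True by (auto simp: less_Suc_eq)
          then show ?thesis using True less z(2) unfolding body
            by (intro disjI2 exI[of _ k]) (simp add: wt_def)
        next
          case False
          then have "?P (Suc k) z" using z by (auto simp: less_Suc_eq)
          then show ?thesis using False z(1,2) unfolding body
            by (intro disjI2 exI[of _ z]) (simp add: wt_def)
        qed
      qed
    qed
  qed (simp_all add: ksize_def)
  then show ?thesis using ex unfolding min_ratio_def by auto
qed

lemma rescale:
  assumes s: "s ''n'' 0 = int n" "s ''m'' 0 = int m" "s ''z'' 0 = int z" and m: "m \<le> 2 * n + 3" and j: "j < m"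
  shows "wt (run rescale s) j = s ''cc'' (int z) * wt s j - wt s z * s ''cc'' (int j)"
proof -
  let ?I = "\<lambda>k w. \<forall>j. wt w j = (if j < k \<and> j < m then s ''cc'' (int z) * wt s j - wt s z * s ''cc'' (int j) else wt s j)"
  let ?s = "store (store s ''cy'' 0 (s ''cc'' (int z))) ''my'' 0 (wt s z)"
  let ?c = "guarded (Less (var ''j'') (var ''m''))
      (PAssign ''mu'' (var ''j'') (Sub (Mul (var ''cy'') (vec ''mu'' ''j'')) (Mul (var ''my'') (vec ''cc'' ''j''))))"
  have "?I (2 * n + 3) (run (PFor ''j'' 2 3 ?c) ?s)"
  proof (rule For_induct[where I = ?I], goal_cases)
    case (2 k w)
    note k = 2(1,2) and fr = 2(3) and IH = 2(4)
    have w: "w y = ?s y" if "y \<notin> {''j'', ''mu''}" for y using fr that by simp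
    show ?case using IH k s w by (auto simp: wt_def less_Suc_eq)
  qed simp_all
  then show ?thesis using s m j by (simp add: rescale_def wt_def)
qed

text \<open>The Caratheodory step: with at least n + 2 orders there is an affine dependency of their
  bases, and moving along it up to the minimal ratio makes one weight 0 while combination and total
  weight keep their proportions. The order of weight 0 is then dropped.\<close>

lemma reduce_shrinks:
  assumes n: "s ''n'' 0 = int n" and w: "weighted_orders m s" and m: "n + 1 < m" "m \<le> 2 * n + 3"
  shows "weighted_orders (m - 1) (run reduce s)" and "shrinks {..<m} m s (m - 1) (run reduce s)"
proof -
  have sm: "s ''m'' 0 = int m" using w unfolding weighted_orders_def by simp
  define s1 where "s1 = run kernel s"
  have s1: "s1 y = s y" if "y \<notin> {''c'', ''z'', ''l'', ''u'', ''us'', ''j'', ''C''}" for y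
    using that by (simp add: s1_def sem_unwritten)
  have K: "kernel_inv (ksize) (equation s) (n + 1) (\<lambda>r. s1 ''us'' (int r)) (ker s1)"
    unfolding s1_def using kernel[of s] n by simp
  define s2 where "s2 = run coefficients s1"
  have s2: "s2 y = s1 y" if "y \<notin> {''u'', ''z'', ''j'', ''cc''}" for y
    using that by (simp add: s2_def sem_unwritten)
  have "s1 ''n'' 0 = int n" using n s1 by simp
  moreover have "\<exists>r<ksize. s1 ''us'' (int r) = 0"
    using kernel_unused[OF K] by (simp add: ksize_def)
  ultimately obtain r where r: "r < ksize" "s1 ''us'' (int r) = 0"
    and cc: "\<And>j. j < 2 * n + 3 \<Longrightarrow> s2 ''cc'' (int j) = (if j < ksize then ker s1 r j else 0)"
    using coefficients[of s1] unfolding s2_def by blast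
  let ?cc = "\<lambda>j. s2 ''cc'' (int j)"
  have dep: "(\<Sum>j<m. ?cc j * equation s j c) = 0" if "c < n + 1" for c
  proof -
    have "(\<Sum>j<m. ?cc j * equation s j c) = (\<Sum>j<ksize. ?cc j * equation s j c)"
      by (rule sum.mono_neutral_right) (use m cc in \<open>auto simp: ksize_def\<close>)
    also have "\<dots> = (\<Sum>j<ksize. ker s1 r j * equation s j c)"
      by (rule sum.cong) (use cc in \<open>auto simp: ksize_def\<close>)
    also have "\<dots> = 0" using K r that unfolding kernel_inv_def by blast
    finally show ?thesis .
  qed
  have total: "(\<Sum>j<m. ?cc j) = 0" using dep[of n] by (simp add: equation_def)
  \<comment> \<open>The coefficients sum to 0 and the one at the free row \<open>r\<close> is a
    nonzero diagonal entry, so they cannot all be at most 0.\<close>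
  have "\<exists>j<ksize. 0 < ?cc j"
  proof (rule ccontr)
    assume *: "\<not> (\<exists>j<ksize. 0 < ?cc j)"
    have "?cc j \<le> 0" if "j < m" for j
    proof (cases "j < ksize")
      case True
      then show ?thesis using * linorder_not_less by blast
    next
      case False
      then show ?thesis using cc[of j] m that by simp
    qed
    then have "(\<Sum>j<m. - ?cc j) = 0 \<longleftrightarrow> (\<forall>j\<in>{..<m}. - ?cc j = 0)"
      by (intro sum_nonneg_eq_0_iff) auto
    then have "\<forall>j\<in>{..<m}. - ?cc j = 0" using total by (simp add: sum_negf)
    then have "?cc r = 0" using r m by (simp add: ksize_def)
    moreover have "?cc r \<noteq> 0" using cc[of r] r K unfolding kernel_inv_def by (simp add: ksize_def)
    ultimately show False by simp
  qed
  moreover have "s2 ''n'' 0 = int n" using n s1 s2 by simp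
  ultimately obtain z where z: "z < ksize" "run min_ratio s2 ''z'' 0 = int z" "0 < ?cc z"
    "\<And>j. j < ksize \<Longrightarrow> 0 < ?cc j \<Longrightarrow> wt s2 z * ?cc j \<le> wt s2 j * ?cc z"
    using min_ratio[of s2] by blast
  define s3 where "s3 = run min_ratio s2"
  have s3: "s3 y = s2 y" if "y \<notin> {''z'', ''j''}" for y using that by (simp add: s3_def sem_unwritten)
  define s4 where "s4 = run rescale s3"
  have s4: "s4 y = s3 y" if "y \<notin> {''cy'', ''my'', ''j'', ''mu''}" for y using that by (simp add: s4_def sem_unwritten)
  have wts: "wt s2 = wt s" "wt s3 = wt s" by (simp_all add: wt_def s1 s2 s3 fun_eq_iff)
  have rows: "row s4 = row s" "brow s4 = brow s" by (simp_all add: row_def brow_def s1 s2 s3 s4 fun_eq_iff)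
  have wt4: "wt s4 j = ?cc z * wt s j - wt s z * ?cc j" if "j < m" for j
    using rescale[of s3 m z j] n sm z(2) m(2) that by (simp add: s4_def[symmetric] wts s1 s2 s3 flip: s3_def)
  have min: "wt s z * ?cc j \<le> wt s j * ?cc z" if "j < m" "0 < ?cc j" for j
    using z(4)[of j] cc[of j] that m wts by (cases "j < ksize") auto
  have pos: "0 \<le> wt s j" if "j < m" for j using w that unfolding weighted_orders_def by blast
  have zm: "z < m" using z(1) m by (simp add: ksize_def)
  have ratio1: "0 \<le> ?cc z * wt s j - wt s z * ?cc j" if "j < m" for j
    by (rule ratio_step(1)[of m "wt s" z ?cc]) (use pos zm z(3) min that in auto)
  have ratio2: "(\<Sum>j<m. (?cc z * wt s j - wt s z * ?cc j) * h j) = ?cc z * (\<Sum>j<m. wt s j * h j)"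
    if "(\<Sum>j<m. ?cc j * h j) = 0" for h
    by (rule ratio_step(2)[of m "wt s" z ?cc]) (use pos zm z(3) min that in auto)
  have w4: "weighted_orders m s4"
    using w ratio1 wt4 unfolding weighted_orders_def orders_def by (simp add: rows s1 s2 s3 s4)
  have "shrinks {..<m} m s m s4"
    unfolding shrinks_def
  proof (intro exI[of _ "?cc z"] conjI exI[of _ id])
    show "\<forall>v<n. comb m (row s4) (wt s4) v = ?cc z * comb m (row s) (wt s) v"
    proof (intro allI impI)
      fix v assume v: "v < n"
      have "(\<Sum>j<m. ?cc j * base (row s j) v) = (\<Sum>j<m. ?cc j * equation s j v)"
        using w v unfolding weighted_orders_def orders_def by (intro sum.cong) (auto simp: equation_def)
      then have "(\<Sum>j<m. ?cc j * base (row s j) v) = 0" using dep[of v] v by simp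
      from ratio2[OF this] show "comb m (row s4) (wt s4) v = ?cc z * comb m (row s) (wt s) v"
        unfolding comb_def rows by (simp add: wt4)
    qed
    show "(\<Sum>j<m. wt s4 j) = ?cc z * (\<Sum>j<m. wt s j)"
      using ratio2[of "\<lambda>_. 1"] total by (simp add: wt4)
  qed (use z in \<open>auto simp: rows\<close>)
  moreover have "wt s4 z = 0" using wt4[OF zm] by simp
  moreover have "s4 ''n'' 0 = int n" "s4 ''z'' 0 = int z" using n z(2) s1 s2 s3 s4 by (simp_all add: s3_def)
  moreover have run: "run reduce s = run drop_row s4"
    using n sm m by (simp add: reduce_def s1_def s2_def s3_def s4_def)
  ultimately have D: "weighted_orders (m - 1) (run reduce s)" "shrinks ({..<m} - {z}) m s4 (m - 1) (run reduce s)"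
    "shrinks {..<m} m s m s4"
    using drop_row[of s4 m z] w4 zm by simp_all
  then show "weighted_orders (m - 1) (run reduce s)" by blast
  show "shrinks {..<m} m s (m - 1) (run reduce s)"
    using shrinks_trans[OF D(3) shrinks_mono[OF D(2)]] by blast
qed

end

section \<open>One iteration\<close>

text \<open>Order \<open>i\<close> is dropped explicitly when its weight is 0, because a reduction
  picks its own victim and does not guarantee that \<open>i\<close> leaves. Starting from at most 2n
  + 1 orders, \<open>n\<close> reductions lead to at most n + 1.\<close>

definition clean_up :: prog where
  "clean_up = guarded (Equal (vec ''mu'' ''i'') (Const 0)) (''z'' ::= var ''i'' ;; drop_row) ;;
    PFor ''y'' 1 0 reduce"

definition push :: prog where
  "push = select_i ;; append_moves ;; elimination ;; reweigh ;; clean_up"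

definition iterate :: prog where
  "iterate = compute_x ;; select_t ;; guarded (BNot (Less (var ''t'') (Const 0)))
    (select_s ;; PCond (Less (var ''s'') (Const 0))
      (PAssign ''d'' (var ''t'') (Add (vec ''d'' ''t'') (Const 1))) push)"

lemma written_push [simp]:
  "written clean_up = {''z'', ''y''} \<union> written drop_row \<union> written reduce"
  "written push = written select_i \<union> written append_moves \<union> written elimination \<union> written reweigh \<union>
    ({''z'', ''y''} \<union> written drop_row \<union> written reduce)"
  "written iterate = insert ''d'' (written compute_x \<union> written select_t \<union> written select_s \<union> written push)"
  by (auto simp: clean_up_def push_def iterate_def)

lemma counters_safe_iterate [simp]: "counters_safe push" "counters_safe iterate"
  by (simp_all add: iterate_def push_def clean_up_def)

lemma sum_lessThan_add: "(\<Sum>j<m + n. F j) = (\<Sum>j<m. F j) + (\<Sum>u<n. F (m + u))"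
  for F :: "nat \<Rightarrow> int"
  by (induction n) (simp_all add: add.assoc)

context minimization
begin

lemma weighted_orders_store [simp]:
  "x \<notin> {''m'', ''pos'', ''b'', ''mu''} \<Longrightarrow> weighted_orders m (store s x i v) = weighted_orders m s"
  by (auto simp: weighted_orders_def orders_def)

lemma shrinks_store [simp]:
  "x \<notin> {''pos'', ''mu''} \<Longrightarrow> shrinks J m s m' (store s' x i v) = shrinks J m s m' s'"
  by (simp add: shrinks_def)

lemma clean_up:
  assumes n: "s ''n'' 0 = int n" and w: "weighted_orders m s" and m: "m \<le> 2 * n + 1" and i: "s ''i'' 0 = int i" "i < m"
  shows "\<exists>m' \<le> n + 1. weighted_orders m' (run clean_up s) \<and>
    shrinks (if wt s i = 0 then {..<m} - {i} else {..<m}) m s m' (run clean_up s)"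
proof -
  define s1 where "s1 = run (guarded (Equal (vec ''mu'' ''i'') (Const 0)) (''z'' ::= var ''i'' ;; drop_row)) s"
  define m1 where "m1 = (if wt s i = 0 then m - 1 else m)"
  let ?J = "if wt s i = 0 then {..<m} - {i} else {..<m}"
  have 1: "weighted_orders m1 s1 \<and> shrinks ?J m s m1 s1"
  proof (cases "wt s i = 0")
    case True
    let ?s = "store s ''z'' 0 (int i)"
    have "s1 = run drop_row ?s" using True i by (simp add: s1_def wt_def)
    moreover have "weighted_orders (m - 1) (run drop_row ?s)" "shrinks ({..<m} - {i}) m ?s (m - 1) (run drop_row ?s)"
      using drop_row[of ?s m i] n w i True by simp_all
    moreover have "shrinks J m ?s m' s' = shrinks J m s m' s'" for J m' s'
      unfolding shrinks_def by simp
    ultimately show ?thesis using True by (simp add: m1_def)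
  next
    case False
    then have "s1 = s" using i by (simp add: s1_def wt_def)
    then show ?thesis using False w shrinks_refl by (simp add: m1_def)
  qed
  have n1: "s1 ''n'' 0 = int n" unfolding s1_def by (subst sem_unwritten) (simp_all add: n)
  let ?I = "\<lambda>k t. \<exists>m' \<le> n + 1 + (n - k). weighted_orders m' t \<and> shrinks ?J m s m' t"
  have "?I n (run (PFor ''y'' 1 0 reduce) s1)"
  proof (rule For_induct[where I = ?I], goal_cases)
    case 1
    have "m1 \<le> m" by (simp add: m1_def)
    then have "m1 \<le> n + 1 + (n - 0)" using m by simp
    then show ?case using \<open>weighted_orders m1 s1 \<and> shrinks ?J m s m1 s1\<close>
      by (intro exI[of _ m1]) simp
  next
    case (2 k t)
    obtain m' where m': "m' \<le> n + 1 + (n - k)" "weighted_orders m' t" "shrinks ?J m s m' t" using 2(4) by blast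
    have tn: "t ''n'' 0 = int n" using 2(3)[of "''n''"] n1 by simp
    have tm: "t ''m'' 0 = int m'" using m'(2) unfolding weighted_orders_def by simp
    show ?case
    proof (cases "n + 1 < m'")
      case True
      then have "m' \<le> 2 * n + 3" using m' by simp
      note R = reduce_shrinks[OF tn m'(2) True this]
      have "m' - 1 \<le> n + 1 + (n - Suc k)" using m'(1) 2(1) True by simp
      then show ?thesis using R(1) shrinks_trans[OF m'(3) R(2)]
        by (intro exI[of _ "m' - 1"]) simp
    next
      case False
      then have "run reduce t = t" using tn tm by (simp add: reduce_def)
      then show ?thesis using m' False by (intro exI[of _ m']) simp
    qed
  qed simp
  then show ?thesis by (simp add: clean_up_def s1_def)
qed

lemma push:
  assumes env: "env s" and w: "weighted_orders m s" and mass: "0 < (\<Sum>j<m. wt s j)" and m: "m \<le> n + 1"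
    and x: "x = comb m (row s) (wt s)" "\<And>v. v < n \<Longrightarrow> s ''x'' (int v) = x v"
    and lab: "labels m (row s) x d"
    and t: "s ''t'' 0 = int t" "t < n" "x t < 0" "d t < n"
    and t_max: "\<And>v. v < n \<Longrightarrow> x v < 0 \<Longrightarrow> d v < n \<Longrightarrow> key d v \<le> key d t"
    and a: "s ''s'' 0 = int a" "a < n" "d t = Suc (d a)" "\<exists>j<m. row s j a < row s j t"
    and a_max: "\<And>v j. v < n \<Longrightarrow> d t = Suc (d v) \<Longrightarrow> j < m \<Longrightarrow> row s j v < row s j t \<Longrightarrow> v \<le> a"
    and bd: "bounded m (row s) x d b1 b2 b3 b4 b5"
  shows "\<exists>m' \<le> n + 1. weighted_orders m' (run push s) \<and> 0 < (\<Sum>j<m'. wt (run push s) j) \<and>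
    labels m' (row (run push s)) (comb m' (row (run push s)) (wt (run push s))) d \<and>
    (\<exists>c1 c2 c3 c4 c5. bounded m' (row (run push s)) (comb m' (row (run push s)) (wt (run push s))) d c1 c2 c3 c4 c5 \<and>
      c2 < n * n \<and> c3 < n \<and> c4 \<le> n \<and> c5 < m \<and>
      (lex_less c1 c2 c3 c4 c5 b1 b2 b3 b4 b5))"
proof -
  have sn: "s ''n'' 0 = int n" using env unfolding env_def by simp
  have sm: "s ''m'' 0 = int m" and o: "orders m s" and pos: "\<And>j. j < m \<Longrightarrow> 0 \<le> wt s j"
    using w unfolding weighted_orders_def by simp_all
  define s1 where "s1 = run select_i s"
  have s1: "s1 y = s y" if "y \<notin> {''best'', ''j'', ''c'', ''v'', ''i''}" for y
    using that by (simp add: s1_def sem_unwritten)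
  have m3: "m \<le> 2 * n + 3" using m by simp
  obtain i where i: "i < m" "s1 ''i'' 0 = int i" "row s i a < row s i t"
    "\<And>j. j < m \<Longrightarrow> interval_size (row s j) a t \<le> interval_size (row s i) a t"
    using select_i[of s m a t] sn sm a t m3 unfolding s1_def by blast
  let ?p = "row s i"
  have inj: "inj_on ?p {..<n}" using o i(1) unfolding orders_def by blast
  have rows1: "row s1 = row s" "brow s1 = brow s" "wt s1 = wt s"
    by (simp_all add: row_def brow_def wt_def s1 fun_eq_iff)
  define s2 where "s2 = run append_moves s1"
  have s2: "s2 y = s1 y" if "y \<notin> {''u'', ''k'', ''q'', ''v'', ''pos'', ''w'', ''Y'', ''h'', ''b''}" for y
    using that by (simp add: s2_def sem_unwritten)
  have o1: "orders m s1" using o unfolding orders_def rows1 .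
  have env1: "env s1" using env by (simp add: env_def s1)
  have pre1: "s1 ''m'' 0 = int m" "s1 ''s'' 0 = int a" "s1 ''t'' 0 = int t" using sm a t by (simp_all add: s1)
  have rows2: "row s2 j v = (if j < m then row s j v else move ?p a (target ?p a t (j - m)) v)"
    if "j < m + n" "v < n" for j v
    using append_moves(1)[of s1 m i a t j v] env1 pre1 i a t o1 that unfolding s2_def rows1 by blast
  have o2: "orders (m + n) s2"
    using append_moves(2)[of s1 m i a t] env1 pre1 i a t o1 unfolding s2_def rows1 by blast
  have p2: "row s2 i v = ?p v" if "v < n" for v using rows2[of i v] i that by simp
  have base2: "base (row s2 (m + u)) v = base (move ?p a (target ?p a t u)) v" if "u < n" "v < n" for u v
    using rows2[of "m + u"] that by (intro base_cong) auto
  have basei: "base (row s2 j) v = base (row s j) v" if "j < m" "v < n" for j v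
    using rows2[of j] that by (intro base_cong) auto
  have diff: "brow s2 (m + u) v - brow s2 i v = exchange ?p a (target ?p a t u) v" if "u < n" "v < n" for u v
  proof -
    have "brow s2 (m + u) v = base (row s2 (m + u)) v" "brow s2 i v = base (row s2 i) v"
      using o2 i that unfolding orders_def by auto
    then show ?thesis unfolding exchange_def using base2 basei i that by simp
  qed
  define s3 where "s3 = run elimination s2"
  have s3: "s3 y = s2 y" if "y \<notin> {''q'', ''z'', ''v'', ''p'', ''e'', ''u'', ''co'', ''r''}" for y
    using that by (simp add: s3_def sem_unwritten)
  let ?co = "\<lambda>u. s3 ''co'' (int u)" and ?r = "\<lambda>v. s3 ''r'' (int v)"
  have inj2: "inj_on (row s2 i) {..<n}" using o2 i unfolding orders_def by simp
  have ex2: "brow s2 (m + u) v - brow s2 i v = exchange (row s2 i) a u v"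
    if "u < n" "v < n" "row s2 i a < row s2 i u" "row s2 i u \<le> row s2 i t" for u v
  proof -
    have "target ?p a t u = u" using that p2 a t by (simp add: target_def)
    moreover have "exchange (row s2 i) a u v = exchange ?p a u v"
    proof -
      have "base (move (row s2 i) a u) v = base (move ?p a u) v"
        using p2 a that by (intro base_cong) (auto simp: move_def)
      then show ?thesis unfolding exchange_def using basei i that by simp
    qed
    ultimately show ?thesis using diff that by simp
  qed
  have pre2: "s2 ''n'' 0 = int n" "s2 ''m'' 0 = int m" "s2 ''i'' 0 = int i" "s2 ''s'' 0 = int a" "s2 ''t'' 0 = int t"
    using sn sm a t i by (simp_all add: s1 s2)
  have at2: "row s2 i a < row s2 i t" using p2 a t i by simp
  note el = elimination[of s2 m i a t, OF pre2 inj2 a(2) t(2) at2 ex2, folded s3_def]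
  define q where "q = ?r t"
  have fin: "?r v = (if v = t then q else if v = a then - q else 0)" if "v < n" for v
    using elim_final(1)[OF inj2 a(2) t(2) at2 el that] unfolding q_def by simp
  have q: "0 \<le> q" using elim_final(2)[OF inj2 a(2) t(2) at2 el t(2)] unfolding q_def by simp
  define W where "W = (\<Sum>u<n. ?co u)"
  have W: "0 < W" and co: "\<And>u. u < n \<Longrightarrow> 0 \<le> ?co u" and
    sup: "\<And>u. u < n \<Longrightarrow> ?co u \<noteq> 0 \<Longrightarrow> target ?p a t u = u"
    and r: "\<And>v. v < n \<Longrightarrow> ?r v = (\<Sum>u<n. ?co u * exchange (row s2 i) a u v)"
    using el(1) p2 a t unfolding elim_inv_def W_def target_def by auto
  define s4 where "s4 = run reweigh s3"
  have s4: "s4 y = s3 y" if "y \<notin> {''W'', ''u'', ''ca'', ''cb'', ''j'', ''mu'', ''m''}" for y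
    using that by (simp add: s4_def sem_unwritten)
  have wt3: "wt s3 = wt s" by (simp add: wt_def s1 s2 s3 fun_eq_iff)
  have pre3: "s3 ''n'' 0 = int n" "s3 ''m'' 0 = int m" "s3 ''i'' 0 = int i" "s3 ''t'' 0 = int t"
    using pre2 by (simp_all add: s3)
  have xt: "s3 ''x'' (int t) = x t" using x(2) t(2) by (simp add: s1 s2 s3)
  have sm4: "s4 ''m'' 0 = int (m + n)"
    unfolding s4_def by (rule reweigh(1)[of s3 m i t W, OF pre3 m3 i(1) W_def])
  obtain ca cb where scale: "q * wt s i \<le> W * - x t \<and> ca = W \<and> cb = wt s i \<or>
        W * - x t < q * wt s i \<and> ca = q \<and> cb = - x t"
    and wt_old: "\<And>j. j < m \<Longrightarrow> wt s4 j = ca * wt s j - (if j = i then cb * W else 0)"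
    and wt_new: "\<And>u. u < n \<Longrightarrow> wt s4 (m + u) = cb * ?co u"
    using reweigh(2)[of s3 m i t W, OF pre3 m3 i(1) W_def] unfolding s4_def[symmetric] wt3 xt q_def[symmetric] by blast
  have cb: "0 \<le> cb" using scale pos[OF i(1)] t(3) by auto
  have ca: "0 < ca"
  proof (cases "ca = W")
    case False
    then have "W * - x t < q * wt s i" "ca = q" using scale by auto
    moreover have "0 < W * - x t" using W t(3) by (intro mult_pos_pos) simp_all
    ultimately have "q \<noteq> 0" by auto
    then show ?thesis using q \<open>ca = q\<close> by simp
  qed (use W in simp)
  \<comment> \<open>Full replacement gives order \<open>i\<close> the weight W * mu - mu * W = 0;
    the shorter step gives x t the value q * x t + (- x t) * q = 0. These are the two kinds of
    progress.\<close>
  have x't: "ca * x t + cb * q \<le> 0" and drop: "ca * x t + cb * q < 0 \<Longrightarrow> wt s4 i = 0" and wi: "0 \<le> wt s4 i"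
    using scale wt_old[OF i(1)] by (auto simp: algebra_simps)
  have rows4: "row s4 = row s2" "brow s4 = brow s2"
    by (simp_all add: row_def brow_def s3 s4 fun_eq_iff)
  have w4: "weighted_orders (m + n) s4"
    unfolding weighted_orders_def
  proof (intro conjI allI impI)
    show "orders (m + n) s4" using o2 unfolding orders_def rows4 .
    fix j assume j: "j < m + n"
    show "0 \<le> wt s4 j"
    proof (cases "j < m")
      case True
      then show ?thesis using wt_old[OF True] wi pos[OF True] ca by (cases "j = i") auto
    next
      case False
      then show ?thesis using wt_new[of "j - m"] co[of "j - m"] cb j by simp
    qed
  qed (rule sm4)
  have mass4: "(\<Sum>j<m + n. wt s4 j) = ca * (\<Sum>j<m. wt s j)"
  proof -
    have "(\<Sum>j<m. wt s4 j) = ca * (\<Sum>j<m. wt s j) - cb * W"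
      using i(1) by (simp add: wt_old sum_subtractf sum_distrib_left)
    moreover have "(\<Sum>u<n. wt s4 (m + u)) = cb * W" by (simp add: wt_new W_def sum_distrib_left)
    ultimately show ?thesis by (simp add: sum_lessThan_add)
  qed
  have comb4: "comb (m + n) (row s4) (wt s4) v = ca * x v + (if v = t then cb * q else if v = a then - (cb * q) else 0)"
    if v: "v < n" for v
  proof -
    have "(\<Sum>j<m. wt s4 j * base (row s4 j) v) = (\<Sum>j<m. ca * (wt s j * base (row s j) v) - (if j = i then cb * W * base (row s j) v else 0))"
      by (rule sum.cong) (simp_all add: wt_old rows4 basei v algebra_simps)
    then have 1: "(\<Sum>j<m. wt s4 j * base (row s4 j) v) = ca * x v - cb * W * base ?p v"
      using i(1) by (simp add: x comb_def sum_subtractf sum_distrib_left)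
    \<comment> \<open>Each new base is an exchange vector plus the base of order \<open>i\<close>.
      Summed up, the latter parts give \<open>cb * W\<close> times that base, exactly what order
      \<open>i\<close> has lost.\<close>
    have "wt s4 (m + u) * base (row s4 (m + u)) v = cb * (?co u * exchange (row s2 i) a u v) + cb * base ?p v * ?co u"
      if u: "u < n" for u
    proof (cases "?co u = 0")
      case False
      have "base (row s2 (m + u)) v = exchange (row s2 i) a u v + base ?p v"
      proof -
        have "base (move (row s2 i) a u) v = base (move ?p a u) v"
          using p2 a u v by (intro base_cong) (auto simp: move_def)
        then show ?thesis using base2[OF u v] sup[OF u False] basei i v unfolding exchange_def by simp
      qed
      then show ?thesis using wt_new[OF u] by (simp add: rows4 algebra_simps)
    qed (simp add: wt_new u)
    then have "(\<Sum>u<n. wt s4 (m + u) * base (row s4 (m + u)) v) =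
        (\<Sum>u<n. cb * (?co u * exchange (row s2 i) a u v) + cb * base ?p v * ?co u)"
      by (intro sum.cong) auto
    also have "\<dots> = cb * ?r v + cb * base ?p v * W"
      by (simp add: sum.distrib sum_distrib_left r[OF v] W_def)
    finally have "comb (m + n) (row s4) (wt s4) v = ca * x v + cb * ?r v"
      unfolding comb_def sum_lessThan_add using 1 by (simp add: algebra_simps)
    then show ?thesis using fin[OF v] by simp
  qed
  have run: "run push s = run clean_up s4" by (simp add: push_def s1_def s2_def s3_def s4_def)
  let ?s = "run push s"
  let ?J = "if wt s4 i = 0 then {..<m + n} - {i} else {..<m + n}"
  have "s4 ''n'' 0 = int n" "s4 ''i'' 0 = int i" using pre3 by (simp_all add: s4)
  then obtain m' where m': "m' \<le> n + 1" "weighted_orders m' ?s" "shrinks ?J (m + n) s4 m' ?s"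
    using clean_up[of s4 "m + n" i] w4 m i unfolding run by auto
  obtain K \<pi> where K: "0 < K" and \<pi>: "inj_on \<pi> {..<m'}" "\<pi> ` {..<m'} \<subseteq> ?J"
    and row': "\<And>j v. j < m' \<Longrightarrow> v < n \<Longrightarrow> row ?s j v = row s4 (\<pi> j) v"
    and comb': "\<And>v. v < n \<Longrightarrow> comb m' (row ?s) (wt ?s) v = K * comb (m + n) (row s4) (wt s4) v"
    and mass': "(\<Sum>j<m'. wt ?s j) = K * (\<Sum>j<m + n. wt s4 j)"
    using m'(3) unfolding shrinks_def by blast
  let ?x = "comb m' (row ?s) (wt ?s)"
  have \<pi>_less: "\<pi> j < m + n" if "j < m'" for j
    using \<pi>(2) that by (auto split: if_splits)
  have x': "?x v = K * (ca * x v + (if v = t then cb * q else if v = a then - (cb * q) else 0))" if "v < n" for v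
    using comb'[OF that] comb4[OF that] by simp
  have neg: "?x t \<le> 0"
    using x'[OF t(2)] x't K by (simp add: mult_le_0_iff)
  have i_out: "i \<notin> \<pi> ` {..<m'}" if "?x t < 0"
  proof -
    have "ca * x t + cb * q < 0" using x'[OF t(2)] that K by (simp add: mult_less_0_iff)
    then have "wt s4 i = 0" by (rule drop)
    then show ?thesis using \<pi>(2) by auto
  qed
  have old: "row ?s j v = row s (\<pi> j) v" if "j < m'" "\<pi> j < m" "v < n" for j v
    using row'[OF that(1,3)] rows2[of "\<pi> j" v] that by (simp add: rows4)
  have new: "\<exists>u<n. ?p a < ?p u \<and> ?p u \<le> ?p t \<and> (\<forall>v<n. row ?s j v = move ?p a u v)"
    if "j < m'" "\<not> \<pi> j < m" for j
  proof (intro exI[of _ "target ?p a t (\<pi> j - m)"] conjI allI impI)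
    show "target ?p a t (\<pi> j - m) < n" using t(2) \<pi>_less[OF that(1)] that by (auto simp: target_def)
    show "?p a < ?p (target ?p a t (\<pi> j - m))" "?p (target ?p a t (\<pi> j - m)) \<le> ?p t"
      using i(3) by (auto simp: target_def)
    show "row ?s j v = move ?p a (target ?p a t (\<pi> j - m)) v" if "v < n" for v
      using row'[OF \<open>j < m'\<close> that] rows2[of "\<pi> j" v] \<pi>_less[OF \<open>j < m'\<close>] that \<open>\<not> \<pi> j < m\<close>
      by (simp add: rows4)
  qed
  have injs: "inj_on (row s j) {..<n}" if "j < m" for j using o that unfolding orders_def by blast
  have "0 \<le> cb * q" using cb q by simp
  have at: "a < n" "d t = Suc (d a)" "row s i a < row s i t" "i < m" using a i by simp_all
  have L: "labels m' (row ?s) ?x d"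
    by (rule push_progress(1)[of m "row s" x d t a i ?x K ca "cb * q" \<pi> m' "row ?s" b1 b2 b3 b4 b5])
      (fact injs lab t t_max at a_max i x' K ca \<open>0 \<le> cb * q\<close> neg \<pi>(1) i_out old new bd)+
  have M: "\<exists>c1 c2 c3 c4 c5. bounded m' (row ?s) ?x d c1 c2 c3 c4 c5 \<and>
      c2 < n * n \<and> c3 < n \<and> c4 \<le> n \<and> c5 < m \<and>
      (lex_less c1 c2 c3 c4 c5 b1 b2 b3 b4 b5)"
    by (rule push_progress(2)[of m "row s" x d t a i ?x K ca "cb * q" \<pi> m' "row ?s" b1 b2 b3 b4 b5])
      (fact injs lab t t_max at a_max i x' K ca \<open>0 \<le> cb * q\<close> neg \<pi>(1) i_out old new bd)+
  have "0 < (\<Sum>j<m'. wt ?s j)" using K ca mass unfolding mass' mass4 by simp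
  then show ?thesis using m'(1,2) L M by blast
qed


definition state_ok :: "nat \<Rightarrow> (nat \<Rightarrow> nat) \<Rightarrow> state \<Rightarrow> bool" where
  "state_ok m d s \<longleftrightarrow> env s \<and> m \<le> n + 1 \<and> weighted_orders m s \<and> 0 < (\<Sum>j<m. wt s j) \<and>
     (\<forall>v<n. s ''d'' (int v) = int (d v)) \<and> labels m (row s) (comb m (row s) (wt s)) d"

definition finished :: "nat \<Rightarrow> (nat \<Rightarrow> nat) \<Rightarrow> state \<Rightarrow> bool" where
  "finished m d s \<longleftrightarrow> (\<forall>v<n. comb m (row s) (wt s) v < 0 \<longrightarrow> n \<le> d v)"

abbreviation state_bounded :: "nat \<Rightarrow> (nat \<Rightarrow> nat) \<Rightarrow> state \<Rightarrow> nat \<Rightarrow> nat \<Rightarrow> nat \<Rightarrow> nat \<Rightarrow> nat \<Rightarrow> bool" where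
  "state_bounded m d s \<equiv> bounded m (row s) (comb m (row s) (wt s)) d"

text \<open>The first alternative absorbs surplus rounds, as a finished state stays finished. In the
  second, the new bound is produced from an arbitrary old one, so the induction can carry upper
  bounds instead of an exact measure.\<close>

lemma iterate:
  assumes ok: "state_ok m d s"
  shows "state_ok m d (run iterate s) \<and> finished m d (run iterate s) \<or>
    (\<not> finished m d s \<and> (\<exists>m' d'. state_ok m' d' (run iterate s) \<and> (\<forall>b1 b2 b3 b4 b5. state_bounded m d s b1 b2 b3 b4 b5 \<longrightarrow>
      (\<exists>c1 c2 c3 c4 c5. state_bounded m' d' (run iterate s) c1 c2 c3 c4 c5 \<and>
        c2 \<le> n * n \<and> c3 \<le> n \<and> c4 \<le> n \<and> c5 \<le> Suc n \<and>
        (lex_less c1 c2 c3 c4 c5 b1 b2 b3 b4 b5)))))"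
proof -
  let ?x = "comb m (row s) (wt s)"
  have env: "env s" and m: "m \<le> n + 1" and w: "weighted_orders m s" and mass: "0 < (\<Sum>j<m. wt s j)"
    and d: "\<And>v. v < n \<Longrightarrow> s ''d'' (int v) = int (d v)" and lab: "labels m (row s) ?x d"
    using ok unfolding state_ok_def by auto
  have sn: "s ''n'' 0 = int n" using env unfolding env_def by simp
  have sm: "s ''m'' 0 = int m" and o: "orders m s" using w unfolding weighted_orders_def by simp_all
  have m3: "m \<le> 2 * n + 3" using m by simp
  define s1 where "s1 = run compute_x s"
  have s1: "s1 y = s y" if "y \<notin> {''v'', ''x'', ''j''}" for y using that by (simp add: s1_def sem_unwritten)
  have x1: "s1 ''x'' (int v) = ?x v" if "v < n" for v
    unfolding s1_def by (rule compute_x[OF sn sm m3 o that])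
  define s2 where "s2 = run select_t s1"
  have s2: "s2 y = s1 y" if "y \<notin> {''t'', ''v''}" for y using that by (simp add: s2_def sem_unwritten)
  have run: "run iterate s = run (guarded (BNot (Less (var ''t'') (Const 0)))
    (select_s ;; PCond (Less (var ''s'') (Const 0))
      (PAssign ''d'' (var ''t'') (Add (vec ''d'' ''t'') (Const 1))) push)) s2"
    by (simp only: iterate_def sem.simps(5) s1_def s2_def)
  have pre: "s1 ''n'' 0 = int n" "\<And>v. v < n \<Longrightarrow> s1 ''d'' (int v) = int (d v)" using sn d by (simp_all add: s1)
  have "(s2 ''t'' 0 < 0 \<and> (\<forall>v<n. ?x v < 0 \<longrightarrow> n \<le> d v)) \<or>
    (\<exists>t<n. s2 ''t'' 0 = int t \<and> ?x t < 0 \<and> d t < n \<and>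
      (\<forall>v<n. ?x v < 0 \<longrightarrow> d v < n \<longrightarrow> key d v \<le> key d t))"
    unfolding s2_def by (rule select_t) (fact pre x1)+
  then show ?thesis
  proof (elim disjE exE conjE)
    assume t: "s2 ''t'' 0 < 0" "\<forall>v<n. ?x v < 0 \<longrightarrow> n \<le> d v"
    have rs: "row s2 = row s" "wt s2 = wt s" "brow s2 = brow s"
      by (simp_all add: row_def wt_def brow_def s1 s2 fun_eq_iff)
    have "run iterate s = s2" unfolding run using t(1) by simp
    moreover have "state_ok m d s2"
      using ok unfolding state_ok_def env_def weighted_orders_def orders_def rs by (simp add: s1 s2)
    ultimately show ?thesis using t(2) by (simp add: finished_def rs)
  next
    fix t assume t: "t < n" "s2 ''t'' 0 = int t" "?x t < 0" "d t < n"
      "\<forall>v<n. ?x v < 0 \<longrightarrow> d v < n \<longrightarrow> key d v \<le> key d t"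
    have unfinished: "\<not> finished m d s" using t unfolding finished_def by auto
    define s3 where "s3 = run select_s s2"
    have s3: "s3 y = s2 y" if "y \<notin> {''s'', ''v'', ''j''}" for y using that by (simp add: s3_def sem_unwritten)
    have rs2: "row s2 = row s" by (simp add: row_def s1 s2 fun_eq_iff)
    have rs: "row s3 = row s" "wt s3 = wt s" "brow s3 = brow s"
      by (simp_all add: row_def wt_def brow_def s1 s2 s3 fun_eq_iff)
    have pre2: "s2 ''n'' 0 = int n" "s2 ''m'' 0 = int m" "s2 ''t'' 0 = int t"
      "\<And>v. v < n \<Longrightarrow> s2 ''d'' (int v) = int (d v)" using sn sm t d by (simp_all add: s1 s2)
    have run3: "run iterate s = run (PCond (Less (var ''s'') (Const 0))
      (PAssign ''d'' (var ''t'') (Add (vec ''d'' ''t'') (Const 1))) push) s3"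
      unfolding run using t(2) by (simp add: s3_def)
    have w3: "weighted_orders m s3" using w unfolding weighted_orders_def orders_def rs by (simp add: s1 s2 s3)
    have env3: "env s3" using env by (simp add: env_def s1 s2 s3)
    have t3: "s3 ''t'' 0 = int t" using t by (simp add: s3)
    have d3: "s3 ''d'' (int v) = int (d v)" if "v < n" for v using d that by (simp add: s1 s2 s3)
    have "(s3 ''s'' 0 < 0 \<and> (\<forall>v<n. \<not> (d t = Suc (d v) \<and> (\<exists>j<m. row s2 j v < row s2 j t)))) \<or>
      (\<exists>a<n. s3 ''s'' 0 = int a \<and> d t = Suc (d a) \<and> (\<exists>j<m. row s2 j a < row s2 j t) \<and>
        (\<forall>v<n. d t = Suc (d v) \<longrightarrow> (\<exists>j<m. row s2 j v < row s2 j t) \<longrightarrow> v \<le> a))"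
      unfolding s3_def by (rule select_s) (fact pre2 m3 t(1))+
    then consider (relabel) "s3 ''s'' 0 < 0" "\<forall>v<n. \<not> (d t = Suc (d v) \<and> (\<exists>j<m. row s j v < row s j t))" |
      (push) a where "a < n" "s3 ''s'' 0 = int a" "d t = Suc (d a)" "\<exists>j<m. row s j a < row s j t"
        "\<forall>v<n. d t = Suc (d v) \<longrightarrow> (\<exists>j<m. row s j v < row s j t) \<longrightarrow> v \<le> a"
      unfolding rs2 by blast
    then show ?thesis
    proof cases
      case a: relabel
      let ?d = "d(t := Suc (d t))"
      let ?s = "store s3 ''d'' (int t) (int (d t) + 1)"
      have r: "run iterate s = ?s" unfolding run3 using a(1) t3 d3[OF t(1)] by simp
      have no_arc: "\<not> (\<exists>j<m. row s j v < row s j t)" if "v < n" "d t = Suc (d v)" for v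
        using a(2) that by blast
      have R: "labels m (row s) ?x ?d" "(\<Sum>v<n. n - ?d v) < (\<Sum>v<n. n - d v)"
        by (rule labels_relabel[of m "row s" ?x d t]; fact lab t less_imp_le[OF t(3)] no_arc)+
      have rs': "row ?s = row s" "wt ?s = wt s" by (simp_all add: rs)
      have "state_ok m ?d ?s"
        unfolding state_ok_def rs' using env3 m w3 mass d3 R(1) by (simp add: env_def)
      moreover have "\<exists>c1 c2 c3 c4 c5. state_bounded m ?d ?s c1 c2 c3 c4 c5 \<and>
        c2 \<le> n * n \<and> c3 \<le> n \<and> c4 \<le> n \<and> c5 \<le> Suc n \<and>
        (lex_less c1 c2 c3 c4 c5 b1 b2 b3 b4 b5)"
        if "state_bounded m d s b1 b2 b3 b4 b5" for b1 b2 b3 b4 b5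
      proof -
        have "(\<Sum>v<n. n - ?d v) < b1" using R(2) that unfolding bounded_def by simp
        moreover have "state_bounded m ?d ?s (\<Sum>v<n. n - ?d v) (n * n) n n (Suc n)"
          by (rule bounded_trivial) (use m in simp)
        ultimately show ?thesis by blast
      qed
      ultimately show ?thesis unfolding r using unfinished by blast
    next
      case a: push
      have r: "run iterate s = run push s3" unfolding run3 using a(2) by simp
      let ?s = "run push s3"
      have x3: "s3 ''x'' (int v) = ?x v" if "v < n" for v using x1[OF that] by (simp add: s2 s3)
      have P: "\<exists>m'\<le>n + 1. weighted_orders m' ?s \<and> 0 < (\<Sum>j<m'. wt ?s j) \<and>
        labels m' (row ?s) (comb m' (row ?s) (wt ?s)) d \<and>
        (\<exists>c1 c2 c3 c4 c5. bounded m' (row ?s) (comb m' (row ?s) (wt ?s)) d c1 c2 c3 c4 c5 \<and>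
          c2 < n * n \<and> c3 < n \<and> c4 \<le> n \<and> c5 < m \<and>
          (lex_less c1 c2 c3 c4 c5 b1 b2 b3 b4 b5))"
        if "state_bounded m d s b1 b2 b3 b4 b5" for b1 b2 b3 b4 b5
        by (rule push[of s3 m ?x d t a]) (use env3 w3 mass m x3 lab t t3 a that in \<open>auto simp: rs\<close>)
      obtain m' where m': "m' \<le> n + 1" "weighted_orders m' ?s" "0 < (\<Sum>j<m'. wt ?s j)"
        "labels m' (row ?s) (comb m' (row ?s) (wt ?s)) d" and P': "\<And>b1 b2 b3 b4 b5. state_bounded m d s b1 b2 b3 b4 b5 \<Longrightarrow>
        (\<exists>c1 c2 c3 c4 c5. bounded m' (row ?s) (comb m' (row ?s) (wt ?s)) d c1 c2 c3 c4 c5 \<and>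
          c2 < n * n \<and> c3 < n \<and> c4 \<le> n \<and> c5 < m \<and>
          (lex_less c1 c2 c3 c4 c5 b1 b2 b3 b4 b5))"
      proof -
        have "state_bounded m d s (\<Sum>v<n. n - d v) (n * n) n n (Suc n)"
          by (rule bounded_trivial) (use m in simp)
        from P[OF this] obtain m' where m': "m' \<le> n + 1" "weighted_orders m' ?s" "0 < (\<Sum>j<m'. wt ?s j)"
          "labels m' (row ?s) (comb m' (row ?s) (wt ?s)) d" by blast
        \<comment> \<open>\<open>push\<close> yields its number of orders only after the bounds are
          fixed. The value stored in \<open>m\<close> determines it, so one number serves all
          bounds.\<close>
        have "k = m'" if "weighted_orders k ?s" for k
          using that m'(2) unfolding weighted_orders_def by simp
        then show ?thesis using that[OF m'] P by (metis (no_types, lifting))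
      qed
      have "env ?s" using env3 by (rule env_run) simp
      moreover have "?s ''d'' (int v) = int (d v)" if "v < n" for v using d3[OF that] by (simp add: sem_unwritten)
      ultimately have "state_ok m' d ?s" unfolding state_ok_def using m' by blast
      moreover have "\<exists>c1 c2 c3 c4 c5. state_bounded m' d ?s c1 c2 c3 c4 c5 \<and>
        c2 \<le> n * n \<and> c3 \<le> n \<and> c4 \<le> n \<and> c5 \<le> Suc n \<and>
        (lex_less c1 c2 c3 c4 c5 b1 b2 b3 b4 b5)"
        if bd: "state_bounded m d s b1 b2 b3 b4 b5" for b1 b2 b3 b4 b5
      proof -
        obtain c1 c2 c3 c4 c5 where c: "state_bounded m' d ?s c1 c2 c3 c4 c5"
          "c2 < n * n" "c3 < n" "c4 \<le> n" "c5 < m"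
          "lex_less c1 c2 c3 c4 c5 b1 b2 b3 b4 b5"
          using P'[OF bd] by blast
        have "c2 \<le> n * n" "c3 \<le> n" "c5 \<le> Suc n" using c(2,3,5) m by simp_all
        then show ?thesis using c(1,4,6) by blast
      qed
      ultimately show ?thesis unfolding r using unfinished by blast
    qed
  qed
qed

end

section \<open>Nested loops and the complete algorithm\<close>

text \<open>The first character separates the counters of nested loops from all other variables.\<close>

definition counter :: "char \<Rightarrow> nat \<Rightarrow> vname" where
  "counter c j = c # replicate j c"

lemma counter_eq_iff [simp]: "counter c i = counter c' j \<longleftrightarrow> c = c' \<and> i = j"
  unfolding counter_def by (auto simp: replicate_eq_replicate)

lemma counter_in_image [simp]: "counter c i \<in> counter c' ` S \<longleftrightarrow> c = c' \<and> i \<in> S"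
  by auto

lemma counter_eq_Cons:
  "counter c j = x # xs \<longleftrightarrow> x = c \<and> xs = replicate j c"
  "x # xs = counter c j \<longleftrightarrow> x = c \<and> xs = replicate j c"
  unfolding counter_def by auto

text \<open>A single loop runs only linearly often; \<open>d\<close> nested loops of length n + 3
  run the body (n + 3)^d times.\<close>

fun iterated :: "nat \<Rightarrow> prog \<Rightarrow> prog" where
  "iterated 0 c = c"
| "iterated (Suc d) c = PFor (counter (CHR ''#'') d) 1 3 (iterated d c)"

lemma written_iterated: "written (iterated d c) = written c \<union> counter (CHR ''#'') ` {..<d}"
  by (induction d) (auto simp: lessThan_Suc)

lemma counters_safe_iterated:
  "counters_safe c \<Longrightarrow> (\<And>j. counter (CHR ''#'') j \<notin> written c) \<Longrightarrow> counters_safe (iterated d c)"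
  by (induction d) (auto simp: written_iterated)

text \<open>The invariant is indexed by the number of completed bodies and must survive writing the
  counters; the nesting then disappears from view.\<close>

lemma iterated_induct:
  assumes step: "\<And>k s. I k s \<Longrightarrow> I (Suc k) (sem n val mem c s)"
    and counters: "\<And>k s j v. I k s \<Longrightarrow> I k (store s (counter (CHR ''#'') j) 0 v)"
  shows "I k s \<Longrightarrow> I (k + (n + 3) ^ d) (sem n val mem (iterated d c) s)"
proof (induction d arbitrary: k s)
  case 0
  then show ?case using step by simp
next
  case (Suc d)
  let ?J = "\<lambda>i t. I (k + i * (n + 3) ^ d) t"
  have "?J (n + 3) (sem n val mem (PFor (counter (CHR ''#'') d) 1 3 (iterated d c)) s)"
  proof (rule For_induct[where I = ?J], goal_cases)
    case 1
    show ?case using counters[OF Suc.prems] by simp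
  next
    case (2 i t)
    then show ?case using counters[OF Suc.IH[OF 2(4)]] by (simp add: algebra_simps)
  qed simp
  then show ?case by (simp add: algebra_simps)
qed

text \<open>One order, the identity, with weight 1. Zero labels are valid for any family of
  orders.\<close>

definition start :: prog where
  "start = PFor ''v'' 1 0 (PAssign ''d'' (var ''v'') (Const 0) ;; PAssign ''pos'' (var ''v'') (var ''v'')) ;;
    ''k'' ::= Const 0 ;; base_row ;; ''m'' ::= Const 1 ;; ''mu'' ::= Const 1"

definition minimize :: prog where
  "minimize = start ;; iterated 10 iterate"

definition test_candidate :: prog where
  "test_candidate = PMember ''h'' (Const 0) ''Y'' ;; guarded (Equal (var ''h'') (Const 1))
    (PValue ''h'' (Const 1) ''Y'' ;;
     guarded (either (Equal (var ''F'') (Const 0)) (Less (Read ''h'' (Const 1)) (var ''O'')))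
      (''F'' ::= Const 1 ;; ''O'' ::= Read ''h'' (Const 1) ;;
       PFor ''v'' 1 0 (PAssign ''X'' (var ''v'') (vec ''Y'' ''v''))))"

text \<open>Which label is missing is not computed: the thresholds 0 to \<open>n\<close> are all
  tried.\<close>

definition test_cuts :: prog where
  "test_cuts = PFor ''j'' 1 1 (query_set (Less (var ''j'') (vec ''d'' ''w'')) ;; test_candidate)"

abbreviation ctr_a :: "nat \<Rightarrow> vname" where "ctr_a \<equiv> counter (CHR ''!'')"
abbreviation ctr_b :: "nat \<Rightarrow> vname" where "ctr_b \<equiv> counter (CHR ''?'')"

fun mark :: "nat \<Rightarrow> prog" where
  "mark 0 = PSkip"
| "mark (Suc j) = mark j ;; PAssign ''A'' (var (ctr_a j)) (Const 1) ;; PAssign ''B'' (var (ctr_b j)) (Const 1)"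

definition clear :: prog where
  "clear = PFor ''v'' 1 0 (PAssign ''A'' (var ''v'') (Const 0) ;; PAssign ''B'' (var ''v'') (Const 0))"

definition search_interval :: "nat \<Rightarrow> prog" where
  "search_interval k = clear ;; mark k ;; minimize ;; test_cuts"

fun for_pairs :: "nat \<Rightarrow> prog \<Rightarrow> prog" where
  "for_pairs 0 c = c"
| "for_pairs (Suc j) c = PFor (ctr_a j) 1 0 (PFor (ctr_b j) 1 0 (for_pairs j c))"

definition full_set :: prog where
  "full_set = PFor ''v'' 1 0 (PAssign ''Y'' (var ''v'') (Const 1))"

text \<open>The first test concerns the empty set, because all cells of ''Y'' are 0 in the input
  state.\<close>

definition algorithm :: "nat \<Rightarrow> prog" where
  "algorithm k = test_candidate ;; full_set ;; test_candidate ;; for_pairs k (search_interval k)"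

definition work_vars :: "vname set" where
  "work_vars = written iterate \<union> {''d'', ''pos'', ''k'', ''v'', ''w'', ''Y'', ''h'', ''b'', ''m'', ''mu'', ''F'', ''O'', ''X'', ''j'', ''A'', ''B''}"

lemma counter_work_vars: "c \<in> {CHR ''#'', CHR ''!'', CHR ''?''} \<Longrightarrow> counter c j \<notin> work_vars"
  by (auto simp: work_vars_def counter_eq_Cons)

lemma work_vars_n: "''n'' \<notin> work_vars"
  by (simp add: work_vars_def)

lemma written_test_candidate [simp]:
  "written test_candidate = {''h'', ''F'', ''O'', ''v'', ''X''}"
  "written test_cuts = {''j'', ''w'', ''Y'', ''h'', ''F'', ''O'', ''v'', ''X''}"
  "written start = {''v'', ''d'', ''pos'', ''k'', ''w'', ''Y'', ''h'', ''b'', ''m'', ''mu''}"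
  "written clear = {''v'', ''A'', ''B''}"
  "written full_set = {''v'', ''Y''}"
  by (auto simp: test_candidate_def test_cuts_def start_def clear_def full_set_def)

lemma written_mark: "written (mark k) \<subseteq> {''A'', ''B''}"
  by (induction k) auto

lemma written_search_interval: "written (search_interval k) \<subseteq> work_vars \<union> counter (CHR ''#'') ` {..<10}"
proof -
  have AB: "{''A'', ''B''} \<subseteq> work_vars" and sub: "written iterate \<subseteq> work_vars" "written start \<subseteq> work_vars"
    "written clear \<subseteq> work_vars" "written test_cuts \<subseteq> work_vars"
    by (simp_all add: work_vars_def)
  have marked: "written (mark k) \<subseteq> work_vars" by (rule subset_trans[OF written_mark AB])
  show ?thesis
    unfolding search_interval_def minimize_def written.simps written_iterated
    by (intro Un_least; (rule sup_ge2 | (rule le_supI1, rule sub marked)))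
qed

lemma written_for_pairs: "written (for_pairs k c) = written c \<union> ctr_a ` {..<k} \<union> ctr_b ` {..<k}"
  by (induction k) (auto simp: lessThan_Suc)

lemma counters_safe_for_pairs:
  "counters_safe c \<Longrightarrow> (\<And>j. ctr_a j \<notin> written c \<and> ctr_b j \<notin> written c) \<Longrightarrow> counters_safe (for_pairs k c)"
  by (induction k) (auto simp: written_for_pairs)

lemma counters_not_written:
  "ctr_a j \<notin> written (search_interval k)" "ctr_b j \<notin> written (search_interval k)"
  "''n'' \<notin> written (search_interval k)"
proof -
  have "x \<notin> written (search_interval k)" if "x \<notin> work_vars" "x \<notin> range (counter (CHR ''#''))" for x
    using written_search_interval[of k] that by blast
  moreover have "ctr_a j \<notin> range (counter (CHR ''#''))" "ctr_b j \<notin> range (counter (CHR ''#''))"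
    "''n'' \<notin> range (counter (CHR ''#''))"
    by (auto simp: counter_eq_Cons)
  ultimately show "ctr_a j \<notin> written (search_interval k)" "ctr_b j \<notin> written (search_interval k)"
    "''n'' \<notin> written (search_interval k)"
    using counter_work_vars[of "CHR ''!''" j] counter_work_vars[of "CHR ''?''" j] work_vars_n by simp_all
qed

lemma counters_safe_algorithm: "counters_safe (algorithm k)"
proof -
  have c: "counters_safe test_candidate" by (simp add: test_candidate_def)
  have "counter (CHR ''#'') j \<notin> written iterate" for j
    using counter_work_vars[of "CHR ''#''" j] by (simp add: work_vars_def)
  then have "counters_safe (iterated 10 iterate)" by (intro counters_safe_iterated) simp_all
  moreover have "counters_safe start" by (simp add: start_def)
  moreover have "counters_safe (mark k)" by (induction k) simp_all
  moreover have "counters_safe clear" "counters_safe full_set" "counters_safe test_cuts"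
    using c by (simp_all add: clear_def full_set_def test_cuts_def)
  ultimately have "counters_safe (search_interval k)"
    by (simp add: search_interval_def minimize_def)
  then have "counters_safe (for_pairs k (search_interval k))"
    using counters_not_written by (intro counters_safe_for_pairs) auto
  then show ?thesis using c by (simp add: algorithm_def full_set_def)
qed

lemma n_not_written_algorithm: "''n'' \<notin> written (algorithm k)"
proof -
  have "''n'' \<notin> range ctr_a" "''n'' \<notin> range ctr_b" by (auto simp: counter_eq_Cons)
  then have "''n'' \<notin> ctr_a ` {..<k}" "''n'' \<notin> ctr_b ` {..<k}" by blast+
  then show ?thesis
    using counters_not_written(3)[of k] by (simp add: algorithm_def written_for_pairs)
qed

context minimization
begin

lemma start:
  assumes env: "env s"
  shows "state_ok 1 (\<lambda>_. 0) (run start s)"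
proof -
  have sn: "s ''n'' 0 = int n" using env unfolding env_def by simp
  let ?c = "PAssign ''d'' (var ''v'') (Const 0) ;; PAssign ''pos'' (var ''v'') (var ''v'')"
  define s1 where "s1 = run (PFor ''v'' 1 0 ?c) s"
  let ?I = "\<lambda>k t. \<forall>v<k. t ''d'' (int v) = 0 \<and> t ''pos'' (int v) = int v"
  have "?I n s1"
    unfolding s1_def
  proof (rule For_induct[where I = ?I], goal_cases)
    case (2 k t)
    note k = 2(1,2) and IH = 2(4)
    show ?case using IH k by (simp add: less_Suc_eq)
  qed simp_all
  then have s1: "s1 ''d'' (int v) = 0" "row s1 0 v = int v" if "v < n" for v
    using that by (simp_all add: row_def)
  have env1: "env s1" unfolding s1_def by (rule env_run[OF env]) simp
  define s2 where "s2 = store s1 ''k'' 0 (int 0)"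
  define s3 where "s3 = run base_row s2"
  have "env s2" "s2 ''k'' 0 = int 0" using env1 by (simp_all add: s2_def)
  note B = base_row(1)[OF this, folded s3_def]
  have env3: "env s3" unfolding s3_def by (rule env_run[OF \<open>env s2\<close>]) simp
  have row3: "row s3 = row s1" by (simp add: s3_def row_run s2_def)
  have d3: "s3 ''d'' (int v) = 0" if "v < n" for v using s1(1)[OF that] by (simp add: s3_def s2_def sem_unwritten)
  let ?s = "store (store s3 ''m'' 0 1) ''mu'' 0 1"
  have run: "run start s = ?s" by (simp add: start_def s1_def s2_def s3_def)
  have "inj_on (row s3 0) {..<n}" using s1(2) by (auto simp: inj_on_def row3)
  moreover have "brow s3 0 v = base (row s3 0) v" if "v < n" for v
    using B[OF that] by (simp add: s2_def row3)
  ultimately have "orders 1 ?s" unfolding orders_def by simp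
  then show ?thesis
    unfolding state_ok_def run weighted_orders_def labels_def using env3 d3
    by (simp add: wt_def)
qed

lemma state_ok_store:
  assumes "x \<notin> work_vars" "x \<noteq> ''n''"
  shows "state_ok m d (store s x i v) = state_ok m d s" "finished m d (store s x i v) = finished m d s"
    "state_bounded m d (store s x i v) = state_bounded m d s"
proof -
  have x: "x \<notin> {''n'', ''A'', ''B'', ''d'', ''pos'', ''b'', ''m'', ''mu''}"
    using assms by (auto simp: work_vars_def)
  then have "(store s x i v) ''d'' = s ''d''" by auto
  then show "state_ok m d (store s x i v) = state_ok m d s" "finished m d (store s x i v) = finished m d s"
    "state_bounded m d (store s x i v) = state_bounded m d s"
    using x unfolding state_ok_def finished_def by simp_all
qed

text \<open>As long as the state is not finished, the code of the measure plus the number of rounds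
  stays below (n + 3)^10, which fails after that many rounds. Initially all labels are 0, so the
  leading digit is n * n < B and the code is below B^5.\<close>

lemma minimize:
  assumes env: "env s"
  shows "\<exists>m d. state_ok m d (run minimize s) \<and> finished m d (run minimize s)"
proof -
  define B where "B = (n + 3) ^ 2"
  let ?I = "\<lambda>k s. \<exists>m d. state_ok m d s \<and> (finished m d s \<or>
    (\<exists>b1 b2 b3 b4 b5. state_bounded m d s b1 b2 b3 b4 b5 \<and> lex_code B b1 b2 b3 b4 b5 + k < (n + 3) ^ 10))"
  have B: "n * n < B" "n < B" "Suc n < B" unfolding B_def by (simp_all add: power2_eq_square algebra_simps)
  have init: "?I 0 (run start s)"
  proof -
    let ?s = "run start s" and ?d = "\<lambda>_::nat. 0::nat"
    have ok: "state_ok 1 ?d ?s" by (rule start[OF env])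
    have "state_bounded 1 ?d ?s (\<Sum>v<n. n - ?d v) (n * n) n n (Suc n)"
      by (rule bounded_trivial) simp
    then have bd: "state_bounded 1 ?d ?s (n * n) (n * n) n n (Suc n)" by simp
    have "lex_code B (n * n) (n * n) n n (Suc n) < lex_code B B 0 0 0 0"
      using B by (intro lex_code_less) simp_all
    also have "\<dots> = B ^ 5" by (simp add: lex_code_def eval_nat_numeral)
    also have "\<dots> = (n + 3) ^ 10" unfolding B_def power_mult[symmetric] by simp
    finally show ?thesis using ok bd by (intro exI[of _ 1] exI[of _ ?d]) (auto simp del: One_nat_def)
  qed
  have step: "?I (Suc k) (run iterate s)" if "?I k s" for k s
  proof -
    from that obtain m d where ok: "state_ok m d s" and fb: "finished m d s \<or>
      (\<exists>b1 b2 b3 b4 b5. state_bounded m d s b1 b2 b3 b4 b5 \<and> lex_code B b1 b2 b3 b4 b5 + k < (n + 3) ^ 10)"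
      by blast
    show ?thesis
    proof (cases "state_ok m d (run iterate s) \<and> finished m d (run iterate s)")
      case False
      then obtain m' d' where 1: "\<not> finished m d s" "state_ok m' d' (run iterate s)"
        and 2: "\<And>b1 b2 b3 b4 b5. state_bounded m d s b1 b2 b3 b4 b5 \<Longrightarrow>
          (\<exists>c1 c2 c3 c4 c5. state_bounded m' d' (run iterate s) c1 c2 c3 c4 c5 \<and>
            c2 \<le> n * n \<and> c3 \<le> n \<and> c4 \<le> n \<and> c5 \<le> Suc n \<and>
            (lex_less c1 c2 c3 c4 c5 b1 b2 b3 b4 b5))"
        using iterate[OF ok] by blast
      obtain b1 b2 b3 b4 b5 where b: "state_bounded m d s b1 b2 b3 b4 b5" "lex_code B b1 b2 b3 b4 b5 + k < (n + 3) ^ 10"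
        using fb 1(1) by blast
      obtain c1 c2 c3 c4 c5 where c: "state_bounded m' d' (run iterate s) c1 c2 c3 c4 c5"
        "c2 \<le> n * n" "c3 \<le> n" "c4 \<le> n" "c5 \<le> Suc n"
        "lex_less c1 c2 c3 c4 c5 b1 b2 b3 b4 b5"
        using 2[OF b(1)] by blast
      have "lex_code B c1 c2 c3 c4 c5 < lex_code B b1 b2 b3 b4 b5"
        by (rule lex_code_less) (use c B in auto)
      then have "lex_code B c1 c2 c3 c4 c5 + Suc k < (n + 3) ^ 10" using b(2) by simp
      then show ?thesis using 1(2) c(1) by blast
    qed blast
  qed
  have "?I (0 + (n + 3) ^ 10) (run (iterated 10 iterate) (run start s))"
  proof (rule iterated_induct[where I = ?I, OF step _ init])
    fix k s j v assume "?I k s"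
    moreover have "counter (CHR ''#'') j \<notin> work_vars" "counter (CHR ''#'') j \<noteq> ''n''"
      using counter_work_vars by (simp_all add: counter_eq_Cons)
    ultimately show "?I k (store s (counter (CHR ''#'') j) 0 v)"
      by (simp add: state_ok_store)
  qed
  then show ?thesis by (auto simp: minimize_def)
qed


lemma minimize_cut:
  assumes env: "env s"
  shows "\<exists>d. (\<forall>v<n. run minimize s ''d'' (int v) = int (d v)) \<and>
    (\<exists>j\<le>n. \<forall>T\<subseteq>{..<n}. val (({v. v < n \<and> j < d v} \<union> A) - B) \<le> val ((T \<union> A) - B))"
proof -
  let ?s = "run minimize s"
  obtain m d where ok: "state_ok m d ?s" and fin: "finished m d ?s" using minimize[OF env] by blast
  have "family m (row ?s) (wt ?s)"
    using ok unfolding state_ok_def family_def weighted_orders_def orders_def by simp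
  moreover have "labels m (row ?s) (comb m (row ?s) (wt ?s)) d" using ok unfolding state_ok_def by simp
  ultimately have "\<exists>j\<le>n. \<forall>T\<subseteq>{..<n}. val (({v. v < n \<and> j < d v} \<union> A) - B) \<le> val ((T \<union> A) - B)"
    using fin unfolding finished_def by (intro optimal_cut) auto
  then show ?thesis using ok unfolding state_ok_def by blast
qed

end

section \<open>Keeping the best feasible candidate\<close>

context oracles
begin

definition best_ok :: "state \<Rightarrow> bool" where
  "best_ok s \<longleftrightarrow> s ''F'' 0 = 0 \<or>
    s ''F'' 0 = 1 \<and> mem (array_set n (s ''X'')) \<and> val (array_set n (s ''X'')) = s ''O'' 0"

text \<open>An implication, so that every tested set can be recorded, whether feasible or
  not.\<close>

definition beats :: "state \<Rightarrow> nat set \<Rightarrow> bool" where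
  "beats s Z \<longleftrightarrow> (mem Z \<longrightarrow> s ''F'' 0 = 1 \<and> s ''O'' 0 \<le> val Z)"

lemma best_ok_cong: "s ''F'' = s' ''F'' \<Longrightarrow> s ''O'' = s' ''O'' \<Longrightarrow> s ''X'' = s' ''X'' \<Longrightarrow> best_ok s = best_ok s'"
  by (simp add: best_ok_def)

lemma beats_cong: "s ''F'' = s' ''F'' \<Longrightarrow> s ''O'' = s' ''O'' \<Longrightarrow> beats s = beats s'"
  by (simp add: beats_def fun_eq_iff)

lemma test_candidate:
  assumes n: "s ''n'' 0 = int n" and ok: "best_ok s"
  shows "best_ok (run test_candidate s)" and "beats (run test_candidate s) (array_set n (s ''Y''))"
    and "beats s Z \<Longrightarrow> beats (run test_candidate s) Z"
proof -
  let ?Y = "array_set n (s ''Y'')"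
  let ?s = "run test_candidate s"
  have "best_ok ?s \<and> beats ?s ?Y \<and> (beats s Z \<longrightarrow> beats ?s Z)"
  proof (cases "mem ?Y")
    case False
    then have "?s = store s ''h'' 0 0" by (simp add: test_candidate_def)
    moreover have "best_ok (store s ''h'' 0 0) = best_ok s" "beats (store s ''h'' 0 0) = beats s"
      by (intro best_ok_cong beats_cong; simp)+
    ultimately have "best_ok ?s = best_ok s" "beats ?s = beats s" by simp_all
    then show ?thesis using ok False by (simp add: beats_def)
  next
    case True
    define s1 where "s1 = store (store s ''h'' 0 1) ''h'' 1 (val ?Y)"
    have s1: "s1 y = s y" if "y \<noteq> ''h''" for y using that by (simp add: s1_def)
    have h: "s1 ''h'' 1 = val ?Y" by (simp add: s1_def)
    let ?c = "PFor ''v'' 1 0 (PAssign ''X'' (var ''v'') (vec ''Y'' ''v''))"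
    define s2 where "s2 = store (store s1 ''F'' 0 1) ''O'' 0 (val ?Y)"
    have run: "?s = (if s ''F'' 0 = 0 \<or> val ?Y < s ''O'' 0 then run ?c s2 else s1)"
      using True by (simp add: test_candidate_def s1_def s2_def)
    show ?thesis
    proof (cases "s ''F'' 0 = 0 \<or> val ?Y < s ''O'' 0")
      case True
      let ?I = "\<lambda>k t. \<forall>v<k. t ''X'' (int v) = s ''Y'' (int v)"
      have "?I n (run ?c s2)"
      proof (rule For_induct[where I = ?I], goal_cases)
        case (2 k t)
        note k = 2(1,2) and fr = 2(3) and IH = 2(4)
        have "t ''Y'' = s ''Y''" using fr by (simp add: s2_def s1)
        then show ?case using IH k by (simp add: less_Suc_eq)
      qed simp_all
      then have X: "array_set n (run ?c s2 ''X'') = ?Y" by (auto simp: array_set_def)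
      have FO: "run ?c s2 ''F'' 0 = 1" "run ?c s2 ''O'' 0 = val ?Y"
        by (simp_all add: sem_unwritten s2_def)
      have s: "?s = run ?c s2" using run True by simp
      have "beats ?s Z" if "beats s Z"
        unfolding beats_def
      proof
        assume "mem Z"
        then have "s ''F'' 0 = 1" "s ''O'' 0 \<le> val Z" using that unfolding beats_def by simp_all
        then show "?s ''F'' 0 = 1 \<and> ?s ''O'' 0 \<le> val Z" using True unfolding s FO by simp
      qed
      moreover have "best_ok ?s" unfolding best_ok_def s X FO using \<open>mem ?Y\<close> by simp
      moreover have "beats ?s ?Y" unfolding beats_def s FO by simp
      ultimately show ?thesis by blast
    next
      case False
      then have "?s = s1" using run by simp
      then show ?thesis using False ok by (auto simp: best_ok_def beats_def s1)
    qed
  qed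
  then show "best_ok ?s" "beats ?s ?Y" "beats s Z \<Longrightarrow> beats ?s Z" by blast+
qed

lemma test_cuts:
  assumes n: "s ''n'' 0 = int n" and ok: "best_ok s" and d: "\<And>v. v < n \<Longrightarrow> s ''d'' (int v) = int (d v)"
    and AB: "array_set n (s ''A'') = A" "array_set n (s ''B'') = B"
  shows "best_ok (run test_cuts s)" and "beats s Z \<Longrightarrow> beats (run test_cuts s) Z"
    and "j \<le> n \<Longrightarrow> beats (run test_cuts s) (({v. v < n \<and> j < d v} \<union> A) - B)"
proof -
  let ?Y = "\<lambda>j. ({v. v < n \<and> j < d v} \<union> A) - B"
  let ?I = "\<lambda>k t. best_ok t \<and> (\<forall>Z. beats s Z \<longrightarrow> beats t Z) \<and> (\<forall>j<k. beats t (?Y j))"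
  have "?I (n + 1) (run test_cuts s)"
    unfolding test_cuts_def
  proof (rule For_induct[where I = ?I], goal_cases)
    case 1
    have "best_ok (store s ''j'' 0 0) = best_ok s" "beats (store s ''j'' 0 0) = beats s"
      by (intro best_ok_cong beats_cong; simp)+
    then show ?case using ok by simp
  next
    case (2 k t)
    note k = 2(1,2) and fr = 2(3) and IH = 2(4)
    have t: "t y = s y" if "y \<notin> {''j'', ''w'', ''Y'', ''h'', ''F'', ''O'', ''v'', ''X''}" for y
      using fr that by simp
    define t1 where "t1 = run (query_set (Less (var ''j'') (vec ''d'' ''w''))) t"
    have t1: "t1 y = t y" if "y \<notin> {''w'', ''Y''}" for y using that by (simp add: t1_def sem_unwritten)
    have tn: "t ''n'' 0 = int n" using n t by simp
    have "array_set n (t1 ''Y'') = ({v. v < n \<and> k < d v} \<union> array_set n (t ''A'')) - array_set n (t ''B'')"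
      unfolding t1_def
    proof (rule query_set[of t, OF tn])
      fix w u assume w: "w < n" "u ''w'' 0 = int w" and u: "\<And>y. y \<noteq> ''w'' \<Longrightarrow> y \<noteq> ''Y'' \<Longrightarrow> u y = t y"
      have "u ''j'' 0 = int k" "u ''d'' (int w) = int (d w)" using u k t d w(1) by simp_all
      then show "bval (Less (var ''j'') (vec ''d'' ''w'')) u \<longleftrightarrow> k < d w" using w(2) by simp
    qed
    then have Y: "array_set n (t1 ''Y'') = ?Y k" using AB t by simp
    have n1: "t1 ''n'' 0 = int n" using tn t1 by simp
    have b: "best_ok t1 = best_ok t" "beats t1 = beats t" using t1 by (intro best_ok_cong beats_cong; simp)+
    let ?t = "run test_candidate t1"
    have T: "best_ok ?t" "beats ?t (?Y k)" "beats t Z \<Longrightarrow> beats ?t Z" for Z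
      using test_candidate[of t1, OF n1] IH Y by (simp_all add: b)
    have "run (query_set (Less (var ''j'') (vec ''d'' ''w'')) ;; test_candidate) t = ?t" by (simp add: t1_def)
    moreover have "best_ok (store ?t ''j'' 0 (int (Suc k))) = best_ok ?t" "beats (store ?t ''j'' 0 (int (Suc k))) = beats ?t"
      by (intro best_ok_cong beats_cong; simp)+
    ultimately show ?case using T IH by (auto simp: less_Suc_eq)
  qed simp
  then show "best_ok (run test_cuts s)" "beats s Z \<Longrightarrow> beats (run test_cuts s) Z"
    "j \<le> n \<Longrightarrow> beats (run test_cuts s) (?Y j)" by (auto simp: less_Suc_eq_le)
qed

lemma clear:
  assumes "s ''n'' 0 = int n"
  shows "array_set n (run clear s ''A'') = {}" "array_set n (run clear s ''B'') = {}"
proof -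
  let ?I = "\<lambda>k t. \<forall>v<k. t ''A'' (int v) = 0 \<and> t ''B'' (int v) = 0"
  have "?I n (run clear s)"
    unfolding clear_def by (rule For_induct[where I = ?I]) (auto simp: less_Suc_eq)
  then show "array_set n (run clear s ''A'') = {}" "array_set n (run clear s ''B'') = {}"
    by (auto simp: array_set_def)
qed

lemma mark:
  assumes c: "\<And>j. j < k \<Longrightarrow> s (ctr_a j) 0 = int (\<alpha> j) \<and> s (ctr_b j) 0 = int (\<beta> j) \<and> \<alpha> j < n \<and> \<beta> j < n"
  shows "array_set n (run (mark k) s ''A'') = array_set n (s ''A'') \<union> \<alpha> ` {..<k}"
    and "array_set n (run (mark k) s ''B'') = array_set n (s ''B'') \<union> \<beta> ` {..<k}"
proof -
  have "array_set n (run (mark k) s ''A'') = array_set n (s ''A'') \<union> \<alpha> ` {..<k} \<and>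
    array_set n (run (mark k) s ''B'') = array_set n (s ''B'') \<union> \<beta> ` {..<k}"
    using c
  proof (induction k)
    case (Suc k)
    let ?t = "run (mark k) s"
    have fr: "?t x = s x" if "x \<notin> {''A'', ''B''}" for x
      using written_mark[of k] that by (intro sem_unwritten) blast
    have "ctr_a k \<notin> {''A'', ''B''}" "ctr_b k \<notin> {''A'', ''B''}" by (simp_all add: counter_eq_Cons)
    then have c: "?t (ctr_a k) 0 = int (\<alpha> k)" "?t (ctr_b k) 0 = int (\<beta> k)" "\<alpha> k < n" "\<beta> k < n"
      using fr Suc.prems[of k] by simp_all
    have b: "store ?t ''A'' x y (ctr_b k) = ?t (ctr_b k)" for x y
      by (rule store_other) (simp add: counter_eq_Cons)
    have ins: "array_set n (r(int v := 1)) = insert v (array_set n r)" if "v < n" for r v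
      using that by (auto simp: array_set_def)
    have "run (mark (Suc k)) s ''A'' = (?t ''A'')(int (\<alpha> k) := 1)" "run (mark (Suc k)) s ''B'' = (?t ''B'')(int (\<beta> k) := 1)"
      using c by (simp_all add: b fun_eq_iff)
    then have "array_set n (run (mark (Suc k)) s ''A'') = insert (\<alpha> k) (array_set n (?t ''A''))"
      "array_set n (run (mark (Suc k)) s ''B'') = insert (\<beta> k) (array_set n (?t ''B''))"
      by (simp_all only: ins c)
    then show ?case using Suc.IH Suc.prems by (simp only: lessThan_Suc image_insert) simp
  qed simp
  then show "array_set n (run (mark k) s ''A'') = array_set n (s ''A'') \<union> \<alpha> ` {..<k}"
    and "array_set n (run (mark k) s ''B'') = array_set n (s ''B'') \<union> \<beta> ` {..<k}" by blast+
qed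

lemma full_set:
  "array_set n (run full_set s ''Y'') = {..<n}"
proof -
  let ?I = "\<lambda>k t. \<forall>v<k. t ''Y'' (int v) = 1"
  have "?I n (run full_set s)"
    unfolding full_set_def by (rule For_induct[where I = ?I]) (auto simp: less_Suc_eq)
  then show ?thesis by (auto simp: array_set_def)
qed

text \<open>\<open>Q \<alpha> \<beta>\<close> is reached when the innermost body runs with the
  counters at \<open>\<alpha>\<close> and \<open>\<beta>\<close>, and persists afterwards. Counters
  from index \<open>i\<close> on belong to the outer loops and already have their values, so the
  induction concerns tuples that agree with them; for \<open>i = k\<close> all tuples are
  covered.\<close>

lemma for_pairs:
  assumes step: "\<And>s. R s \<Longrightarrow> R (run c s)"
    and mono: "\<And>s \<alpha> \<beta>. R s \<Longrightarrow> Q \<alpha> \<beta> s \<Longrightarrow> Q \<alpha> \<beta> (run c s)"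
    and store_R: "\<And>s j v. R s \<Longrightarrow> R (store s (ctr_a j) 0 v) \<and> R (store s (ctr_b j) 0 v)"
    and store_Q: "\<And>s j v \<alpha> \<beta>. Q \<alpha> \<beta> s \<Longrightarrow> Q \<alpha> \<beta> (store s (ctr_a j) 0 v) \<and> Q \<alpha> \<beta> (store s (ctr_b j) 0 v)"
    and hit: "\<And>s \<alpha> \<beta>. R s \<Longrightarrow>
      (\<forall>j<k. s (ctr_a j) 0 = int (\<alpha> j) \<and> s (ctr_b j) 0 = int (\<beta> j) \<and> \<alpha> j < n \<and> \<beta> j < n) \<Longrightarrow> Q \<alpha> \<beta> (run c s)"
    and c: "\<And>j. ctr_a j \<notin> written c \<and> ctr_b j \<notin> written c"
  shows "i \<le> k \<Longrightarrow> R s \<Longrightarrow> R (run (for_pairs i c) s) \<and>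
    (\<forall>\<alpha> \<beta>. Q \<alpha> \<beta> s \<longrightarrow> Q \<alpha> \<beta> (run (for_pairs i c) s)) \<and>
    (\<forall>\<alpha> \<beta>. (\<forall>j<k. \<alpha> j < n \<and> \<beta> j < n \<and> (i \<le> j \<longrightarrow> s (ctr_a j) 0 = int (\<alpha> j) \<and> s (ctr_b j) 0 = int (\<beta> j))) \<longrightarrow>
      Q \<alpha> \<beta> (run (for_pairs i c) s))"
proof (induction i arbitrary: s)
  case 0
  then show ?case using step mono hit by simp
next
  case (Suc i)
  let ?fixed = "\<lambda>i s \<alpha> \<beta>. \<forall>j<k. \<alpha> j < n \<and> \<beta> j < n \<and> (i \<le> j \<longrightarrow> s (ctr_a j) 0 = int (\<alpha> j) \<and> s (ctr_b j) 0 = int (\<beta> j))"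
  have i: "i < k" using Suc.prems by simp
  let ?inner = "PFor (ctr_b i) 1 0 (for_pairs i c)"
  let ?I = "\<lambda>x t. R t \<and> (\<forall>\<alpha> \<beta>. Q \<alpha> \<beta> s \<longrightarrow> Q \<alpha> \<beta> t) \<and>
    (\<forall>\<alpha> \<beta>. ?fixed (Suc i) s \<alpha> \<beta> \<longrightarrow> \<alpha> i < x \<longrightarrow> Q \<alpha> \<beta> t)"
  have "?I n (run (PFor (ctr_a i) 1 0 ?inner) s)"
  proof (rule For_induct[where I = ?I], goal_cases)
    case 1
    show ?case using store_R store_Q Suc.prems by simp
  next
    case (2 x t)
    note x = 2(1,2) and fr = 2(3) and IH = 2(4)
    have t: "t (ctr_a j) = s (ctr_a j) \<and> t (ctr_b j) = s (ctr_b j)" if "Suc i \<le> j" for j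
      using fr[of "ctr_a j"] fr[of "ctr_b j"] c that by (auto simp: written_for_pairs)
    let ?J = "\<lambda>y u. R u \<and> (\<forall>\<alpha> \<beta>. Q \<alpha> \<beta> t \<longrightarrow> Q \<alpha> \<beta> u) \<and>
      (\<forall>\<alpha> \<beta>. ?fixed (Suc i) s \<alpha> \<beta> \<longrightarrow> \<alpha> i = x \<longrightarrow> \<beta> i < y \<longrightarrow> Q \<alpha> \<beta> u)"
    have J: "?J n (run ?inner t)"
    proof (rule For_induct[where I = ?J], goal_cases)
      case 1
      show ?case using store_R store_Q IH by simp
    next
      case (2 y u)
      note y = 2(1,2) and fr' = 2(3) and IH' = 2(4)
      have u: "u (ctr_a j) = t (ctr_a j)" if "i \<le> j" for j
        using fr'[of "ctr_a j"] c that by (auto simp: written_for_pairs)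
      have u': "u (ctr_b j) = t (ctr_b j)" if "Suc i \<le> j" for j
        using fr'[of "ctr_b j"] c that by (auto simp: written_for_pairs)
      have body: "R (run (for_pairs i c) u)" "\<And>\<alpha> \<beta>. Q \<alpha> \<beta> u \<Longrightarrow> Q \<alpha> \<beta> (run (for_pairs i c) u)"
        "\<And>\<alpha> \<beta>. ?fixed i u \<alpha> \<beta> \<Longrightarrow> Q \<alpha> \<beta> (run (for_pairs i c) u)"
        using Suc.IH[of u] i IH' by auto
      have new: "Q \<alpha> \<beta> (run (for_pairs i c) u)" if "?fixed (Suc i) s \<alpha> \<beta>" "\<alpha> i = x" "\<beta> i = y" for \<alpha> \<beta>
      proof (rule body(3), intro allI impI conjI)
        fix j assume j: "j < k"
        show "\<alpha> j < n" "\<beta> j < n" using that(1) j by blast+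
        assume "i \<le> j"
        then consider "j = i" | "Suc i \<le> j" by linarith
        then have "u (ctr_a j) 0 = int (\<alpha> j) \<and> u (ctr_b j) 0 = int (\<beta> j)"
        proof cases
          case 1
          then show ?thesis using u[of i] x(2) y(2) that by simp
        next
          case 2
          then show ?thesis using u[of j] u'[of j] t[of j] that(1) j by simp
        qed
        then show "u (ctr_a j) 0 = int (\<alpha> j)" "u (ctr_b j) 0 = int (\<beta> j)" by blast+
      qed
      show ?case using body new IH' store_R store_Q by (auto simp: less_Suc_eq)
    qed simp
    have "\<beta> i < n" if "?fixed (Suc i) s \<alpha> \<beta>" for \<alpha> \<beta> using that i by blast
    then have "Q \<alpha> \<beta> (run ?inner t)" if "?fixed (Suc i) s \<alpha> \<beta>" "\<alpha> i = x" for \<alpha> \<beta> using J that by blast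
    then show ?case using J IH store_R store_Q by (auto simp: less_Suc_eq)
  qed simp
  note I = this
  show ?case
    unfolding for_pairs.simps
  proof (intro conjI allI impI)
    show "R (run (PFor (ctr_a i) 1 0 ?inner) s)" using I by blast
    show "Q \<alpha> \<beta> (run (PFor (ctr_a i) 1 0 ?inner) s)" if "Q \<alpha> \<beta> s" for \<alpha> \<beta> using I that by blast
    fix \<alpha> \<beta> assume f: "?fixed (Suc i) s \<alpha> \<beta>"
    then have "\<alpha> i < n" using i by blast
    then show "Q \<alpha> \<beta> (run (PFor (ctr_a i) 1 0 ?inner) s)" using I f by blast
  qed
qed


text \<open>Says nothing about feasibility of the interval; only for a certifying pair does
  \<open>beats\<close> turn into a bound on the stored value.\<close>

definition interval_solved :: "nat \<Rightarrow> (nat \<Rightarrow> nat) \<Rightarrow> (nat \<Rightarrow> nat) \<Rightarrow> state \<Rightarrow> bool" where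
  "interval_solved k \<alpha> \<beta> s \<longleftrightarrow> (\<exists>S\<subseteq>{..<n}. beats s ((S \<union> \<alpha> ` {..<k}) - \<beta> ` {..<k}) \<and>
     (\<forall>T\<subseteq>{..<n}. val ((S \<union> \<alpha> ` {..<k}) - \<beta> ` {..<k}) \<le> val ((T \<union> \<alpha> ` {..<k}) - \<beta> ` {..<k})))"

end

section \<open>Minimizing over one interval and over all of them\<close>

locale submodular_oracles = oracles +
  assumes val_submod: "X \<subseteq> {..<n} \<Longrightarrow> Y \<subseteq> {..<n} \<Longrightarrow> val (X \<union> Y) + val (X \<inter> Y) \<le> val X + val Y"
begin

lemma minimization_cut:
  assumes "A \<subseteq> {..<n}"
  shows "minimization n val A B"
proof
  fix X Y assume XY: "X \<subseteq> {..<n}" "Y \<subseteq> {..<n}"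
  have "X \<union> Y \<union> A - B = (X \<union> A - B) \<union> (Y \<union> A - B)" "X \<inter> Y \<union> A - B = (X \<union> A - B) \<inter> (Y \<union> A - B)"
    by auto
  moreover have "X \<union> A - B \<subseteq> {..<n}" "Y \<union> A - B \<subseteq> {..<n}" using XY assms by blast+
  ultimately show "val (X \<union> Y \<union> A - B) + val (X \<inter> Y \<union> A - B) \<le> val (X \<union> A - B) + val (Y \<union> A - B)"
    using val_submod[of "X \<union> A - B" "Y \<union> A - B"] by presburger
qed

lemma search_interval:
  assumes n: "s ''n'' 0 = int n" and ok: "best_ok s"
  shows "best_ok (run (search_interval k) s)"
    and "beats s Z \<Longrightarrow> beats (run (search_interval k) s) Z"
    and "(\<And>j. j < k \<Longrightarrow> s (ctr_a j) 0 = int (\<alpha> j) \<and> s (ctr_b j) 0 = int (\<beta> j) \<and> \<alpha> j < n \<and> \<beta> j < n) \<Longrightarrow>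
      interval_solved k \<alpha> \<beta> (run (search_interval k) s)"
proof -
  define s1 where "s1 = run (mark k) (run clear s)"
  have s1: "s1 y = s y" if "y \<notin> {''v'', ''A'', ''B''}" for y
  proof -
    have "y \<notin> written (mark k)" using written_mark[of k] that by blast
    then show ?thesis using that by (simp add: s1_def sem_unwritten)
  qed
  define A where "A = array_set n (s1 ''A'')"
  define B where "B = array_set n (s1 ''B'')"
  have A: "A \<subseteq> {..<n}" unfolding A_def array_set_def by auto
  interpret minimization n val mem A B by (rule minimization_cut[OF A])
  have env: "env s1" using n by (simp add: env_def A_def[symmetric] B_def[symmetric] s1)
  define s2 where "s2 = run minimize s1"
  obtain d j where d: "\<And>v. v < n \<Longrightarrow> s2 ''d'' (int v) = int (d v)" and j: "j \<le> n"
    and opt: "\<And>T. T \<subseteq> {..<n} \<Longrightarrow> val (({v. v < n \<and> j < d v} \<union> A) - B) \<le> val ((T \<union> A) - B)"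
    using minimize_cut[OF env] unfolding s2_def by blast
  have s2: "s2 y = s1 y" if "y \<in> {''n'', ''A'', ''B'', ''F'', ''O'', ''X''}" for y
  proof -
    have "y \<notin> written minimize"
      using that by (auto simp: minimize_def written_iterated counter_eq_Cons)
    then show ?thesis by (simp add: s2_def sem_unwritten)
  qed
  have same: "s2 ''F'' = s ''F''" "s2 ''O'' = s ''O''" "s2 ''X'' = s ''X''" "s2 ''n'' 0 = int n"
    using n by (simp_all add: s2 s1)
  have ok2: "best_ok s2" using ok best_ok_cong[OF same(1,2,3)] by simp
  have beats2: "beats s2 = beats s" by (rule beats_cong[OF same(1,2)])
  have AB: "array_set n (s2 ''A'') = A" "array_set n (s2 ''B'') = B" by (simp_all add: s2 A_def B_def)
  have run: "run (search_interval k) s = run test_cuts s2"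
    by (simp add: search_interval_def s1_def s2_def)
  note C = test_cuts[of s2 d A B, OF same(4) ok2 d AB]
  show "best_ok (run (search_interval k) s)" unfolding run using C(1) by blast
  show "beats s Z \<Longrightarrow> beats (run (search_interval k) s) Z" unfolding run using C(2) beats2 by simp
  assume c: "\<And>j. j < k \<Longrightarrow> s (ctr_a j) 0 = int (\<alpha> j) \<and> s (ctr_b j) 0 = int (\<beta> j) \<and> \<alpha> j < n \<and> \<beta> j < n"
  have "run clear s (ctr_a j) = s (ctr_a j)" "run clear s (ctr_b j) = s (ctr_b j)" for j
    by (rule sem_unwritten; simp add: counter_eq_Cons)+
  then have "A = \<alpha> ` {..<k}" "B = \<beta> ` {..<k}"
    using mark[of k "run clear s" \<alpha> \<beta>] clear[of s] n c unfolding A_def B_def s1_def by simp_all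
  moreover have "beats (run test_cuts s2) (({v. v < n \<and> j < d v} \<union> A) - B)" using C(3) j by blast
  moreover have "{v. v < n \<and> j < d v} \<subseteq> {..<n}" by auto
  ultimately show "interval_solved k \<alpha> \<beta> (run (search_interval k) s)"
    unfolding interval_solved_def run using opt by blast
qed

text \<open>The certificate of \<open>X\<close> is among the enumerated pairs. The minimizer found
  for it is feasible because the whole interval is, and it is at least as good as \<open>X\<close>,
  which lies in the interval too.\<close>

lemma algorithm_finds_minimizer:
  assumes cover: "\<And>X. X \<subseteq> {..<n} \<Longrightarrow> mem X \<Longrightarrow> X \<noteq> {} \<Longrightarrow> X \<noteq> {..<n} \<Longrightarrow>
    \<exists>\<alpha> \<beta>. (\<forall>j<k. \<alpha> j \<in> X \<and> \<beta> j \<in> {..<n} - X) \<and>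
      (\<forall>T\<subseteq>{..<n}. \<alpha> ` {..<k} \<subseteq> T \<longrightarrow> \<beta> ` {..<k} \<inter> T = {} \<longrightarrow> mem T)"
    and X: "X \<subseteq> {..<n}" "mem X"
  defines "S \<equiv> array_set n (run (algorithm k) (input_state n) ''X'')"
  shows "mem S" and "val S \<le> val X"
proof -
  let ?s = "input_state n"
  have n0: "?s ''n'' 0 = int n" by (simp add: input_state_def)
  have ok0: "best_ok ?s" by (simp add: best_ok_def input_state_def)
  have Y0: "array_set n (?s ''Y'') = {}" by (simp add: input_state_def array_set_def)
  define s1 where "s1 = run test_candidate ?s"
  note T1 = test_candidate[of ?s, OF n0 ok0, folded s1_def, unfolded Y0]
  define s2 where "s2 = run full_set s1"
  have n1: "s1 ''n'' 0 = int n" using n0 by (simp add: s1_def sem_unwritten)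
  have s2: "s2 y = s1 y" if "y \<notin> {''v'', ''Y''}" for y using that by (simp add: s2_def sem_unwritten)
  have eq2: "best_ok s2 = best_ok s1" "beats s2 = beats s1" using s2 by (intro best_ok_cong beats_cong; simp)+
  have n2: "s2 ''n'' 0 = int n" and ok2: "best_ok s2" using n1 s2 eq2 T1(1) by simp_all
  define s3 where "s3 = run test_candidate s2"
  have Y2: "array_set n (s2 ''Y'') = {..<n}" unfolding s2_def by (rule full_set)
  note T3 = test_candidate[of s2, OF n2 ok2, folded s3_def, unfolded Y2 eq2]
  have n3: "s3 ''n'' 0 = int n" using n2 by (simp add: s3_def sem_unwritten)
  let ?c = "search_interval k"
  let ?R = "\<lambda>s. s ''n'' 0 = int n \<and> best_ok s \<and> beats s {} \<and> beats s {..<n}"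
  let ?Q = "interval_solved k"
  have store: "best_ok (store s (ctr_a j) 0 v) = best_ok s" "best_ok (store s (ctr_b j) 0 v) = best_ok s"
    "beats (store s (ctr_a j) 0 v) = beats s" "beats (store s (ctr_b j) 0 v) = beats s"
    "store s (ctr_a j) 0 v ''n'' = s ''n''" "store s (ctr_b j) 0 v ''n'' = s ''n''" for s j v
    by (rule best_ok_cong beats_cong store_other; simp add: counter_eq_Cons)+
  have "run (for_pairs k ?c) s3 = run (algorithm k) ?s"
    by (simp add: algorithm_def s1_def s2_def s3_def)
  moreover have "?R (run (for_pairs k ?c) s3) \<and> (\<forall>\<alpha> \<beta>. ?Q \<alpha> \<beta> s3 \<longrightarrow> ?Q \<alpha> \<beta> (run (for_pairs k ?c) s3)) \<and>
    (\<forall>\<alpha> \<beta>. (\<forall>j<k. \<alpha> j < n \<and> \<beta> j < n \<and> (k \<le> j \<longrightarrow> s3 (ctr_a j) 0 = int (\<alpha> j) \<and> s3 (ctr_b j) 0 = int (\<beta> j))) \<longrightarrow>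
      ?Q \<alpha> \<beta> (run (for_pairs k ?c) s3))"
  proof (rule for_pairs[where R = ?R and Q = ?Q])
    show "?R (run ?c s)" if "?R s" for s
      using search_interval(1,2)[of s] that counters_not_written(3)[of k] by (simp add: sem_unwritten)
    show "?Q \<alpha> \<beta> (run ?c s)" if "?R s" "?Q \<alpha> \<beta> s" for s \<alpha> \<beta>
      using search_interval(2)[of s] that unfolding interval_solved_def by blast
    show "?R (store s (ctr_a j) 0 v) \<and> ?R (store s (ctr_b j) 0 v)" if "?R s" for s j v
      using that by (simp add: store)
    show "?Q \<alpha> \<beta> (store s (ctr_a j) 0 v) \<and> ?Q \<alpha> \<beta> (store s (ctr_b j) 0 v)" if "?Q \<alpha> \<beta> s" for s j v \<alpha> \<beta>
      using that unfolding interval_solved_def by (simp add: store)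
    show "?Q \<alpha> \<beta> (run ?c s)"
      if "?R s" "\<forall>j<k. s (ctr_a j) 0 = int (\<alpha> j) \<and> s (ctr_b j) 0 = int (\<beta> j) \<and> \<alpha> j < n \<and> \<beta> j < n" for s \<alpha> \<beta>
      using search_interval(3)[of s k \<alpha> \<beta>] that by blast
    show "?R s3" using n3 T1(2) T3 by simp
  qed (use counters_not_written in simp_all)
  ultimately have R: "?R (run (algorithm k) ?s)"
    and Q: "\<And>\<alpha> \<beta>. (\<forall>j<k. \<alpha> j < n \<and> \<beta> j < n) \<Longrightarrow> ?Q \<alpha> \<beta> (run (algorithm k) ?s)" by simp_all
  let ?t = "run (algorithm k) ?s"
  have "?t ''F'' 0 = 1 \<and> ?t ''O'' 0 \<le> val X"
  proof (cases "X = {} \<or> X = {..<n}")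
    case True
    then show ?thesis using R X unfolding beats_def by blast
  next
    case False
    then obtain \<alpha> \<beta> where ab: "\<forall>j<k. \<alpha> j \<in> X \<and> \<beta> j \<in> {..<n} - X"
      and T: "\<And>T. T \<subseteq> {..<n} \<Longrightarrow> \<alpha> ` {..<k} \<subseteq> T \<Longrightarrow> \<beta> ` {..<k} \<inter> T = {} \<Longrightarrow> mem T"
      using cover[OF X] by blast
    have "\<forall>j<k. \<alpha> j < n \<and> \<beta> j < n" using ab X(1) by auto
    from Q[OF this] obtain S where S: "S \<subseteq> {..<n}" "beats ?t ((S \<union> \<alpha> ` {..<k}) - \<beta> ` {..<k})"
      "val ((S \<union> \<alpha> ` {..<k}) - \<beta> ` {..<k}) \<le> val ((X \<union> \<alpha> ` {..<k}) - \<beta> ` {..<k})"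
      unfolding interval_solved_def using X(1) by blast
    have "\<alpha> ` {..<k} \<subseteq> X" "\<beta> ` {..<k} \<inter> X = {}" using ab by auto
    \<comment> \<open>\<open>X\<close> lies in its own interval, so the transformation fixes it.
      Disjointness of the two sets puts the transformed \<open>S\<close> into the certified interval
      as well.\<close>
    then have "(X \<union> \<alpha> ` {..<k}) - \<beta> ` {..<k} = X" "\<alpha> ` {..<k} \<inter> \<beta> ` {..<k} = {}" "\<alpha> ` {..<k} \<subseteq> {..<n}"
      using X(1) by blast+
    moreover from this have "mem ((S \<union> \<alpha> ` {..<k}) - \<beta> ` {..<k})" using S(1) by (intro T) blast+
    ultimately show ?thesis using S(2,3) unfolding beats_def by fastforce
  qed
  moreover from this have "mem S \<and> val S = ?t ''O'' 0"
    using R unfolding S_def best_ok_def by (metis zero_neq_one)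
  ultimately show "mem S" and "val S \<le> val X" by simp_all
qed

end

section \<open>Intersections of complements of lattices\<close>

lemma set_lattice_finite:
  assumes L: "set_lattice L" and I: "finite I" "I \<noteq> {}" and X: "\<And>i. i \<in> I \<Longrightarrow> X i \<in> L"
  shows "(\<Union>i\<in>I. X i) \<in> L" and "(\<Inter>i\<in>I. X i) \<in> L"
proof -
  have "(\<Union>i\<in>I. X i) \<in> L \<and> (\<Inter>i\<in>I. X i) \<in> L"
    using I X
  proof (induction I rule: finite_ne_induct)
    case (insert i I)
    then have "X i \<in> L" "(\<Union>i\<in>I. X i) \<in> L" "(\<Inter>i\<in>I. X i) \<in> L" by blast+
    then show ?case using L unfolding set_lattice_def by simp
  qed simp
  then show "(\<Union>i\<in>I. X i) \<in> L" and "(\<Inter>i\<in>I. X i) \<in> L" by blast+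
qed

text \<open>A lattice is closed only under nonempty unions and intersections and may lack
  \<open>{}\<close> and \<open>V\<close>. The union below runs over \<open>X\<close> and the
  intersections over \<open>V - X\<close>, which explains the two exceptional sets.\<close>

lemma not_in_lattice_separation:
  assumes L: "set_lattice L" "L \<subseteq> Pow V" and V: "finite V" and X: "X \<subseteq> V" "X \<notin> L" "X \<noteq> {}" "X \<noteq> V"
  shows "\<exists>u\<in>X. \<exists>v\<in>V - X. \<forall>T. u \<in> T \<longrightarrow> v \<notin> T \<longrightarrow> T \<notin> L"
proof (rule ccontr)
  assume "\<not> ?thesis"
  then have "\<forall>u\<in>X. \<forall>v\<in>V - X. \<exists>T. u \<in> T \<and> v \<notin> T \<and> T \<in> L" by blast
  then obtain T where T: "\<And>u v. u \<in> X \<Longrightarrow> v \<in> V - X \<Longrightarrow> u \<in> T u v \<and> v \<notin> T u v \<and> T u v \<in> L"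
    by metis
  have fin: "finite X" "finite (V - X)" using V X(1) finite_subset by auto
  have ne: "V - X \<noteq> {}" using X by blast
  \<comment> \<open>The intersection avoids all of \<open>V - X\<close> and is a member of
    \<open>L\<close>, hence a subset of \<open>V\<close>; so it lies between {u} and
    \<open>X\<close>.\<close>
  define S where "S u = (\<Inter>v\<in>V - X. T u v)" for u
  have S: "S u \<in> L" if "u \<in> X" for u
    unfolding S_def using T[OF that] by (intro set_lattice_finite(2)[OF L(1) fin(2) ne]) blast
  have "S u \<subseteq> X" if u: "u \<in> X" for u
  proof
    fix w assume w: "w \<in> S u"
    then have "w \<in> V" using S[OF u] L(2) by blast
    moreover have "w \<notin> V - X" using w T[OF u] unfolding S_def by blast
    ultimately show "w \<in> X" by blast
  qed
  moreover have "u \<in> S u" if "u \<in> X" for u unfolding S_def using T[OF that] by blast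
  ultimately have "(\<Union>u\<in>X. S u) = X" by blast
  moreover have "(\<Union>u\<in>X. S u) \<in> L" using S by (intro set_lattice_finite(1)[OF L(1) fin(1) X(3)])
  ultimately show False using X(2) by simp
qed

theorem corollary4p2:
  fixes k :: nat
  assumes "k > 0"
  shows "\<exists>(c :: com) (p :: nat poly).
    \<forall>(V :: 'a set) (e :: nat \<Rightarrow> 'a) (f :: 'a set \<Rightarrow> int) (L :: nat \<Rightarrow> 'a set set) (F :: 'a set set).
      finite V \<longrightarrow> bij_betw e {..<card V} V \<longrightarrow>
      submodular_on V f \<longrightarrow>
      (\<forall>i\<in>{1..k}. L i \<subseteq> Pow V \<and> set_lattice (L i)) \<longrightarrow>
      F = (\<Inter>i\<in>{1..k}. Pow V - L i) \<longrightarrow>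
      finds_minimizer_within c (poly p (card V)) e V f F"
proof (intro exI allI impI)
  fix V :: "'a set" and e f L F
  assume V: "finite V" and e: "bij_betw e {..<card V} V" and sub: "submodular_on V f"
    and L: "\<forall>i\<in>{1..k}. L i \<subseteq> Pow V \<and> set_lattice (L i)" and F: "F = (\<Inter>i\<in>{1..k}. Pow V - L i)"
  define n where "n = card V"
  define val where "val S = f (e ` S)" for S
  define mem where "mem S \<longleftrightarrow> e ` S \<in> F" for S
  have inj: "inj_on e {..<n}" and img: "e ` {..<n} = V"
    using e unfolding bij_betw_def n_def by auto
  have sub_img: "e ` S \<subseteq> V" if "S \<subseteq> {..<n}" for S using that img by blast
  interpret submodular_oracles n val mem
  proof
    fix X Y assume XY: "X \<subseteq> {..<n}" "Y \<subseteq> {..<n}"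
    have "e ` (X \<inter> Y) = e ` X \<inter> e ` Y" using inj_on_image_Int[OF inj XY] .
    then show "val (X \<union> Y) + val (X \<inter> Y) \<le> val X + val Y"
      using sub sub_img[OF XY(1)] sub_img[OF XY(2)] unfolding submodular_on_def val_def image_Un by auto
  qed
  have cover: "\<exists>\<alpha> \<beta>. (\<forall>j<k. \<alpha> j \<in> X \<and> \<beta> j \<in> {..<n} - X) \<and>
      (\<forall>T\<subseteq>{..<n}. \<alpha> ` {..<k} \<subseteq> T \<longrightarrow> \<beta> ` {..<k} \<inter> T = {} \<longrightarrow> mem T)"
    if X: "X \<subseteq> {..<n}" "mem X" "X \<noteq> {}" "X \<noteq> {..<n}" for X
  proof -
    have eX: "e ` X \<subseteq> V" "e ` X \<noteq> {}" "e ` X \<noteq> V"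
      using X img inj_on_image_eq_iff[OF inj X(1), of "{..<n}"] by auto
    \<comment> \<open>One separating pair for each lattice, which is why \<open>k\<close> elements
      on each side suffice. The shift by \<open>Suc\<close> matches program counters from 0 with
      lattices numbered from 1.\<close>
    have "\<exists>a b. a \<in> X \<and> b \<in> {..<n} - X \<and> (\<forall>T\<subseteq>{..<n}. a \<in> T \<longrightarrow> b \<notin> T \<longrightarrow> e ` T \<notin> L (Suc j))" if j: "j < k" for j
    proof -
      have "Suc j \<in> {1..k}" using j by simp
      then have "L (Suc j) \<subseteq> Pow V" "set_lattice (L (Suc j))" "e ` X \<notin> L (Suc j)"
        using L X(2) unfolding mem_def F by blast+
      then obtain u v where u: "u \<in> e ` X" and v: "v \<in> V - e ` X"
        and uv: "\<And>T. u \<in> T \<Longrightarrow> v \<notin> T \<Longrightarrow> T \<notin> L (Suc j)"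
        using not_in_lattice_separation[of "L (Suc j)" V "e ` X"] V eX by blast
      obtain a b where ab: "a \<in> X" "u = e a" "b \<in> {..<n} - X" "v = e b"
        using u v img by blast
      have b: "b \<in> {..<n}" using ab(3) by blast
      have "e ` T \<notin> L (Suc j)" if T: "T \<subseteq> {..<n}" "a \<in> T" "b \<notin> T" for T
      proof (rule uv)
        show "u \<in> e ` T" using T(2) ab(2) by blast
        show "v \<notin> e ` T" using inj_on_image_mem_iff[OF inj b T(1)] T(3) ab(4) by simp
      qed
      then show ?thesis using ab(1,3) by blast
    qed
    then obtain \<alpha> \<beta> where ab: "\<And>j. j < k \<Longrightarrow> \<alpha> j \<in> X \<and> \<beta> j \<in> {..<n} - X \<and>
        (\<forall>T\<subseteq>{..<n}. \<alpha> j \<in> T \<longrightarrow> \<beta> j \<notin> T \<longrightarrow> e ` T \<notin> L (Suc j))" by metis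
    have "mem T" if T: "T \<subseteq> {..<n}" "\<alpha> ` {..<k} \<subseteq> T" "\<beta> ` {..<k} \<inter> T = {}" for T
    proof -
      have "e ` T \<notin> L i" if "i \<in> {1..k}" for i
      proof -
        obtain j where j: "i = Suc j" "j < k" using \<open>i \<in> {1..k}\<close> by (cases i) auto
        then have "\<alpha> j \<in> T" "\<beta> j \<notin> T" using T by auto
        then show ?thesis using ab[OF j(2)] T(1) j(1) by blast
      qed
      then show ?thesis using sub_img[OF T(1)] unfolding mem_def F by blast
    qed
    then show ?thesis using ab by blast
  qed
  let ?c = "algorithm k"
  have "input_state n ''n'' 0 = int n" by (simp add: input_state_def)
  then obtain t where t: "t \<le> poly (time_poly ?c) n"
      "exec n val mem (compile ?c) (input_state n) t (run ?c (input_state n))"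
    using compile_correct[OF counters_safe_algorithm n_not_written_algorithm] by blast
  let ?S = "array_set n (run ?c (input_state n) ''X'')"
  have "minimizer f F (e ` ?S)" if "F \<noteq> {}"
  proof -
    have pull: "\<exists>X\<subseteq>{..<n}. Y = e ` X \<and> mem X" if "Y \<in> F" for Y
    proof -
      \<comment> \<open>The place where \<open>k > 0\<close> enters: lattice 1 exists, so the
        intersection is over a nonempty index set and stays within the subsets of
        \<open>V\<close>.\<close>
      have "Y \<subseteq> V" using that assms unfolding F by (auto dest: bspec[of _ _ 1])
      then obtain X where "X \<subseteq> {..<n}" "Y = e ` X" using img by (metis subset_imageE)
      then show ?thesis using that unfolding mem_def by blast
    qed
    have "f (e ` ?S) \<le> f Y" and "e ` ?S \<in> F" if "Y \<in> F" for Y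
    proof -
      obtain X where X: "X \<subseteq> {..<n}" "Y = e ` X" "mem X" using pull[OF \<open>Y \<in> F\<close>] by blast
      then show "f (e ` ?S) \<le> f Y" "e ` ?S \<in> F"
        using algorithm_finds_minimizer[OF cover X(1,3)] unfolding mem_def val_def by auto
    qed
    then show ?thesis using \<open>F \<noteq> {}\<close> unfolding minimizer_def by blast
  qed
  then show "finds_minimizer_within (compile ?c) (poly (time_poly ?c) (card V)) e V f F"
    using t unfolding finds_minimizer_within_def n_def val_def mem_def by blast
qed

end
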